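(* Let $t\ge2$ be a fixed integer. Then for all sufficiently large $n$, $$\mathrm{ex}(n,K_3,C_{2t+1}^{\triangle})=\left|\mathcal{S}_{\mathrm{bi}}(n,t)\right|\quad\text{and}\quad\mathrm{ex}(n,K_3,C_{2t+2}^{\triangle})=\left|\mathcal{S}^{+}_{\mathrm{bi}}(n,t)\right|.$$
   Context: $C_k$ is the cycle of length $k$. The $\triangle$-blowup $F^{\triangle}$ of a graph $F$ is obtained by replacing each edge $uv$ by a triangle $uvw_{uv}$ with a new vertex $w_{uv}$, distinct edges receiving distinct new vertices. $\mathrm{ex}(n,K_3,F^{\triangle})$ is the maximum number of triangles in an $n$-vertex graph with no copy of $F^{\triangle}$. $T(m)$ is the balanced complete bipartite graph on $m$ vertices and $T^{+}(m)$ is obtained from $T(m)$ by adding one edge inside the smaller part. $S(n,t)=K_t\vee T(n-t)$ and $S^{+}(n,t)=K_t\vee T^{+}(n-t)$ are joins (disjoint copies plus all edges between them). $\mathcal{S}_{\mathrm{bi}}(n,t)$ and $\mathcal{S}^{+}_{\mathrm{bi}}(n,t)$ are the sets of triangles of $S(n,t)$ and $S^{+}(n,t)$, respectively. *)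

theory Defs
  imports Main
begin

definition graph_on :: "'a set \<Rightarrow> 'a set set \<Rightarrow> bool" where
  "graph_on V E \<longleftrightarrow> (\<forall>e\<in>E. e \<subseteq> V \<and> card e = 2)"

definition triangles :: "'a set \<Rightarrow> 'a set set \<Rightarrow> 'a set set" where
  "triangles V E = {T. T \<subseteq> V \<and> card T = 3 \<and> (\<forall>x\<in>T. \<forall>y\<in>T. x \<noteq> y \<longrightarrow> {x, y} \<in> E)}"

definition contains_copy :: "'b set \<Rightarrow> 'b set set \<Rightarrow> 'a set \<Rightarrow> 'a set set \<Rightarrow> bool" where
  "contains_copy W F V E \<longleftrightarrow>
     (\<exists>f. inj_on f W \<and> f ` W \<subseteq> V \<and> (\<forall>e\<in>F. f ` e \<in> E))"

definition cycle_V :: "nat \<Rightarrow> nat set" where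
  "cycle_V k = {0..<k}"

definition cycle_E :: "nat \<Rightarrow> nat set set" where
  "cycle_E k = {{i, (i + 1) mod k} | i. i < k}"

(* triangle blowup: every edge uv gets its own new vertex w_uv (= Inr {u,v}) forming triangle u v w_uv *)
definition blowup_V :: "'a set \<Rightarrow> 'a set set \<Rightarrow> ('a + 'a set) set" where
  "blowup_V V E = Inl ` V \<union> Inr ` E"

definition blowup_E :: "'a set \<Rightarrow> 'a set set \<Rightarrow> ('a + 'a set) set set" where
  "blowup_E V E = (\<lambda>e. Inl ` e) ` E \<union> {{Inl u, Inr e} | u e. e \<in> E \<and> u \<in> e}"

definition ex_triangles :: "nat \<Rightarrow> 'b set \<Rightarrow> 'b set set \<Rightarrow> nat" where
  "ex_triangles n W F = Max {card (triangles {0..<n} E) | E.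
       graph_on {0..<n} E \<and> \<not> contains_copy W F {0..<n} E}"

(* S(n,t) = K_t join T(n-t) on vertex set {0..<n}: vertices < t form the K_t,
   part A = {t..< t + (n-t) div 2} (the smaller part), part B = {t + (n-t) div 2 ..< n} *)
definition S_edges :: "nat \<Rightarrow> nat \<Rightarrow> nat set set" where
  "S_edges n t = {{u, v} | u v. u < n \<and> v < n \<and> u \<noteq> v \<and>
       (u < t \<or> v < t \<or>
        (t \<le> u \<and> u < t + (n - t) div 2 \<and> t + (n - t) div 2 \<le> v))}"

(* S^+(n,t): additionally one edge inside the smaller part A *)
definition Splus_edges :: "nat \<Rightarrow> nat \<Rightarrow> nat set set" where
  "Splus_edges n t = insert {t, t + 1} (S_edges n t)"

definition S_bi :: "nat \<Rightarrow> nat \<Rightarrow> nat set set" where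
  "S_bi n t = triangles {0..<n} (S_edges n t)"

definition S_bi_plus :: "nat \<Rightarrow> nat \<Rightarrow> nat set set" where
  "S_bi_plus n t = triangles {0..<n} (Splus_edges n t)"

end

theory Submission
  imports Complex_Main Defs
begin

text \<open>
  A copy of the blow-up of a cycle is a loose cycle of triangles. After peeling off edges in few
  triangles, every edge has at least \<open>t\<close> common neighbours, and choosing one for each edge of a
  large complete bipartite subgraph colours a grid. By canonical Ramsey theory such a colouring may be taken to be
  constant, injective, or an injective function of one side. If \<open>t + 1\<close> disjoint choices are possible,
  they yield loose cycles of both lengths; if only \<open>t\<close> are, all of them are constant, which gives
  \<open>t\<close> vertices joined to the whole grid. Hence a graph without both cycles has at most \<open>t\<close>
  triangles per edge up to \<open>o(n\<^sup>2)\<close>. In an extremal graph the peeled subgraph has about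
  \<open>n\<^sup>2 / 4\<close> edges but only \<open>O(n\<^sup>2)\<close> triangles, so it is almost complete balanced
  bipartite, with \<open>t\<close> vertices joined to almost all of it. When the two parts are chosen as large as
  possible, each vertex left over accounts for fewer triangles than a vertex inside the parts, so none is
  left, and the edges inside the parts are controlled by closing loose paths through the \<open>t\<close> centres.
\<close>

text \<open>Two obstacles shape the argument. The first is parity: a loose path whose core runs
  through a bipartite grid has a length whose parity is fixed by its ends, while either of the two
  cycles may be the missing one. All asymptotic work therefore assumes only \<open>free t E\<close>,
  the absence of at least one of the two lengths, and every grid argument has to produce both
  cycles. In a grid of distinct apexes the parity is changed by a detour over the other two edges of
  a triangle. The second obstacle is the borderline codegree \<open>t\<close>. Peeling at codegree
  at most \<open>t\<close> bounds the number of triangles, but it would destroy the extremal graph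
  itself, where almost all edges lie in exactly \<open>t\<close> triangles. \<open>tight\<close>
  keeps such edges and only forbids two of them in one triangle. Reaching it costs at most
  \<open>t - 1 / 2\<close> triangles per deleted edge, strictly less than the average of about
  \<open>t\<close> per edge of the whole graph, and this gap forces the peeled graph to keep about
  \<open>n^2 / 4\<close> edges.\<close>

section \<open>Neighbourhoods and common neighbourhoods\<close>

definition nb :: "'a set set \<Rightarrow> 'a \<Rightarrow> 'a set" where
  "nb E x = {y. {x, y} \<in> E}"

definition cn :: "'a set set \<Rightarrow> 'a \<Rightarrow> 'a \<Rightarrow> 'a set" where
  "cn E x y = nb E x \<inter> nb E y"

lemma cn_iff: "z \<in> cn E x y \<longleftrightarrow> {x, z} \<in> E \<and> {y, z} \<in> E"
  by (simp add: cn_def nb_def)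

lemma cn_commute: "cn E x y = cn E y x"
  by (auto simp: cn_def)

lemma graph_on_subset: "graph_on V E \<Longrightarrow> E' \<subseteq> E \<Longrightarrow> graph_on V E'"
  by (auto simp: graph_on_def)

lemma graph_on_neq: "graph_on V E \<Longrightarrow> {x, y} \<in> E \<Longrightarrow> x \<noteq> y"
  by (auto simp: graph_on_def)

lemma graph_on_loop: "graph_on V E \<Longrightarrow> {x} \<notin> E"
  by (auto simp: graph_on_def)

lemma graph_on_in: "graph_on V E \<Longrightarrow> {x, y} \<in> E \<Longrightarrow> x \<in> V \<and> y \<in> V"
  by (auto simp: graph_on_def)

lemma nb_subset: "graph_on V E \<Longrightarrow> nb E x \<subseteq> V"
  by (auto simp: nb_def graph_on_def)

lemma cn_subset: "graph_on V E \<Longrightarrow> cn E x y \<subseteq> V"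
  by (auto simp: nb_def cn_def graph_on_def)

lemma finite_nb: "graph_on V E \<Longrightarrow> finite V \<Longrightarrow> finite (nb E x)"
  by (meson finite_subset nb_subset)

lemma finite_cn: "graph_on V E \<Longrightarrow> finite V \<Longrightarrow> finite (cn E x y)"
  by (meson finite_subset cn_subset)

lemma graph_on_finite: "graph_on V E \<Longrightarrow> finite V \<Longrightarrow> finite E"
  by (rule finite_subset[of E "Pow V"]) (auto simp: graph_on_def)

lemma graph_on_edge: "graph_on V E \<Longrightarrow> e \<in> E \<Longrightarrow> \<exists>x y. e = {x, y} \<and> x \<noteq> y \<and> x \<in> V \<and> y \<in> V"
  unfolding graph_on_def by (metis card_2_iff insert_subset)

text \<open>All greedy choices go through this: \<open>F\<close> collects what is already used, and
  only sizes have to be compared. The cardinality condition makes \<open>S\<close> finite, since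
  \<open>card\<close> is 0 on infinite sets.\<close>

lemma fresh:
  assumes "finite F" "card F < card S"
  obtains x where "x \<in> S" "x \<notin> F"
  using assms by (metis card_mono leD subsetI)

lemma card_insert_bound: "finite F \<Longrightarrow> card (insert x F) \<le> Suc (card F)"
  by (simp add: card_insert_if)

subsection \<open>Loose paths and cycles\<close>

text \<open>The last argument collects all vertices of the path, apexes of the triangles included.\<close>
inductive lpath :: "'a set set \<Rightarrow> 'a \<Rightarrow> 'a \<Rightarrow> nat \<Rightarrow> 'a set \<Rightarrow> bool" for E where
  base: "lpath E x x 0 {x}"
| step: "lpath E y z l U \<Longrightarrow> {x, y} \<in> E \<Longrightarrow> {x, a} \<in> E \<Longrightarrow> {y, a} \<in> E \<Longrightarrow>
    x \<notin> U \<Longrightarrow> a \<notin> U \<Longrightarrow> x \<noteq> a \<Longrightarrow> lpath E x z (Suc l) (insert x (insert a U))"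

text \<open>The cycle is cut open at one of its triangles: \<open>x\<close> and \<open>y\<close> are
  the core vertices of that triangle and \<open>a\<close> is its apex, so what remains is a path
  with one triangle less.\<close>

definition lcyc :: "'a set set \<Rightarrow> nat \<Rightarrow> bool" where
  "lcyc E k \<longleftrightarrow> (\<exists>x y a U. lpath E x y (k - 1) U \<and> a \<notin> U \<and> {x, y} \<in> E \<and> {x, a} \<in> E \<and> {y, a} \<in> E)"

lemma lpath_ends: "lpath E x y l U \<Longrightarrow> x \<in> U \<and> y \<in> U"
  by (induction rule: lpath.induct) auto

lemma lpath_card: "lpath E x y l U \<Longrightarrow> finite U \<and> card U = 2 * l + 1"
  by (induction rule: lpath.induct) auto

lemma lpath_mono: "lpath E x y l U \<Longrightarrow> E \<subseteq> E' \<Longrightarrow> lpath E' x y l U"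
proof (induction rule: lpath.induct)
  case (step y z l U x a)
  then show ?case by (intro lpath.step) auto
qed (rule lpath.base)

lemma lcyc_mono: "lcyc E k \<Longrightarrow> E \<subseteq> E' \<Longrightarrow> lcyc E' k"
  unfolding lcyc_def by (meson lpath_mono subsetD)

lemma lpath_tri:
  assumes "graph_on V E" "{x, y} \<in> E" "{x, a} \<in> E" "{y, a} \<in> E"
  shows "lpath E x y 1 {x, y, a}"
proof -
  have "lpath E x y (Suc 0) (insert x (insert a {y}))"
    using assms graph_on_neq[OF assms(1)] by (intro lpath.step[OF lpath.base]) blast+
  then show ?thesis by (simp add: insert_commute)
qed

lemma lpath_join:
  "lpath E x y l U \<Longrightarrow> lpath E y z l' U' \<Longrightarrow> U \<inter> U' = {y} \<Longrightarrow> lpath E x z (l + l') (U \<union> U')"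
proof (induction rule: lpath.induct)
  case (base x)
  then show ?case using lpath_ends[of E x z l' U'] by (simp add: insert_absorb)
next
  case (step y z' l U x a)
  have y: "z' \<in> U" "z' \<in> U'" using step.hyps(1) step.prems lpath_ends by fastforce+
  have "U \<inter> U' = {z'}" "x \<notin> U'" "a \<notin> U'" using step.prems(2) step.hyps y by auto
  then have "lpath E y z (l + l') (U \<union> U')" using step.IH step.prems(1) by blast
  then have "lpath E x z (Suc (l + l')) (insert x (insert a (U \<union> U')))"
    by (rule lpath.step) (use step \<open>x \<notin> U'\<close> \<open>a \<notin> U'\<close> in auto)
  then show ?case by simp
qed

lemma lpath_rev: "lpath E x y l U \<Longrightarrow> lpath E y x l U"
proof (induction rule: lpath.induct)
  case (step y z l U x a)
  have yU: "y \<in> U" using step.hyps lpath_ends by fast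
  have "lpath E y x (Suc 0) (insert y (insert a {x}))"
    by (intro lpath.step[OF lpath.base]) (use step yU in \<open>auto simp: insert_commute\<close>)
  then have "lpath E z x (l + Suc 0) (U \<union> insert y (insert a {x}))"
    by (rule lpath_join[OF step.IH]) (use step yU in auto)
  moreover have "U \<union> insert y (insert a {x}) = insert x (insert a U)" using yU by auto
  ultimately show ?case by simp
qed (rule lpath.base)

text \<open>\<open>lcyc\<close> wants one path and one closing triangle. The first triangle of the
  second path becomes the closing one; the rest of that path, reversed, is appended to the first
  path.\<close>

lemma lcyc_two_paths:
  assumes "lpath E x y l U" "lpath E y x l' U'" "U \<inter> U' \<subseteq> {x, y}" "x \<noteq> y"
  shows "lcyc E (l + l')"
proof -
  have r: "lpath E x y l' U'" using assms(2) lpath_rev by fast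
  from r show ?thesis
  proof (cases rule: lpath.cases)
    case base
    then show ?thesis using assms by auto
  next
    case (step x' l1 U1 a)
    have xU: "x \<in> U" "y \<in> U" using assms(1) lpath_ends by fast+
    have yU: "y \<in> U1" using step lpath_ends by fast
    have "U \<inter> U1 = {y}" using assms(3,4) step xU yU by auto
    then have "lpath E x x' (l + l1) (U \<union> U1)"
      using lpath_join[OF assms(1) lpath_rev[OF step(3)]] by blast
    moreover have "a \<notin> U \<union> U1" using step assms(3) yU by auto
    ultimately show ?thesis 
      using step(1,4-6) unfolding lcyc_def
      by (intro exI[of _ x] exI[of _ x'] exI[of _ a] exI[of _ "U \<union> U1"] conjI) (simp_all add: insert_commute)
  qed
qed

text \<open>\<open>c\<close> lists the core vertices and \<open>a\<close> the apexes,
  \<open>a i\<close> being the apex over the edge from \<open>c i\<close> to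
  \<open>c (Suc i)\<close>. The indexed form serves to write down the embedding of the
  blow-up.\<close>

lemma lpath_fun:
  "lpath E x y l U \<Longrightarrow> \<exists>c a. c 0 = x \<and> c l = y \<and> inj_on c {0..l} \<and> inj_on a {0..<l} \<and>
     c ` {0..l} \<inter> a ` {0..<l} = {} \<and> c ` {0..l} \<union> a ` {0..<l} = U \<and>
     (\<forall>i<l. {c i, c (Suc i)} \<in> E \<and> {c i, a i} \<in> E \<and> {c (Suc i), a i} \<in> E)"
proof (induction rule: lpath.induct)
  case (base x)
  show ?case by (rule exI[of _ "\<lambda>_. x"], rule exI[of _ "\<lambda>_. x"]) auto
next
  case (step y z l U x b)
  then obtain c a where ca: "c 0 = y" "c l = z" "inj_on c {0..l}" "inj_on a {0..<l}"
    "c ` {0..l} \<inter> a ` {0..<l} = {}" "c ` {0..l} \<union> a ` {0..<l} = U"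
    "\<forall>i<l. {c i, c (Suc i)} \<in> E \<and> {c i, a i} \<in> E \<and> {c (Suc i), a i} \<in> E" by auto
  define c' where "c' i = (case i of 0 \<Rightarrow> x | Suc j \<Rightarrow> c j)" for i
  define a' where "a' i = (case i of 0 \<Rightarrow> b | Suc j \<Rightarrow> a j)" for i
  have s1: "{0..Suc l} = insert 0 (Suc ` {0..l})" by (simp add: atLeast0_atMost_Suc_eq_insert_0)
  have s2: "{0..<Suc l} = insert 0 (Suc ` {0..<l})" by (simp add: atLeast0_lessThan_Suc_eq_insert_0)
  have i1: "c' ` {0..Suc l} = insert x (c ` {0..l})" unfolding s1 image_insert image_image by (simp add: c'_def)
  have i2: "a' ` {0..<Suc l} = insert b (a ` {0..<l})" unfolding s2 image_insert image_image by (simp add: a'_def)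
  have sc: "c' \<circ> Suc = c" "a' \<circ> Suc = a" by (auto simp: c'_def a'_def)
  have "inj_on c' (Suc ` {0..l})" "inj_on a' (Suc ` {0..<l})"
    using inj_on_imageI[of c' Suc "{0..l}"] inj_on_imageI[of a' Suc "{0..<l}"] sc ca(3,4) by auto
  moreover have "c' 0 \<notin> c' ` (Suc ` {0..l})" "a' 0 \<notin> a' ` (Suc ` {0..<l})"
    using ca(6) step.hyps unfolding image_image c'_def a'_def by auto
  ultimately have inj1: "inj_on c' {0..Suc l}" and inj2: "inj_on a' {0..<Suc l}"
    unfolding s1 s2 inj_on_insert by (auto simp: insert_Diff_if)
  have e: "{c' i, c' (Suc i)} \<in> E \<and> {c' i, a' i} \<in> E \<and> {c' (Suc i), a' i} \<in> E" if "i < Suc l" for i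
    using that ca step.hyps by (cases i) (auto simp: c'_def a'_def)
  have c0: "c' 0 = x" "c' (Suc l) = z" using ca(2) by (simp_all add: c'_def)
  have dj: "insert x (c ` {0..l}) \<inter> insert b (a ` {0..<l}) = {}"
    "insert x (c ` {0..l}) \<union> insert b (a ` {0..<l}) = insert x (insert b U)"
    using ca(5,6) step.hyps by auto
  show ?case
    by (rule exI[of _ c'], rule exI[of _ a'], unfold i1 i2) (use inj1 inj2 e c0 dj in blast)
qed

text \<open>False for \<open>k = 2\<close>, where both indices give the edge \<open>{0, 1}\<close>.
  A new vertex of the blow-up is labelled by an edge as a set, so the index of its triangle has to
  be recoverable from that set.\<close>

lemma cycle_edge_inj:
  fixes k :: nat
  assumes "k \<ge> 3" "i < k" "j < k" "{i, (i + 1) mod k} = {j, (j + 1) mod k}"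
  shows "i = j"
proof (rule ccontr)
  assume "i \<noteq> j"
  then have *: "i = (j + 1) mod k" "j = (i + 1) mod k" using assms(4) by (auto simp: doubleton_eq_iff)
  show False
  proof (cases "i + 1 < k")
    case True
    then have j: "j = i + 1" using *(2) by simp
    have "(i + 2) mod k = i" using *(1) j by simp
    moreover have "(i + 2) mod k = (if i + 2 < k then i + 2 else 0)" using True by (auto simp: mod_if)
    ultimately show False using assms(1) True by (auto split: if_splits)
  next
    case False
    then have i: "i + 1 = k" using assms by simp
    then have "j = 0" using *(2) by simp
    then show False using *(1) assms(1) i by simp
  qed
qed

lemma lcyc_contains_copy:
  assumes g: "graph_on V E" and k: "k \<ge> 3" and l: "lcyc E k"
  shows "contains_copy (blowup_V (cycle_V k) (cycle_E k)) (blowup_E (cycle_V k) (cycle_E k)) V E"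
proof -
  obtain x y b U where xy: "lpath E x y (k - 1) U" "b \<notin> U" "{x, y} \<in> E" "{x, b} \<in> E" "{y, b} \<in> E"
    using l unfolding lcyc_def by auto
  obtain c a0 where ca: "c 0 = x" "c (k-1) = y" "inj_on c {0..k-1}" "inj_on a0 {0..<k-1}"
    "c ` {0..k-1} \<inter> a0 ` {0..<k-1} = {}" "c ` {0..k-1} \<union> a0 ` {0..<k-1} = U"
    "\<forall>i<k-1. {c i, c (Suc i)} \<in> E \<and> {c i, a0 i} \<in> E \<and> {c (Suc i), a0 i} \<in> E"
    using lpath_fun[OF xy(1)] by auto
  \<comment> \<open>The closing triangle gets the index \<open>k - 1\<close>, because that edge of
    the cycle leads back to 0.\<close>
  define a where "a = a0(k-1 := b)"
  have r: "{0..k-1} = {0..<k}" "{0..<k} = insert (k-1) {0..<k-1}" using k by auto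
  have injc: "inj_on c {0..<k}" using ca(3) r by simp
  have "a ` {0..<k-1} = a0 ` {0..<k-1}" by (auto simp: a_def image_iff)
  then have ima: "a ` {0..<k} = insert b (a0 ` {0..<k-1})" unfolding r(2) by (auto simp: a_def)
  have inja: "inj_on a {0..<k}" unfolding r(2)
    using ca(4) ca(6) xy(2) by (auto simp: inj_on_def a_def)
  have disj: "c ` {0..<k} \<inter> a ` {0..<k} = {}" unfolding ima using ca(5,6) xy(2) r(1) by auto
  have tri: "{c i, c ((i + 1) mod k)} \<in> E \<and> {c i, a i} \<in> E \<and> {c ((i + 1) mod k), a i} \<in> E" if "i < k" for i
  proof (cases "i = k - 1")
    case True
    then show ?thesis using xy ca k by (simp add: a_def insert_commute)
  next
    case False
    then have "i < k - 1" "(i + 1) mod k = Suc i" using that k by auto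
    then show ?thesis using ca(7) by (auto simp: a_def)
  qed
  define idx where "idx e = (THE i. i < k \<and> e = {i, (i + 1) mod k})" for e
  have idx: "idx {i, (i + 1) mod k} = i" if "i < k" for i
    unfolding idx_def using that cycle_edge_inj[OF k] by (intro the_equality) auto
  define f where "f v = (case v of Inl i \<Rightarrow> c i | Inr e \<Rightarrow> a (idx e))" for v
  have fr: "f (Inr {i, (i + 1) mod k}) = a i" if "i < k" for i using idx[OF that] by (simp add: f_def)
  have "inj_on f (blowup_V (cycle_V k) (cycle_E k))"
    unfolding inj_on_def
  proof (intro ballI impI)
    fix u v assume uv: "u \<in> blowup_V (cycle_V k) (cycle_E k)" "v \<in> blowup_V (cycle_V k) (cycle_E k)" "f u = f v"
    have cs: "(\<exists>i<k. w = Inl i) \<or> (\<exists>i<k. w = Inr {i, (i + 1) mod k})"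
      if "w \<in> blowup_V (cycle_V k) (cycle_E k)" for w
      using that by (auto simp: blowup_V_def cycle_V_def cycle_E_def)
    show "u = v"
      using cs[OF uv(1)] cs[OF uv(2)]
    proof (elim disjE exE conjE)
      fix i j assume "i < k" "u = Inl i" "j < k" "v = Inl j"
      then show ?thesis using uv(3) injc by (auto simp: f_def inj_on_def)
    next
      fix i j assume ij: "i < k" "u = Inl i" "j < k" "v = Inr {j, (j + 1) mod k}"
      then have "c i = a j" using uv(3) fr[OF ij(3)] by (simp add: f_def)
      moreover have "c i \<in> c ` {0..<k}" "a j \<in> a ` {0..<k}" using ij by auto
      ultimately show ?thesis using disj by auto
    next
      fix i j assume ij: "j < k" "u = Inr {j, (j + 1) mod k}" "i < k" "v = Inl i"
      then have "c i = a j" using uv(3) fr[OF ij(1)] by (simp add: f_def)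
      moreover have "c i \<in> c ` {0..<k}" "a j \<in> a ` {0..<k}" using ij by auto
      ultimately show ?thesis using disj by auto
    next
      fix i j assume ij: "i < k" "u = Inr {i, (i + 1) mod k}" "j < k" "v = Inr {j, (j + 1) mod k}"
      then have "a i = a j" using uv(3) fr[OF ij(1)] fr[OF ij(3)] by simp
      then have "i = j" using inja ij by (auto simp: inj_on_def)
      then show ?thesis using ij by simp
    qed
  qed
  moreover have "f ` e \<in> E" if "e \<in> blowup_E (cycle_V k) (cycle_E k)" for e
  proof -
    have "(\<exists>i<k. e = Inl ` {i, (i + 1) mod k}) \<or> (\<exists>i<k. e = {Inl i, Inr {i, (i + 1) mod k}} \<or> e = {Inl ((i+1) mod k), Inr {i, (i + 1) mod k}})"
      using that by (auto simp: blowup_E_def cycle_E_def)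
    then show ?thesis
    proof (elim disjE exE conjE)
      fix i assume "i < k" "e = Inl ` {i, (i + 1) mod k}"
      then show ?thesis using tri[of i] by (simp add: f_def)
    next
      fix i assume i: "i < k" "e = {Inl i, Inr {i, (i + 1) mod k}}"
      then have "f ` e = {c i, a i}" using fr[OF i(1)] by (simp add: f_def)
      then show ?thesis using tri[of i] i by simp
    next
      fix i assume i: "i < k" "e = {Inl ((i+1) mod k), Inr {i, (i + 1) mod k}}"
      then have "f ` e = {c ((i+1) mod k), a i}" using fr[OF i(1)] by (simp add: f_def)
      then show ?thesis using tri[of i] i by simp
    qed
  qed
  moreover have "f ` blowup_V (cycle_V k) (cycle_E k) \<subseteq> V"
  proof
    fix v assume "v \<in> f ` blowup_V (cycle_V k) (cycle_E k)"
    then obtain w where w: "w \<in> blowup_V (cycle_V k) (cycle_E k)" "v = f w" by auto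
    then have "(\<exists>i<k. v = c i) \<or> (\<exists>i<k. v = a i)"
      using fr by (auto simp: blowup_V_def cycle_V_def cycle_E_def f_def) 
    then show "v \<in> V" using tri graph_on_in[OF g] by blast
  qed
  ultimately show ?thesis unfolding contains_copy_def by auto
qed

subsection \<open>Closing loose paths through a highly connected set\<close>

text \<open>\<open>W\<close> plays the centres and \<open>T\<close> the bipartite part. A centre
  \<open>w\<close> links any two points \<open>p\<close>, \<open>q\<close> of \<open>T\<close> by
  the two triangles on the edges \<open>pw\<close> and \<open>wq\<close>, and \<open>N\<close>
  bounds from below the supply of apexes for them and of points of \<open>T\<close>.\<close>

definition env :: "'a set set \<Rightarrow> 'a set \<Rightarrow> 'a set \<Rightarrow> nat \<Rightarrow> bool" where
  "env E T W N \<longleftrightarrow> N \<le> card T \<and> (\<forall>w\<in>W. \<forall>x\<in>T. {w, x} \<in> E \<and> N \<le> card (cn E w x))"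

lemma env_subset: "env E T W N \<Longrightarrow> W' \<subseteq> W \<Longrightarrow> env E T W' N"
  by (auto simp: env_def)

text \<open>Each centre in \<open>ws\<close> is used once as a core vertex and contributes two
  triangles, whence the length \<open>2 * length ws\<close>. The surplus in \<open>N\<close> leaves
  at least four new forbidden vertices for each centre.\<close>

lemma env_conn:
  assumes g: "graph_on V E"
  shows "env E T (set ws) N \<Longrightarrow> distinct ws \<Longrightarrow> ws \<noteq> [] \<Longrightarrow> p \<in> T \<Longrightarrow> q \<in> T \<Longrightarrow> p \<noteq> q \<Longrightarrow> finite F
    \<Longrightarrow> set ws \<inter> F = {} \<Longrightarrow> card F + 6 * length ws + 5 \<le> N
    \<Longrightarrow> \<exists>U. lpath E p q (2 * length ws) U \<and> U \<inter> F \<subseteq> {p, q}"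
proof (induction ws arbitrary: p F)
  case Nil
  then show ?case by simp
next
  case (Cons w ws)
  note envw = Cons.prems(1)[unfolded env_def]
  have Nw: "N \<le> card (cn E w x)" if "x \<in> T" for x using envw that by simp
  have wsT: "v \<notin> T" if "v \<in> set (w # ws)" for v using envw that graph_on_loop[OF g, of v] by force
  then have wT: "w \<notin> T" by simp
  have cards: "card (F \<union> {p, q, w} \<union> set ws) + 3 \<le> N"
  proof -
    have "card (F \<union> {p, q, w} \<union> set ws) \<le> card F + card {p, q, w} + card (set ws)"
      by (meson add_mono_thms_linordered_semiring(3) card_Un_le le_trans)
    moreover have "card {p, q, w} \<le> 3" using card_length[of "[p, q, w]"] by simp
    moreover have "card (set ws) \<le> length ws" by (rule card_length)
    ultimately show ?thesis using Cons.prems(9) by simp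
  qed
  have fin: "finite (F \<union> {p, q, w} \<union> set ws)" using Cons.prems by simp
  show ?case
  proof (cases "ws = []")
    case True
    have "card (F \<union> {p, q, w}) < card (cn E w p)"
      using Nw[of p] cards True Cons.prems(4) by simp
    then obtain a where a: "a \<in> cn E w p" "a \<notin> F \<union> {p, q, w}"
      using fresh[of "F \<union> {p, q, w}" "cn E w p"] Cons.prems(7) by blast
    have "card (insert a (F \<union> {p, q, w})) < card (cn E w q)"
      using Nw[of q] cards True card_insert_bound[of "F \<union> {p, q, w}" a] Cons.prems(5,7) by simp
    then obtain b where b: "b \<in> cn E w q" "b \<notin> insert a (F \<union> {p, q, w})"
      using fresh[of "insert a (F \<union> {p, q, w})" "cn E w q"] Cons.prems(7) by blast
    have e: "{w, p} \<in> E" "{w, q} \<in> E" using envw Cons.prems by auto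
    have 1: "lpath E p w 1 {p, w, a}" using e a by (intro lpath_tri[OF g]) (auto simp: cn_iff insert_commute)
    have 2: "lpath E w q 1 {w, q, b}" using e b by (intro lpath_tri[OF g]) (auto simp: cn_iff insert_commute)
    have "lpath E p q (1 + 1) ({p, w, a} \<union> {w, q, b})"
      by (rule lpath_join[OF 1 2]) (use a b Cons.prems wT in auto)
    then have "lpath E p q (2 * length (w # ws)) ({p, w, a} \<union> {w, q, b})" using True by (simp add: numeral_2_eq_2)
    then show ?thesis using a b Cons.prems(8) by (intro exI[of _ "{p, w, a} \<union> {w, q, b}"]) auto
  next
    case False
    obtain x where x: "x \<in> T" "x \<notin> F \<union> {p, q, w} \<union> set ws"
      using fresh[OF fin, of T] envw cards by (metis add_leD1 le_less_trans less_add_same_cancel1 order_less_le_trans zero_less_numeral)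
    have "card (insert x (F \<union> {p, q, w} \<union> set ws)) < card (cn E w p)"
      using Nw[of p] Cons.prems(4) cards card_insert_bound[OF fin, of x] by linarith
    then obtain a where a: "a \<in> cn E w p" "a \<notin> insert x (F \<union> {p, q, w} \<union> set ws)"
      using fresh[of "insert x (F \<union> {p, q, w} \<union> set ws)" "cn E w p"] fin by blast
    have "card (insert a (insert x (F \<union> {p, q, w} \<union> set ws))) < card (cn E w x)"
      using Nw[OF x(1)] cards card_insert_bound[OF fin, of x]
        card_insert_bound[of "insert x (F \<union> {p, q, w} \<union> set ws)" a] fin by fastforce
    then obtain b where b: "b \<in> cn E w x" "b \<notin> insert a (insert x (F \<union> {p, q, w} \<union> set ws))"
      using fresh[of "insert a (insert x (F \<union> {p, q, w} \<union> set ws))" "cn E w x"] fin by blast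
    \<comment> \<open>All vertices of the first two triangles become forbidden, except
      \<open>x\<close>, where the remaining path starts.\<close>
    define F' where "F' = F \<union> {p, w, a, b}"
    have "card F' \<le> card F + 4"
      unfolding F'_def using card_Un_le[of F "{p, w, a, b}"] card_length[of "[p, w, a, b]"] by simp
    then obtain U where U: "lpath E x q (2 * length ws) U" "U \<inter> F' \<subseteq> {x, q}"
      using Cons.IH[of x F'] env_subset[OF Cons.prems(1), of "set ws"] Cons.prems False x a b
        wsT[of p] by (auto simp: F'_def)
    have e: "{w, p} \<in> E" "{w, x} \<in> E" using envw Cons.prems x by auto
    have 1: "lpath E p w 1 {p, w, a}" using e a by (intro lpath_tri[OF g]) (auto simp: cn_iff insert_commute)
    have 2: "lpath E w x 1 {w, x, b}" using e b by (intro lpath_tri[OF g]) (auto simp: cn_iff insert_commute)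
    have 3: "lpath E p x (1 + 1) ({p, w, a} \<union> {w, x, b})"
      by (rule lpath_join[OF 1 2]) (use a b x Cons.prems wT in auto)
    have 4: "lpath E p q (1 + 1 + 2 * length ws) ({p, w, a} \<union> {w, x, b} \<union> U)"
    proof (rule lpath_join[OF 3 U(1)])
      have "x \<in> U" using U(1) lpath_ends by fast
      then show "({p, w, a} \<union> {w, x, b}) \<inter> U = {x}" using U(2) a b x Cons.prems wT by (auto simp: F'_def)
    qed
    have "({p, w, a} \<union> {w, x, b} \<union> U) \<inter> F \<subseteq> {p, q}"
      using U(2) a b x Cons.prems(8) by (auto simp: F'_def)
    then show ?thesis using 4 by (intro exI[of _ "{p, w, a} \<union> {w, x, b} \<union> U"]) auto
  qed
qed

text \<open>The device by which most cycles below are closed: the way back from \<open>q\<close> to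
  \<open>p\<close> through the centres costs exactly two triangles per centre. With \<open>t\<close>
  centres, starting paths of length 1 and 2 give the cycle lengths \<open>2 * t + 1\<close> and
  \<open>2 * t + 2\<close>; with \<open>t - 1\<close> centres the starting lengths are 3 and
  4.\<close>

lemma env_close:
  assumes g: "graph_on V E" and "env E T W N" "finite W" "W \<noteq> {}"
    and "p \<in> T" "q \<in> T" "p \<noteq> q" "lpath E p q l U" "U \<inter> W = {}"
    and "2 * l + 6 * card W + 6 \<le> N" "k = l + 2 * card W"
  shows "lcyc E k"
proof -
  obtain ws where ws: "set ws = W" "distinct ws" using finite_distinct_list assms(3) by blast
  then have len: "length ws = card W" using distinct_card by fastforce
  have U: "finite U" "card U = 2 * l + 1" using lpath_card assms(8) by fast+
  obtain U' where U': "lpath E q p (2 * length ws) U'" "U' \<inter> U \<subseteq> {q, p}"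
    using env_conn[OF g, of T ws N q p U] assms ws len U by fastforce
  show ?thesis
    using lcyc_two_paths[OF assms(8) U'(1)] U'(2) assms(7,11) len by auto
qed

subsection \<open>Canonical colourings of grids\<close>

lemma subset_of_card: "m \<le> card S \<Longrightarrow> \<exists>T\<subseteq>S. card T = m"
  by (meson obtain_subset_with_card_n)

lemma fibre_or_distinct:
  assumes "finite S" "a * b < card S"
  shows "(\<exists>S'\<subseteq>S. card S' = a \<and> (\<exists>c. \<forall>x\<in>S'. f x = c)) \<or> (\<exists>S'\<subseteq>S. card S' = b \<and> inj_on f S')"
proof (cases "b \<le> card (f ` S)")
  case True
  then obtain T where T: "T \<subseteq> f ` S" "card T = b" by (meson obtain_subset_with_card_n)
  then obtain S' where S': "S' \<subseteq> S" "inj_on f S'" "T = f ` S'" unfolding subset_image_inj by blast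
  then have "card S' = b" using T(2) card_image by fastforce
  then show ?thesis using S' by (intro disjI2 exI[of _ S']) auto
next
  case False
  have "\<exists>c\<in>f ` S. a \<le> card {x\<in>S. f x = c}"
  proof (rule ccontr)
    assume "\<not> ?thesis"
    then have *: "\<forall>c\<in>f ` S. card {x\<in>S. f x = c} \<le> a" by auto
    have "card S = (\<Sum>c\<in>f ` S. card {x\<in>S. f x = c})"
      using sum.image_gen[OF assms(1), of "\<lambda>_. 1::nat" f] by simp
    also have "\<dots> \<le> (\<Sum>c\<in>f ` S. a)" using * by (intro sum_mono) auto
    also have "\<dots> \<le> a * b" using False by (simp add: mult.commute)
    finally show False using assms by simp
  qed
  then obtain c where "a \<le> card {x\<in>S. f x = c}" by auto
  then obtain S' where "S' \<subseteq> {x\<in>S. f x = c}" "card S' = a" using subset_of_card by blast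
  then show ?thesis by (intro disjI1 exI[of _ S'] conjI exI[of _ c]) auto
qed

text \<open>One row costs a square root: among more than \<open>M * M\<close> columns,
  \<open>M\<close> have equal values or \<open>M\<close> have distinct values in that row. Both
  properties survive further restriction of the columns, so the rows can be treated one after the
  other.\<close>

lemma rows_constant_or_injective:
  "\<exists>M. \<forall>(X :: 'a set) (Y :: 'b set) (f :: 'a \<Rightarrow> 'b \<Rightarrow> 'c). finite X \<longrightarrow> card X = r \<longrightarrow> finite Y \<longrightarrow> M \<le> card Y \<longrightarrow>
    (\<exists>Y'\<subseteq>Y. card Y' = m \<and> (\<forall>x\<in>X. (\<exists>c. \<forall>y\<in>Y'. f x y = c) \<or> inj_on (f x) Y'))"
proof (induction r)
  case 0
  show ?case by (rule exI[of _ m]) (simp add: subset_of_card)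
next
  case (Suc r)
  from Suc.IH obtain M where M: "\<forall>(X :: 'a set) (Y :: 'b set) (f :: 'a \<Rightarrow> 'b \<Rightarrow> 'c). finite X \<longrightarrow> card X = r \<longrightarrow> finite Y \<longrightarrow> M \<le> card Y \<longrightarrow>
    (\<exists>Y'\<subseteq>Y. card Y' = m \<and> (\<forall>x\<in>X. (\<exists>c. \<forall>y\<in>Y'. f x y = c) \<or> inj_on (f x) Y'))" by (elim exE) (rule that)
  show ?case
  proof (intro exI[of _ "Suc (M * M)"] allI impI)
    fix X :: "'a set" and Y :: "'b set" and f :: "'a \<Rightarrow> 'b \<Rightarrow> 'c"
    assume a: "finite X" "card X = Suc r" "finite Y" "Suc (M * M) \<le> card Y"
    obtain x X0 where x: "X = insert x X0" "x \<notin> X0" "card X0 = r" using a(2) by (metis card_Suc_eq)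
    obtain Y1 where Y1: "Y1 \<subseteq> Y" "card Y1 = M" "(\<exists>c. \<forall>y\<in>Y1. f x y = c) \<or> inj_on (f x) Y1"
      using fibre_or_distinct[of Y M M "f x"] a by auto
    obtain Y' where Y': "Y' \<subseteq> Y1" "card Y' = m" "\<forall>x\<in>X0. (\<exists>c. \<forall>y\<in>Y'. f x y = c) \<or> inj_on (f x) Y'"
      using M[rule_format, of X0 Y1 f] x a Y1 finite_subset[of Y1 Y] by auto
    have "(\<exists>c. \<forall>y\<in>Y'. f x y = c) \<or> inj_on (f x) Y'" using Y1(3) Y'(1) inj_on_subset by blast
    then show "\<exists>Y'\<subseteq>Y. card Y' = m \<and> (\<forall>x\<in>X. (\<exists>c. \<forall>y\<in>Y'. f x y = c) \<or> inj_on (f x) Y')"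
      using Y' Y1(1) x(1) by (intro exI[of _ Y']) auto
  qed
qed

text \<open>Each chosen element excludes itself and at most \<open>d\<close> others.\<close>

lemma greedy_independent:
  assumes "finite Y" "symp R" "\<And>y. y \<in> Y \<Longrightarrow> card {z\<in>Y. R y z} \<le> d" "m * (d + 1) \<le> card Y"
  shows "\<exists>Y'\<subseteq>Y. card Y' = m \<and> (\<forall>y\<in>Y'. \<forall>z\<in>Y'. y \<noteq> z \<longrightarrow> \<not> R y z)"
  using assms(4)
proof (induction m)
  case 0
  then show ?case by (intro exI[of _ "{}"]) auto
next
  case (Suc m)
  then obtain Y' where Y': "Y' \<subseteq> Y" "card Y' = m" "\<forall>y\<in>Y'. \<forall>z\<in>Y'. y \<noteq> z \<longrightarrow> \<not> R y z" by auto
  have fin: "finite Y'" using Y'(1) assms(1) finite_subset by blast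
  have "card (Y' \<union> (\<Union>y\<in>Y'. {z\<in>Y. R y z})) \<le> card Y' + card (\<Union>y\<in>Y'. {z\<in>Y. R y z})" by (rule card_Un_le)
  also have "card (\<Union>y\<in>Y'. {z\<in>Y. R y z}) \<le> (\<Sum>y\<in>Y'. card {z\<in>Y. R y z})" using fin by (rule card_UN_le)
  also have "\<dots> \<le> (\<Sum>y\<in>Y'. d)" using assms(3) Y'(1) by (intro sum_mono) auto
  finally have "card (Y' \<union> (\<Union>y\<in>Y'. {z\<in>Y. R y z})) < card Y" using Y'(2) Suc.prems by simp
  then obtain y where y: "y \<in> Y" "y \<notin> Y' \<union> (\<Union>y\<in>Y'. {z\<in>Y. R y z})"
    using fresh[of "Y' \<union> (\<Union>y\<in>Y'. {z\<in>Y. R y z})" Y] fin assms(1) by auto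
  then have "\<forall>z\<in>Y'. \<not> R z y \<and> \<not> R y z" using assms(2) by (auto dest: sympD)
  then show ?case using Y' y fin by (intro exI[of _ "insert y Y'"]) auto
qed

definition cgrid :: "'a set \<Rightarrow> 'b set \<Rightarrow> ('a \<Rightarrow> 'b \<Rightarrow> 'c) \<Rightarrow> bool" where
  "cgrid X Y f \<longleftrightarrow> (\<exists>c. \<forall>x\<in>X. \<forall>y\<in>Y. f x y = c)"

definition xgrid :: "'a set \<Rightarrow> 'b set \<Rightarrow> ('a \<Rightarrow> 'b \<Rightarrow> 'c) \<Rightarrow> bool" where
  "xgrid X Y f \<longleftrightarrow> (\<exists>g. inj_on g X \<and> (\<forall>x\<in>X. \<forall>y\<in>Y. f x y = g x))"

definition ygrid :: "'a set \<Rightarrow> 'b set \<Rightarrow> ('a \<Rightarrow> 'b \<Rightarrow> 'c) \<Rightarrow> bool" where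
  "ygrid X Y f \<longleftrightarrow> (\<exists>h. inj_on h Y \<and> (\<forall>x\<in>X. \<forall>y\<in>Y. f x y = h y))"

definition igrid :: "'a set \<Rightarrow> 'b set \<Rightarrow> ('a \<Rightarrow> 'b \<Rightarrow> 'c) \<Rightarrow> bool" where
  "igrid X Y f \<longleftrightarrow> (\<forall>x\<in>X. \<forall>x'\<in>X. \<forall>y\<in>Y. \<forall>y'\<in>Y. f x y = f x' y' \<longrightarrow> x = x' \<and> y = y')"

text \<open>These are the four unavoidable patterns of the canonical Ramsey theorem of Erdos and
  Rado in its version for a product of two sets.\<close>

definition canonical :: "'a set \<Rightarrow> 'b set \<Rightarrow> ('a \<Rightarrow> 'b \<Rightarrow> 'c) \<Rightarrow> bool" where
  "canonical X Y f \<longleftrightarrow> cgrid X Y f \<or> xgrid X Y f \<or> ygrid X Y f \<or> igrid X Y f"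

lemma canonical_subset: "canonical X Y f \<Longrightarrow> X' \<subseteq> X \<Longrightarrow> Y' \<subseteq> Y \<Longrightarrow> canonical X' Y' f"
proof -
  assume a: "canonical X Y f" "X' \<subseteq> X" "Y' \<subseteq> Y"
  have "xgrid X Y f \<Longrightarrow> xgrid X' Y' f" unfolding xgrid_def using a by (meson inj_on_subset subsetD)
  moreover have "ygrid X Y f \<Longrightarrow> ygrid X' Y' f" unfolding ygrid_def using a by (meson inj_on_subset subsetD)
  moreover have "cgrid X Y f \<Longrightarrow> cgrid X' Y' f" unfolding cgrid_def using a by blast
  moreover have "igrid X Y f \<Longrightarrow> igrid X' Y' f" unfolding igrid_def using a by blast
  ultimately show ?thesis using a(1) unfolding canonical_def by blast
qed

lemma majority:
  assumes "finite S" "2 * q \<le> card S"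
  shows "(\<exists>S'\<subseteq>S. card S' = q \<and> (\<forall>x\<in>S'. P x)) \<or> (\<exists>S'\<subseteq>S. card S' = q \<and> (\<forall>x\<in>S'. \<not> P x))"
proof -
  have "card S = card {x\<in>S. P x} + card {x\<in>S. \<not> P x}"
    using card_Int_Diff[OF assms(1), of "{x. P x}"] by (simp add: Int_def set_diff_eq)
  then have "q \<le> card {x\<in>S. P x} \<or> q \<le> card {x\<in>S. \<not> P x}" using assms by linarith
  then show ?thesis
  proof
    assume "q \<le> card {x\<in>S. P x}"
    then obtain S' where "S' \<subseteq> {x\<in>S. P x}" "card S' = q" by (meson obtain_subset_with_card_n)
    then show ?thesis by blast
  next
    assume "q \<le> card {x\<in>S. \<not> P x}"
    then obtain S' where "S' \<subseteq> {x\<in>S. \<not> P x}" "card S' = q" by (meson obtain_subset_with_card_n)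
    then show ?thesis by blast
  qed
qed

text \<open>After thinning the columns, each row is constant or injective, and one kind prevails. If
  the rows are constant, the pigeonhole principle on their values finishes. If they are injective,
  columns are selected that pairwise share no value; then equal values can only occur within a
  column, and treating the columns as the rows were treated separates the last two patterns.\<close>

lemma canonical_ramsey:
  "\<exists>M. \<forall>(X :: 'a set) (Y :: 'b set) (f :: 'a \<Rightarrow> 'b \<Rightarrow> 'c). finite X \<longrightarrow> finite Y \<longrightarrow> M \<le> card X \<longrightarrow> M \<le> card Y \<longrightarrow>
    (\<exists>X'\<subseteq>X. \<exists>Y'\<subseteq>Y. card X' = m \<and> card Y' = m \<and> canonical X' Y' f)"
proof -
  obtain R1 where R1: "\<forall>(X :: 'b set) (Y :: 'a set) (f :: 'b \<Rightarrow> 'a \<Rightarrow> 'c). finite X \<longrightarrow> card X = 2 * m \<longrightarrow> finite Y \<longrightarrow> R1 \<le> card Y \<longrightarrow>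
    (\<exists>Y'\<subseteq>Y. card Y' = m \<and> (\<forall>x\<in>X. (\<exists>c. \<forall>y\<in>Y'. f x y = c) \<or> inj_on (f x) Y'))"
    using rows_constant_or_injective[of "2 * m" m] by (elim exE) (rule that)
  \<comment> \<open>\<open>Q\<close> rows remain after the majority vote: more than
    \<open>m * m\<close> for the pigeonhole principle on constant rows, and at least
    \<open>R1\<close> for the later treatment of the columns. \<open>Z\<close> allows a greedy
    choice of \<open>2 * m\<close> columns when each clashes with at most \<open>Q * Q\<close>
    others.\<close>
  define Q where "Q = R1 + m * m + 1"
  define Z where "Z = (2 * m) * (Q * Q + 1) + m"
  obtain R2 where R2: "\<forall>(X :: 'a set) (Y :: 'b set) (f :: 'a \<Rightarrow> 'b \<Rightarrow> 'c). finite X \<longrightarrow> card X = 2 * Q \<longrightarrow> finite Y \<longrightarrow> R2 \<le> card Y \<longrightarrow>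
    (\<exists>Y'\<subseteq>Y. card Y' = Z \<and> (\<forall>x\<in>X. (\<exists>c. \<forall>y\<in>Y'. f x y = c) \<or> inj_on (f x) Y'))"
    using rows_constant_or_injective[of "2 * Q" Z] by (elim exE) (rule that)
  show ?thesis
  proof (intro exI[of _ "2 * Q + R2"] allI impI)
    fix X :: "'a set" and Y :: "'b set" and f :: "'a \<Rightarrow> 'b \<Rightarrow> 'c"
    assume fin: "finite X" "finite Y" and card: "2 * Q + R2 \<le> card X" "2 * Q + R2 \<le> card Y"
    obtain X1 where X1: "X1 \<subseteq> X" "card X1 = 2 * Q" using card obtain_subset_with_card_n[of "2 * Q" X] by auto
    have fX1: "finite X1" using X1 fin finite_subset by blast
    obtain Y1 where Y1: "Y1 \<subseteq> Y" "card Y1 = Z" "\<forall>x\<in>X1. (\<exists>c. \<forall>y\<in>Y1. f x y = c) \<or> inj_on (f x) Y1"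
      using R2[rule_format, of X1 Y f] fX1 X1 fin card by auto
    have fY1: "finite Y1" using Y1 fin finite_subset by blast
    have X1Q: "2 * Q \<le> card X1" using X1 by simp
    have "(\<exists>X2\<subseteq>X1. card X2 = Q \<and> (\<forall>x\<in>X2. \<exists>c. \<forall>y\<in>Y1. f x y = c)) \<or> (\<exists>X2\<subseteq>X1. card X2 = Q \<and> (\<forall>x\<in>X2. inj_on (f x) Y1))"
      using majority[OF fX1 X1Q, of "\<lambda>x. \<exists>c. \<forall>y\<in>Y1. f x y = c"]
    proof (elim disjE exE conjE)
      fix S assume S: "S \<subseteq> X1" "card S = Q" "\<forall>x\<in>S. \<not> (\<exists>c. \<forall>y\<in>Y1. f x y = c)"
      then have "\<forall>x\<in>S. inj_on (f x) Y1" using Y1(3) by (meson subsetD)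
      then show ?thesis using S by (intro disjI2 exI[of _ S]) simp
    qed (intro disjI1 exI conjI)
    then consider X2 where "X2 \<subseteq> X1" "card X2 = Q" "\<forall>x\<in>X2. \<exists>c. \<forall>y\<in>Y1. f x y = c"
      | X2 where "X2 \<subseteq> X1" "card X2 = Q" "\<forall>x\<in>X2. inj_on (f x) Y1"
      by (elim disjE exE conjE)
    then show "\<exists>X'\<subseteq>X. \<exists>Y'\<subseteq>Y. card X' = m \<and> card Y' = m \<and> canonical X' Y' f"
    proof cases
      case 1
      obtain Y' where Y': "Y' \<subseteq> Y1" "card Y' = m"
        using obtain_subset_with_card_n[of m Y1] Y1(2) by (auto simp: Z_def)
      obtain g where g: "\<forall>x\<in>X2. \<forall>y\<in>Y1. f x y = g x" using 1(3) by metis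
      have fX2: "finite X2" using 1 fX1 finite_subset by blast
      have "(\<exists>S'\<subseteq>X2. card S' = m \<and> (\<exists>c. \<forall>x\<in>S'. g x = c)) \<or> (\<exists>S'\<subseteq>X2. card S' = m \<and> inj_on g S')"
        using fX2 1(2) by (intro fibre_or_distinct) (auto simp: Q_def)
      then obtain S where S: "S \<subseteq> X2" "card S = m" "(\<exists>c. \<forall>x\<in>S. g x = c) \<or> inj_on g S" by blast
      have "cgrid S Y' f \<or> xgrid S Y' f"
        using S g Y'(1) unfolding cgrid_def xgrid_def by (metis subsetD)
      then have "canonical S Y' f" by (auto simp: canonical_def)
      then show ?thesis using S Y' 1(1) X1(1) Y1(1) by (intro exI[of _ S] exI[of _ Y'] conjI) auto
    next
      case 2
      have fX2: "finite X2" using 2 fX1 finite_subset by blast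
      \<comment> \<open>Two columns clash if they share a value. For a fixed pair of rows, a column
        clashes with at most one other in this way because the rows are injective, so
        \<open>Q * Q\<close> bounds the number of clashes.\<close>
      define R where "R y z \<longleftrightarrow> (\<exists>x\<in>X2. \<exists>x'\<in>X2. f x y = f x' z)" for y z
      have sR: "symp R" unfolding R_def symp_def by metis
      have dR: "card {z\<in>Y1. R y z} \<le> Q * Q" if "y \<in> Y1" for y
      proof -
        have "{z\<in>Y1. R y z} = (\<Union>p\<in>X2 \<times> X2. {z\<in>Y1. f (fst p) y = f (snd p) z})"
          unfolding R_def by auto metis
        also have "card \<dots> \<le> (\<Sum>p\<in>X2 \<times> X2. card {z\<in>Y1. f (fst p) y = f (snd p) z})"
          using fX2 by (intro card_UN_le) auto
        also have "\<dots> \<le> (\<Sum>p\<in>X2 \<times> X2. 1)"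
        proof (rule sum_mono)
          fix p assume p: "p \<in> X2 \<times> X2"
          have inj: "inj_on (f (snd p)) Y1" using 2 p by auto
          show "card {z\<in>Y1. f (fst p) y = f (snd p) z} \<le> 1"
          proof (cases "\<exists>z0\<in>Y1. f (fst p) y = f (snd p) z0")
            case True
            then obtain z0 where "z0 \<in> Y1" "f (fst p) y = f (snd p) z0" by auto
            then have "{z\<in>Y1. f (fst p) y = f (snd p) z} \<subseteq> {z0}" using inj by (auto simp: inj_on_def)
            then have "card {z\<in>Y1. f (fst p) y = f (snd p) z} \<le> card {z0}" by (intro card_mono) auto
            then show ?thesis by simp
          next
            case False
            then have "{z\<in>Y1. f (fst p) y = f (snd p) z} = {}" by auto
            then show ?thesis by (simp only: card.empty)
          qed
        qed
        also have "\<dots> = Q * Q" using 2(2) by (simp add: card_cartesian_product)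
        finally show ?thesis .
      qed
      obtain Y2 where Y2: "Y2 \<subseteq> Y1" "card Y2 = 2 * m" "\<forall>y\<in>Y2. \<forall>z\<in>Y2. y \<noteq> z \<longrightarrow> \<not> R y z"
        using greedy_independent[OF fY1 sR dR, of "2 * m"] Y1(2) by (auto simp: Z_def)
      have fY2: "finite Y2" using Y2 fY1 finite_subset by blast
      obtain X3 where X3: "X3 \<subseteq> X2" "card X3 = m"
        "\<forall>y\<in>Y2. (\<exists>c. \<forall>x\<in>X3. f x y = c) \<or> inj_on (\<lambda>x. f x y) X3"
        using R1[rule_format, of Y2 X2 "\<lambda>y x. f x y"] fY2 Y2(2) fX2 2(2) by (auto simp: Q_def)
      have Y2m: "2 * m \<le> card Y2" using Y2 by simp
      have "(\<exists>Y3\<subseteq>Y2. card Y3 = m \<and> (\<forall>y\<in>Y3. \<exists>c. \<forall>x\<in>X3. f x y = c)) \<or> (\<exists>Y3\<subseteq>Y2. card Y3 = m \<and> (\<forall>y\<in>Y3. inj_on (\<lambda>x. f x y) X3))"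
        using majority[OF fY2 Y2m, of "\<lambda>y. \<exists>c. \<forall>x\<in>X3. f x y = c"]
      proof (elim disjE exE conjE)
        fix S assume S: "S \<subseteq> Y2" "card S = m" "\<forall>y\<in>S. \<not> (\<exists>c. \<forall>x\<in>X3. f x y = c)"
        then have "\<forall>y\<in>S. inj_on (\<lambda>x. f x y) X3" using X3(3) by (meson subsetD)
        then show ?thesis using S by (intro disjI2 exI[of _ S]) simp
      qed (intro disjI1 exI conjI)
      then consider Y3 where "Y3 \<subseteq> Y2" "card Y3 = m" "\<forall>y\<in>Y3. \<exists>c. \<forall>x\<in>X3. f x y = c"
        | Y3 where "Y3 \<subseteq> Y2" "card Y3 = m" "\<forall>y\<in>Y3. inj_on (\<lambda>x. f x y) X3"
        by (elim disjE exE conjE)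
      then obtain Y3 where Y3: "Y3 \<subseteq> Y2" "card Y3 = m" "canonical X3 Y3 f"
      proof cases
        case 1
        obtain h where h: "\<forall>y\<in>Y3. \<forall>x\<in>X3. f x y = h y" using 1(3) by metis
        show ?thesis
        proof (cases "X3 = {}")
          case True
          then show ?thesis using that[OF 1(1,2)] by (simp add: canonical_def cgrid_def)
        next
          case False
          then obtain x where x: "x \<in> X3" by auto
          have "inj_on h Y3"
          proof (rule inj_onI)
            fix y z assume yz: "y \<in> Y3" "z \<in> Y3" "h y = h z"
            then have "R y z" unfolding R_def using x h X3(1) by (intro bexI[of _ x]) auto
            then show "y = z" using Y2(3) yz 1(1) by blast
          qed
          then have "ygrid X3 Y3 f" unfolding ygrid_def using h by blast
          then show ?thesis using that[OF 1(1,2)] by (simp add: canonical_def)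
        qed
      next
        case 2
        have "igrid X3 Y3 f" unfolding igrid_def
        proof (intro ballI impI)
          fix x x' y y' assume a: "x \<in> X3" "x' \<in> X3" "y \<in> Y3" "y' \<in> Y3" "f x y = f x' y'"
          then have "R y y'" unfolding R_def using X3(1) by blast
          then have "y = y'" using Y2(3) a 2(1) by blast
          then show "x = x' \<and> y = y'" using 2(3) a by (auto simp: inj_on_def)
        qed
        then show ?thesis using that[OF 2(1,2)] by (simp add: canonical_def)
      qed
      then show ?thesis using X3(1,2) 2(1) X1(1) Y2(1) Y1(1) by (intro exI[of _ X3] exI[of _ Y3] conjI) auto
    qed
  qed
qed

lemma canonical_ramsey_many:
  "\<exists>M. \<forall>(X :: 'a set) (Y :: 'b set) (f :: nat \<Rightarrow> 'a \<Rightarrow> 'b \<Rightarrow> 'c). finite X \<longrightarrow> finite Y \<longrightarrow> M \<le> card X \<longrightarrow> M \<le> card Y \<longrightarrow>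
    (\<exists>X'\<subseteq>X. \<exists>Y'\<subseteq>Y. card X' = m \<and> card Y' = m \<and> (\<forall>i<r. canonical X' Y' (f i)))"
proof (induction r)
  case 0
  show ?case by (rule exI[of _ m]) (auto dest!: subset_of_card)
next
  case (Suc r)
  from Suc.IH obtain M where M: "\<forall>(X :: 'a set) (Y :: 'b set) (f :: nat \<Rightarrow> 'a \<Rightarrow> 'b \<Rightarrow> 'c). finite X \<longrightarrow> finite Y \<longrightarrow> M \<le> card X \<longrightarrow> M \<le> card Y \<longrightarrow>
    (\<exists>X'\<subseteq>X. \<exists>Y'\<subseteq>Y. card X' = m \<and> card Y' = m \<and> (\<forall>i<r. canonical X' Y' (f i)))" by (elim exE) (rule that)
  obtain M' where M': "\<forall>(X :: 'a set) (Y :: 'b set) (f :: 'a \<Rightarrow> 'b \<Rightarrow> 'c). finite X \<longrightarrow> finite Y \<longrightarrow> M' \<le> card X \<longrightarrow> M' \<le> card Y \<longrightarrow>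
    (\<exists>X'\<subseteq>X. \<exists>Y'\<subseteq>Y. card X' = M \<and> card Y' = M \<and> canonical X' Y' f)" using canonical_ramsey[of M] by (elim exE) (rule that)
  show ?case
  proof (intro exI[of _ M'] allI impI)
    fix X :: "'a set" and Y :: "'b set" and f :: "nat \<Rightarrow> 'a \<Rightarrow> 'b \<Rightarrow> 'c"
    assume a: "finite X" "finite Y" "M' \<le> card X" "M' \<le> card Y"
    obtain X1 Y1 where 1: "X1 \<subseteq> X" "Y1 \<subseteq> Y" "card X1 = M" "card Y1 = M" "canonical X1 Y1 (f r)"
      using M'[rule_format, OF a, of "f r"] by blast
    obtain X2 Y2 where 2: "X2 \<subseteq> X1" "Y2 \<subseteq> Y1" "card X2 = m" "card Y2 = m" "\<forall>i<r. canonical X2 Y2 (f i)"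
      using M[rule_format, of X1 Y1 f] 1 a finite_subset by (metis order_refl)
    have "\<forall>i<Suc r. canonical X2 Y2 (f i)" using 2 canonical_subset[OF 1(5) 2(1,2)] less_Suc_eq by auto
    then show "\<exists>X'\<subseteq>X. \<exists>Y'\<subseteq>Y. card X' = m \<and> card Y' = m \<and> (\<forall>i<Suc r. canonical X' Y' (f i))"
      using 1 2 by (intro exI[of _ X2] exI[of _ Y2] conjI) auto
  qed
qed

text \<open>A canonical pattern with values in \<open>bool\<close> on at least three rows and
  columns cannot be injective in any coordinate, so it is constant.\<close>

lemma two_colour_ramsey:
  "\<exists>M. \<forall>(X :: 'a set) (Y :: 'b set) P. finite X \<longrightarrow> finite Y \<longrightarrow> M \<le> card X \<longrightarrow> M \<le> card Y \<longrightarrow>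
    (\<exists>X'\<subseteq>X. \<exists>Y'\<subseteq>Y. card X' = m \<and> card Y' = m \<and> ((\<forall>x\<in>X'. \<forall>y\<in>Y'. P x y) \<or> (\<forall>x\<in>X'. \<forall>y\<in>Y'. \<not> P x y)))"
proof -
  obtain M where M: "\<forall>(X :: 'a set) (Y :: 'b set) (f :: 'a \<Rightarrow> 'b \<Rightarrow> bool). finite X \<longrightarrow> finite Y \<longrightarrow> M \<le> card X \<longrightarrow> M \<le> card Y \<longrightarrow>
    (\<exists>X'\<subseteq>X. \<exists>Y'\<subseteq>Y. card X' = m + 3 \<and> card Y' = m + 3 \<and> canonical X' Y' f)" using canonical_ramsey[of "m + 3"] by (elim exE) (rule that)
  have nob: "\<not> inj_on g S" if "card S = m + 3" for g :: "'d \<Rightarrow> bool" and S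
  proof
    assume "inj_on g S"
    then have "card S \<le> card (UNIV :: bool set)" by (metis card_image card_mono finite_UNIV subset_UNIV finite_class.finite_UNIV)
    then show False using that by simp
  qed
  show ?thesis
  proof (intro exI[of _ M] allI impI)
    fix X :: "'a set" and Y :: "'b set" and P :: "'a \<Rightarrow> 'b \<Rightarrow> bool"
    assume a: "finite X" "finite Y" "M \<le> card X" "M \<le> card Y"
    obtain X1 Y1 where 1: "X1 \<subseteq> X" "Y1 \<subseteq> Y" "card X1 = m + 3" "card Y1 = m + 3" "canonical X1 Y1 P"
      using M[rule_format, OF a, of P] by blast
    have "\<not> xgrid X1 Y1 P" "\<not> ygrid X1 Y1 P" using nob[OF 1(3)] nob[OF 1(4)] by (auto simp: xgrid_def ygrid_def)
    moreover have "\<not> igrid X1 Y1 P"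
    proof
      assume i: "igrid X1 Y1 P"
      obtain y where y: "y \<in> Y1" using 1(4) by fastforce
      have "inj_on (\<lambda>x. P x y) X1" using i y by (auto simp: igrid_def inj_on_def)
      then show False using nob[OF 1(3)] by blast
    qed
    ultimately have c: "cgrid X1 Y1 P" using 1(5) by (auto simp: canonical_def)
    obtain X2 where X2: "X2 \<subseteq> X1" "card X2 = m" using subset_of_card[of m X1] 1 by auto
    obtain Y2 where Y2: "Y2 \<subseteq> Y1" "card Y2 = m" using subset_of_card[of m Y1] 1 by auto
    have "(\<forall>x\<in>X2. \<forall>y\<in>Y2. P x y) \<or> (\<forall>x\<in>X2. \<forall>y\<in>Y2. \<not> P x y)"
      using c X2 Y2 unfolding cgrid_def by (metis subsetD)
    then show "\<exists>X'\<subseteq>X. \<exists>Y'\<subseteq>Y. card X' = m \<and> card Y' = m \<and> ((\<forall>x\<in>X'. \<forall>y\<in>Y'. P x y) \<or> (\<forall>x\<in>X'. \<forall>y\<in>Y'. \<not> P x y))"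
      using 1 X2 Y2 by (intro exI[of _ X2] exI[of _ Y2] conjI) auto
  qed
qed

subsection \<open>Loose cycles from canonical grids\<close>

lemma lpath2:
  assumes g: "graph_on V E" and "{x, y} \<in> E" "{x, a} \<in> E" "{y, a} \<in> E" "{y, z} \<in> E" "{y, b} \<in> E" "{z, b} \<in> E"
    and "x \<noteq> z" "x \<noteq> b" "a \<noteq> z" "a \<noteq> b"
  shows "lpath E x z 2 {x, y, a, z, b}"
proof -
  have "lpath E x z (1 + 1) ({x, y, a} \<union> {y, z, b})"
    using assms graph_on_neq[OF g]
    by (intro lpath_join[OF lpath_tri[OF g] lpath_tri[OF g]]) auto
  moreover have "{x, y, a} \<union> {y, z, b} = {x, y, a, z, b}" by auto
  ultimately show ?thesis by (simp add: numeral_2_eq_2)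
qed

lemma lpath3:
  assumes g: "graph_on V E" and "{x, y} \<in> E" "{x, a} \<in> E" "{y, a} \<in> E" "{y, z} \<in> E" "{y, b} \<in> E" "{z, b} \<in> E"
    "{z, v} \<in> E" "{z, c} \<in> E" "{v, c} \<in> E"
    and "x \<noteq> z" "x \<noteq> b" "a \<noteq> z" "a \<noteq> b" "v \<notin> {x, y, a, b}" "c \<notin> {x, y, a, b}"
  shows "lpath E x v 3 {x, y, a, z, b, v, c}"
proof -
  have 1: "lpath E x z 2 {x, y, a, z, b}" using assms by (intro lpath2[OF g]) auto
  have "lpath E x v (2 + 1) ({x, y, a, z, b} \<union> {z, v, c})"
    using assms graph_on_neq[OF g]
    by (intro lpath_join[OF 1 lpath_tri[OF g]]) auto
  moreover have "{x, y, a, z, b} \<union> {z, v, c} = {x, y, a, z, b, v, c}" by auto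
  ultimately show ?thesis by (simp add: numeral_3_eq_3)
qed

lemma card_inj_preimage: "inj_on a X \<Longrightarrow> finite G \<Longrightarrow> card {x\<in>X. a x \<in> G} \<le> card G"
  by (rule card_inj_on_le[of a]) (auto simp: inj_on_def)

text \<open>Chooses a core vertex \<open>x\<close> together with two apexes \<open>a x\<close> and
  \<open>b x\<close> that depend on it. By injectivity each forbidden apex rules out at most one
  \<open>x\<close>.\<close>

lemma fresh3:
  assumes "finite F" "finite G" "finite H" "inj_on a X" "inj_on b X" "card F + card G + card H < card X"
  obtains x where "x \<in> X" "x \<notin> F" "a x \<notin> G" "b x \<notin> H"
proof -
  have X: "finite X" using assms(6) by (metis card.infinite not_less0)
  let ?B = "F \<union> {x\<in>X. a x \<in> G} \<union> {x\<in>X. b x \<in> H}"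
  have "card ?B \<le> card F + card {x\<in>X. a x \<in> G} + card {x\<in>X. b x \<in> H}"
    by (meson add_mono_thms_linordered_semiring(3) card_Un_le le_trans)
  also have "\<dots> \<le> card F + card G + card H"
    using assms by (intro add_mono card_inj_preimage order.refl)
  finally have "card ?B < card X" using assms(6) by simp
  then obtain x where "x \<in> X" "x \<notin> ?B" using fresh[of ?B X] X assms(1) by auto
  then show thesis using that by auto
qed

text \<open>A cherry is a loose path of two triangles between points of \<open>Y\<close>; it is
  demanded around every forbidden set of size at most \<open>c\<close>. Chains of cherries realise
  even lengths only.\<close>

definition cherries :: "'a set set \<Rightarrow> 'a set \<Rightarrow> nat \<Rightarrow> bool" where
  "cherries E Y c \<longleftrightarrow> (\<forall>y\<in>Y. \<forall>y'\<in>Y. \<forall>F. y \<noteq> y' \<longrightarrow> finite F \<longrightarrow> card F \<le> c \<longrightarrow>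
     (\<exists>U. lpath E y y' 2 U \<and> U \<inter> F \<subseteq> {y, y'}))"

lemma cherries_chain:
  assumes "cherries E Y c" "c \<le> card Y"
  shows "y \<in> Y \<Longrightarrow> y' \<in> Y \<Longrightarrow> y \<noteq> y' \<Longrightarrow> finite F \<Longrightarrow> card F + 5 * j + 3 \<le> c \<Longrightarrow>
    \<exists>U. lpath E y y' (2 * Suc j) U \<and> U \<inter> F \<subseteq> {y, y'}"
proof (induction j arbitrary: y F)
  case 0
  then show ?case using assms(1) unfolding cherries_def by auto
next
  case (Suc j)
  have "card (F \<union> {y, y'}) \<le> card F + 2"
    using card_Un_le[of F "{y, y'}"] card_length[of "[y, y']"] by simp
  then obtain z where z: "z \<in> Y" "z \<notin> F \<union> {y, y'}"
    using fresh[of "F \<union> {y, y'}" Y] Suc.prems assms(2) by auto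
  have "card (insert y' F) \<le> c" using card_insert_bound[of F y'] Suc.prems by simp
  then obtain U1 where U1: "lpath E y z 2 U1" "U1 \<inter> insert y' F \<subseteq> {y, z}"
    using assms(1) Suc.prems z unfolding cherries_def by (metis UnCI finite.insertI insert_iff)
  have c1: "finite U1" "card U1 = 5" using lpath_card[OF U1(1)] by auto
  have "card (F \<union> U1) + 5 * j + 3 \<le> c" using card_Un_le[of F U1] c1 Suc.prems by simp
  then obtain U2 where U2: "lpath E z y' (2 * Suc j) U2" "U2 \<inter> (F \<union> U1) \<subseteq> {z, y'}"
    using Suc.IH[of z "F \<union> U1"] z Suc.prems c1 by auto
  have "z \<in> U1" "z \<in> U2" using U1(1) U2(1) lpath_ends by fast+
  then have "U1 \<inter> U2 = {z}" using U1(2) U2(2) z Suc.prems(3) by auto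
  then have "lpath E y y' (2 + 2 * Suc j) (U1 \<union> U2)" using lpath_join[OF U1(1) U2(1)] by simp
  moreover have "(U1 \<union> U2) \<inter> F \<subseteq> {y, y'}" using U1(2) U2(2) z by auto
  ultimately show ?case by (intro exI[of _ "U1 \<union> U2"]) simp
qed

text \<open>The even cycle consists of \<open>t + 1\<close> cherries. In the odd one the given path
  of length 3 replaces one cherry and half of another: \<open>3 + 2 * (t - 1) = 2 * t + 1\<close>. A
  cherry has five vertices, which is the 5 in the bounds.\<close>

lemma cherries_cycles:
  assumes "cherries E Y c" "c \<le> card Y" "2 \<le> t" "10 * t + 20 \<le> c"
    and "lpath E y y' 3 U" "y \<in> Y" "y' \<in> Y" "y \<noteq> y'"
  shows "lcyc E (2 * t + 1) \<and> lcyc E (2 * t + 2)"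
proof
  have U: "finite U" "card U = 7" using lpath_card[OF assms(5)] by auto
  have c: "5 * (t - 2) + 10 \<le> c" using assms(3,4) by linarith
  obtain U2 where U2: "lpath E y' y (2 * Suc (t - 2)) U2" "U2 \<inter> U \<subseteq> {y', y}"
    using cherries_chain[OF assms(1,2) assms(7,6), of U "t - 2"] assms U c by auto
  have eq: "2 * t + 1 = 3 + 2 * Suc (t - 2)" using assms(3) by simp
  show "lcyc E (2 * t + 1)" unfolding eq
    using U2(2) assms(8) by (intro lcyc_two_paths[OF assms(5) U2(1)]) auto
  obtain U1 where U1: "lpath E y y' 2 U1" "U1 \<inter> {} \<subseteq> {y, y'}"
    using cherries_chain[OF assms(1,2) assms(6,7,8), of "{}" 0] assms by auto
  have c1: "finite U1" "card U1 = 5" using lpath_card[OF U1(1)] by auto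
  have c': "5 * (t - 1) + 8 \<le> c" using assms(3,4) by linarith
  obtain U3 where U3: "lpath E y' y (2 * Suc (t - 1)) U3" "U3 \<inter> U1 \<subseteq> {y', y}"
    using cherries_chain[OF assms(1,2) assms(7,6), of U1 "t - 1"] assms c1 c' by auto
  have eq: "2 * t + 2 = 2 + 2 * Suc (t - 1)" using assms(3) by simp
  show "lcyc E (2 * t + 2)" unfolding eq
    using U3(2) assms(8) by (intro lcyc_two_paths[OF U1(1) U3(1)]) auto
qed

text \<open>What a detour around a triangle needs: after removal of the third vertex of the
  triangle, the two codegrees are at least 1 and sum to at least 3, so the two new apexes can be
  chosen distinct.\<close>

definition rich :: "'a set set \<Rightarrow> bool" where
  "rich E \<longleftrightarrow> (\<forall>x y. {x, y} \<in> E \<longrightarrow> 2 \<le> card (cn E x y)) \<and>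
     (\<forall>x y z. {x, y} \<in> E \<longrightarrow> {x, z} \<in> E \<longrightarrow> {y, z} \<in> E \<longrightarrow> 5 \<le> card (cn E x z) + card (cn E y z))"

text \<open>Two triangles on different edges of a given triangle, with distinct new vertices.
  This is what changes the parity of a cycle running through a bipartite grid.\<close>
lemma rich_detour:
  assumes "graph_on V E" "finite V" "rich E" "{x, y} \<in> E" "{x, z} \<in> E" "{y, z} \<in> E"
  obtains u u' where "u \<in> cn E x z" "u \<noteq> y" "u' \<in> cn E y z" "u' \<noteq> x" "u \<noteq> u'"
proof -
  let ?A = "cn E x z - {y}" and ?B = "cn E y z - {x}"
  have fin: "finite (cn E x z)" "finite (cn E y z)" using finite_cn[OF assms(1,2)] by auto
  have "y \<in> cn E x z" "x \<in> cn E y z" using assms(4-6) by (auto simp: cn_iff insert_commute)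
  then have c: "card ?A = card (cn E x z) - 1" "card ?B = card (cn E y z) - 1" by simp_all
  have r: "2 \<le> card (cn E x z)" "2 \<le> card (cn E y z)" "5 \<le> card (cn E x z) + card (cn E y z)"
    using assms(3-6) unfolding rich_def by blast+
  then have n: "card ?A \<ge> 1" "card ?B \<ge> 1" "card ?A \<ge> 2 \<or> card ?B \<ge> 2" using c by auto
  from n(3) show thesis
  proof
    assume A: "card ?A \<ge> 2"
    obtain u' where u': "u' \<in> ?B" using n(2) by (metis card.empty ex_in_conv not_one_le_zero)
    have "card {u'} < card ?A" using A by simp
    then obtain u where "u \<in> ?A" "u \<notin> {u'}" using fresh[of "{u'}" ?A] by blast
    then show thesis using that u' by auto
  next
    assume B: "card ?B \<ge> 2"
    obtain u where u: "u \<in> ?A" using n(1) by (metis card.empty ex_in_conv not_one_le_zero)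
    have "card {u} < card ?B" using B by simp
    then obtain u' where "u' \<in> ?B" "u' \<notin> {u}" using fresh[of "{u}" ?B] by blast
    then show thesis using that u by auto
  qed
qed

lemma card_le5: "card {a, b, c, d, e} \<le> 5"
  using card_length[of "[a, b, c, d, e]"] by simp

text \<open>Two edges \<open>xy\<close> and \<open>xy'\<close> have distinct apexes, which gives
  cherries through a vertex of \<open>X\<close>. For the odd step the edge from \<open>y\<close> to
  \<open>x\<close> is replaced by the way \<open>y\<close>, \<open>f x y\<close>, \<open>x\<close>
  around its triangle, with the apexes of \<open>rich_detour\<close>; a last triangle leads from
  \<open>x\<close> on to \<open>y2\<close>.\<close>

lemma igrid_cycles:
  assumes g: "graph_on V E" and fV: "finite V" and r: "rich E" and t: "2 \<le> t"
    and e: "\<forall>x\<in>X. \<forall>y\<in>Y. {x, y} \<in> E" and f: "\<forall>x\<in>X. \<forall>y\<in>Y. f x y \<in> cn E x y" and i: "igrid X Y f"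
    and m: "50 * t + 100 \<le> card X" "50 * t + 100 \<le> card Y"
  shows "lcyc E (2 * t + 1) \<and> lcyc E (2 * t + 2)"
proof -
  define c where "c = 10 * t + 20"
  have fe: "{x, f x y} \<in> E" "{y, f x y} \<in> E" if "x \<in> X" "y \<in> Y" for x y using f that by (auto simp: cn_iff)
  have injx: "inj_on (\<lambda>x. f x y) X" if "y \<in> Y" for y using i that unfolding igrid_def inj_on_def by blast
  have injy: "inj_on (f x) Y" if "x \<in> X" for x using i that unfolding igrid_def inj_on_def by blast
  have "cherries E Y c" unfolding cherries_def
  proof (intro ballI allI impI)
    fix y y' and F :: "'a set" assume a: "y \<in> Y" "y' \<in> Y" "y \<noteq> y'" "finite F" "card F \<le> c"
    have "card F + card (insert y' F) + card (insert y F) < card X"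
      using card_insert_bound[OF a(4), of y] card_insert_bound[OF a(4), of y'] a(5) m by (simp add: c_def)
    then obtain x where x: "x \<in> X" "x \<notin> F" "f x y \<notin> insert y' F" "f x y' \<notin> insert y F"
      using fresh3[of F "insert y' F" "insert y F" "\<lambda>x. f x y" X "\<lambda>x. f x y'"] a(4) injx[OF a(1)] injx[OF a(2)] by auto
    have "f x y \<noteq> f x y'" using i x(1) a(1-3) unfolding igrid_def by blast
    then have "lpath E y y' 2 {y, x, f x y, y', f x y'}"
      using e fe x a by (intro lpath2[OF g]) (auto simp: insert_commute)
    then show "\<exists>U. lpath E y y' 2 U \<and> U \<inter> F \<subseteq> {y, y'}" using x by (intro exI conjI) auto
  qed
  moreover obtain x where x: "x \<in> X" using m(1) by fastforce
  moreover obtain y where y: "y \<in> Y" using m(2) by fastforce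
  obtain u u' where u: "u \<in> cn E x (f x y)" "u \<noteq> y" "u' \<in> cn E y (f x y)" "u' \<noteq> x" "u \<noteq> u'"
    using rich_detour[OF g fV r, of x y "f x y"] e fe x y by metis
  have "card {y, x, f x y, u, u'} + card {y, x, f x y, u, u'} + card {} < card Y"
    using card_le5[of y x "f x y" u u'] m(2) by simp
  then obtain y2 where y2: "y2 \<in> Y" "y2 \<notin> {y, x, f x y, u, u'}" "f x y2 \<notin> {y, x, f x y, u, u'}"
    using fresh3[of "{y, x, f x y, u, u'}" "{y, x, f x y, u, u'}" "{}" "f x" Y "f x"] injy[OF x] by auto
  have "lpath E y y2 3 {y, f x y, u', x, u, y2, f x y2}"
    using e fe x y y2 u graph_on_neq[OF g] by (intro lpath3[OF g]) (auto simp: cn_iff insert_commute)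
  ultimately show ?thesis
    using cherries_cycles[of E Y c t y y2] t y y2 m by (auto simp: c_def)
qed

text \<open>Cherries \<open>y\<close>, \<open>x\<close>, \<open>y'\<close> use the two apexes
  \<open>p x\<close> and \<open>q x\<close>. The path of length 3 has the core \<open>y\<close>,
  \<open>p x\<close>, \<open>x\<close>, \<open>y2\<close>: since \<open>p x\<close> is joined to all
  of \<open>Y\<close>, a further point \<open>u\<close> of \<open>Y\<close> serves as apex over the
  edge from \<open>p x\<close> to \<open>x\<close>. The third choice \<open>f\<close> is a reserve
  for the last triangle.\<close>

lemma two_xgrid_cycles:
  assumes g: "graph_on V E" and fV: "finite V" and r: "rich E" and t: "2 \<le> t"
    and e: "\<forall>x\<in>X. \<forall>y\<in>Y. {x, y} \<in> E"
    and p: "inj_on p X" "\<forall>x\<in>X. \<forall>y\<in>Y. p x \<in> cn E x y" and q: "inj_on q X" "\<forall>x\<in>X. \<forall>y\<in>Y. q x \<in> cn E x y"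
    and pq: "\<forall>x\<in>X. p x \<noteq> q x"
    and f: "\<forall>x\<in>X. \<forall>y\<in>Y. f x y \<in> cn E x y \<and> f x y \<noteq> p x \<and> f x y \<noteq> q x"
    and m: "50 * t + 100 \<le> card X" "50 * t + 100 \<le> card Y"
  shows "lcyc E (2 * t + 1) \<and> lcyc E (2 * t + 2)"
proof -
  define c where "c = 10 * t + 20"
  have fe: "{x, p x} \<in> E" "{y, p x} \<in> E" "{x, q x} \<in> E" "{y, q x} \<in> E" "{x, f x y} \<in> E" "{y, f x y} \<in> E"
    if "x \<in> X" "y \<in> Y" for x y using p q f that by (auto simp: cn_iff)
  have ne: "p x \<noteq> y" "q x \<noteq> y" if "x \<in> X" "y \<in> Y" for x y
    using fe[OF that] graph_on_neq[OF g] by blast+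
  have "cherries E Y c" unfolding cherries_def
  proof (intro ballI allI impI)
    fix y y' and F :: "'a set" assume a: "y \<in> Y" "y' \<in> Y" "y \<noteq> y'" "finite F" "card F \<le> c"
    have "card F + card F + card F < card X" using a(5) m by (simp add: c_def)
    then obtain x where x: "x \<in> X" "x \<notin> F" "p x \<notin> F" "q x \<notin> F"
      using fresh3[of F F F p X q] a(4) p q by auto
    have "lpath E y y' 2 {y, x, p x, y', q x}"
      using e fe[of x] x a(1-3) ne[OF x(1) a(1)] ne[OF x(1) a(2)] pq by (intro lpath2[OF g]) (auto simp: insert_commute)
    then show "\<exists>U. lpath E y y' 2 U \<and> U \<inter> F \<subseteq> {y, y'}" using x by (intro exI conjI) auto
  qed
  moreover obtain x where x: "x \<in> X" using m(1) by fastforce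
  have "\<exists>v. v \<in> cn E y (p x) \<and> v \<noteq> x" if "y \<in> Y" for y
  proof -
    have "card {x} < card (cn E y (p x))" using r fe[OF x that] unfolding rich_def by fastforce
    then show ?thesis using fresh[of "{x}"] by blast
  qed
  then obtain v where v: "\<And>y. y \<in> Y \<Longrightarrow> v y \<in> cn E y (p x) \<and> v y \<noteq> x" by metis
  have fY: "finite Y" using m(2) by (metis add_is_0 card.infinite le_zero_eq zero_neq_numeral)
  obtain y y2 where y: "y \<in> Y" "y2 \<in> Y" "y \<noteq> y2" "v y \<noteq> y2" "f x y2 \<noteq> y"
  proof (rule ccontr)
    assume "\<not> thesis"
    then have *: "a = b \<or> v a = b \<or> f x b = a" if "a \<in> Y" "b \<in> Y" for a b
      using that \<open>\<And>y y2. y \<in> Y \<Longrightarrow> y2 \<in> Y \<Longrightarrow> y \<noteq> y2 \<Longrightarrow> v y \<noteq> y2 \<Longrightarrow> f x y2 \<noteq> y \<Longrightarrow> thesis\<close> by blast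
    \<comment> \<open>With \<open>x\<close> fixed, each of the three ways in which a pair can fail
      determines one entry from the other, so at most \<open>3 * card Y\<close> pairs are
      bad.\<close>
    have "Y \<times> Y \<subseteq> (\<lambda>y. (y, y)) ` Y \<union> (\<lambda>y. (y, v y)) ` Y \<union> (\<lambda>y. (f x y, y)) ` Y"
    proof
      fix r assume "r \<in> Y \<times> Y"
      then obtain a b where "r = (a, b)" "a \<in> Y" "b \<in> Y" by auto
      then show "r \<in> (\<lambda>y. (y, y)) ` Y \<union> (\<lambda>y. (y, v y)) ` Y \<union> (\<lambda>y. (f x y, y)) ` Y"
        using *[OF \<open>a \<in> Y\<close> \<open>b \<in> Y\<close>] by auto
    qed
    then have "card (Y \<times> Y) \<le> card ((\<lambda>y. (y, y)) ` Y \<union> (\<lambda>y. (y, v y)) ` Y \<union> (\<lambda>y. (f x y, y)) ` Y)"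
      using fY by (intro card_mono) auto
    also have "\<dots> \<le> card Y + card Y + card Y"
      by (intro order.trans[OF card_Un_le] add_mono card_image_le fY)
    finally have "card Y * card Y \<le> card Y + card Y + card Y" by (simp only: card_cartesian_product)
    moreover have "100 * card Y \<le> card Y * card Y" using m(2) by (intro mult_right_mono) auto
    ultimately show False using m(2) by linarith
  qed
  \<comment> \<open>If \<open>q x\<close> is already taken by \<open>v y\<close>, the third choice
    differs from it and is used instead.\<close>
  define a where "a = (if q x \<noteq> v y then q x else f x y2)"
  have a: "a \<in> cn E x y2" "a \<noteq> y" "a \<noteq> p x" "a \<noteq> v y"
    using q f x y ne[OF x] pq unfolding a_def by (auto split: if_splits)
  have "card (insert y2 {y, x, p x, v y, a}) < card Y"
    using card_le5[of y x "p x" "v y" a] card_insert_bound[of "{y, x, p x, v y, a}" y2] m(2) by simp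
  then obtain u where u: "u \<in> Y" "u \<notin> insert y2 {y, x, p x, v y, a}"
    using fresh[of "insert y2 {y, x, p x, v y, a}" Y] by blast
  have "x \<noteq> y" "x \<noteq> y2" "{x, y2} \<in> E" using e x y graph_on_neq[OF g] by blast+
  then have "lpath E y y2 3 {y, p x, v y, x, u, y2, a}"
    using fe[OF x y(1)] fe[OF x y(2)] fe[OF x u(1)] y u a v[OF y(1)] ne(1)[OF x y(1)] ne(1)[OF x y(2)] e x
    by (intro lpath3[OF g]) (auto simp: cn_iff insert_commute)
  ultimately show ?thesis
    using cherries_cycles[of E Y c t y y2] t y m by (auto simp: c_def)
qed

text \<open>The common neighbours of a centre and a point of the grid are found on the opposite side
  of the grid.\<close>

lemma grid_env:
  assumes g: "graph_on V E" and fV: "finite V"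
    and e: "\<forall>x\<in>X. \<forall>y\<in>Y. {x, y} \<in> E" and W: "\<forall>w\<in>W. \<forall>x\<in>X \<union> Y. {w, x} \<in> E"
    and m: "0 < m" "m \<le> card X" "m \<le> card Y"
  shows "env E (X \<union> Y) W m"
proof -
  have fin: "finite X" "finite Y" using m by (auto intro: card_ge_0_finite)
  have "m \<le> card (cn E w x)" if w: "w \<in> W" and x: "x \<in> X \<union> Y" for w x
  proof -
    have "Y \<subseteq> cn E w x" if "x \<in> X" using that W w e by (auto simp: cn_iff)
    moreover have "X \<subseteq> cn E w x" if "x \<in> Y" using that W w e by (auto simp: cn_iff insert_commute)
    ultimately have "X \<subseteq> cn E w x \<or> Y \<subseteq> cn E w x" using x by blast
    then show ?thesis using card_mono[OF finite_cn[OF g fV, of w x]] m by (meson order_trans)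
  qed
  moreover have "m \<le> card (X \<union> Y)" using m(2) card_mono[of "X \<union> Y" X] fin by auto
  ultimately show ?thesis using W unfolding env_def by blast
qed

text \<open>Along the zigzag \<open>x1\<close>, \<open>y2\<close>, \<open>x3\<close>,
  \<open>y4\<close>, \<open>x5\<close> the apexes alternate between \<open>h\<close> of the even
  points and \<open>p\<close> of the odd ones, so that no apex is repeated. The zigzags of length 3
  and 4 close up through the \<open>t - 1\<close> centres.\<close>

lemma mixed_grid_cycles:
  assumes g: "graph_on V E" and fV: "finite V" and t: "2 \<le> t"
    and e: "\<forall>x\<in>X. \<forall>y\<in>Y. {x, y} \<in> E"
    and p: "inj_on p X" "\<forall>x\<in>X. \<forall>y\<in>Y. p x \<in> cn E x y" and h: "inj_on h Y" "\<forall>x\<in>X. \<forall>y\<in>Y. h y \<in> cn E x y"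
    and W: "\<forall>w\<in>W. \<forall>x\<in>X \<union> Y. {w, x} \<in> E" "finite W" "card W = t - 1"
    and Wp: "\<forall>x\<in>X. p x \<notin> W" and Wh: "\<forall>y\<in>Y. h y \<notin> W"
    and m: "50 * t + 100 \<le> card X" "50 * t + 100 \<le> card Y"
  shows "lcyc E (2 * t + 1) \<and> lcyc E (2 * t + 2)"
proof -
  have env: "env E (X \<union> Y) W (50 * t + 100)" using grid_env[OF g fV e W(1)] m t by simp
  have We: "W \<noteq> {}" using W(3) t by auto
  have XW: "v \<notin> W" if "v \<in> X \<union> Y" for v using W(1) that graph_on_loop[OF g, of v] by force
  have pe: "{x, p x} \<in> E" "{y, p x} \<in> E" "{x, h y} \<in> E" "{y, h y} \<in> E" "{y, x} \<in> E" "{x, y} \<in> E"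
    if "x \<in> X" "y \<in> Y" for x y using p h e that by (auto simp: cn_iff insert_commute)
  obtain x1 where x1: "x1 \<in> X" using m(1) by fastforce
  have "card {x1} + card {x1} + card {} < card Y" using m(2) by simp
  then obtain y2 where y2: "y2 \<in> Y" "y2 \<notin> {x1}" "h y2 \<notin> {x1}"
    using fresh3[of "{x1}" "{x1}" "{}" h Y h] h by auto
  define F2 where "F2 = {x1, y2, h y2}"
  have F2: "finite F2" "card F2 \<le> 3" unfolding F2_def using card_length[of "[x1, y2, h y2]"] by auto
  have "card F2 + card F2 + card {} < card X" using F2 m(1) by simp
  then obtain x3 where x3: "x3 \<in> X" "x3 \<notin> F2" "p x3 \<notin> F2"
    using fresh3[of F2 F2 "{}" p X p] p F2 by auto
  define F3 where "F3 = {x1, y2, h y2, x3, p x3}"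
  have F3: "finite F3" "card F3 \<le> 5" unfolding F3_def using card_le5 by auto
  have "card F3 + card F3 + card {} < card Y" using F3 m(2) by simp
  then obtain y4 where y4: "y4 \<in> Y" "y4 \<notin> F3" "h y4 \<notin> F3"
    using fresh3[of F3 F3 "{}" h Y h] h F3 by auto
  define F4 where "F4 = {y4, h y4} \<union> F3"
  have F4: "finite F4" "card F4 \<le> 7" unfolding F4_def
    using card_Un_le[of "{y4, h y4}" F3] card_length[of "[y4, h y4]"] F3 by auto
  have "card F4 + card F4 + card {} < card X" using F4 m(1) by simp
  then obtain x5 where x5: "x5 \<in> X" "x5 \<notin> F4" "p x5 \<notin> F4"
    using fresh3[of F4 F4 "{}" p X p] p F4 by auto
  have L3: "lpath E x1 y4 3 {x1, y2, h y2, x3, p x3, y4, h y4}"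
    using x1 y2 x3 y4 pe by (intro lpath3[OF g]) (auto simp: F2_def F3_def)
  have "lpath E x1 x5 (3 + 1) ({x1, y2, h y2, x3, p x3, y4, h y4} \<union> {y4, x5, p x5})"
    using y4 x5 pe by (intro lpath_join[OF L3 lpath_tri[OF g]]) (auto simp: F3_def F4_def)
  then have L4: "lpath E x1 x5 4 ({x1, y2, h y2, x3, p x3, y4, h y4} \<union> {y4, x5, p x5})" by simp
  have "lcyc E (2 * t + 1)"
    by (rule env_close[OF g env W(2) We _ _ _ L3])
      (use x1 y2 x3 y4 Wp Wh XW t W(3) in \<open>auto simp: F3_def\<close>)
  moreover have "lcyc E (2 * t + 2)"
    by (rule env_close[OF g env W(2) We _ _ _ L4])
      (use x1 y2 x3 y4 x5 Wp Wh XW t W(3) in \<open>auto simp: F3_def F4_def\<close>)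
  ultimately show ?thesis by simp
qed

text \<open>The paths \<open>x\<close>, \<open>y\<close> and \<open>x\<close>, \<open>y\<close>,
  \<open>x3\<close> with apexes \<open>p x\<close> and \<open>p x3\<close> are the two starting
  paths for \<open>t\<close> centres.\<close>

lemma xgrid_env_cycles:
  assumes g: "graph_on V E" and fV: "finite V" and t: "2 \<le> t"
    and e: "\<forall>x\<in>X. \<forall>y\<in>Y. {x, y} \<in> E"
    and p: "inj_on p X" "\<forall>x\<in>X. \<forall>y\<in>Y. p x \<in> cn E x y"
    and W: "\<forall>w\<in>W. \<forall>x\<in>X \<union> Y. {w, x} \<in> E" "finite W" "card W = t"
    and Wp: "\<forall>x\<in>X. p x \<notin> W"
    and m: "50 * t + 100 \<le> card X" "50 * t + 100 \<le> card Y"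
  shows "lcyc E (2 * t + 1) \<and> lcyc E (2 * t + 2)"
proof -
  have env: "env E (X \<union> Y) W (50 * t + 100)" using grid_env[OF g fV e W(1)] m t by simp
  have We: "W \<noteq> {}" using W(3) t by auto
  have XW: "v \<notin> W" if "v \<in> X \<union> Y" for v using W(1) that graph_on_loop[OF g, of v] by force
  have pe: "{x, p x} \<in> E" "{y, p x} \<in> E" "{y, x} \<in> E" "{x, y} \<in> E"
    if "x \<in> X" "y \<in> Y" for x y using p e that by (auto simp: cn_iff insert_commute)
  obtain x where x: "x \<in> X" using m(1) by fastforce
  obtain y where y: "y \<in> Y" using m(2) by fastforce
  have "card {x, p x} \<le> 2" using card_length[of "[x, p x]"] by simp
  then have "card {x, p x} + card {x, p x} + card {} < card X" using m(1) by simp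
  then obtain x3 where x3: "x3 \<in> X" "x3 \<notin> {x, p x}" "p x3 \<notin> {x, p x}"
    using fresh3[of "{x, p x}" "{x, p x}" "{}" p X p] p by auto
  have L1: "lpath E x y 1 {x, y, p x}" using pe x y by (intro lpath_tri[OF g]) auto
  have L2: "lpath E x x3 2 {x, y, p x, x3, p x3}"
    using pe x y x3 by (intro lpath2[OF g]) auto
  have "lcyc E (2 * t + 1)"
    by (rule env_close[OF g env W(2) We _ _ _ L1])
      (use x y Wp XW t W(3) pe[OF x y] graph_on_neq[OF g] in auto)
  moreover have "lcyc E (2 * t + 2)"
    by (rule env_close[OF g env W(2) We _ _ _ L2])
      (use x y x3 Wp XW t W(3) in auto)
  ultimately show ?thesis by simp
qed

text \<open>One centre \<open>w\<close> is set aside for the starting path: as an apex over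
  \<open>xy\<close> for the odd cycle, and as a core vertex between \<open>x\<close> and
  \<open>x3\<close>, with apexes \<open>y\<close> and \<open>y3\<close>, for the even one.\<close>

lemma env_cycles:
  assumes g: "graph_on V E" and fV: "finite V" and t: "2 \<le> t"
    and e: "\<forall>x\<in>X. \<forall>y\<in>Y. {x, y} \<in> E"
    and W: "\<forall>w\<in>W. \<forall>x\<in>X \<union> Y. {w, x} \<in> E" "finite W" "card W = Suc t"
    and m: "50 * t + 100 \<le> card X" "50 * t + 100 \<le> card Y"
  shows "lcyc E (2 * t + 1) \<and> lcyc E (2 * t + 2)"
proof -
  obtain w W0 where w: "W = insert w W0" "w \<notin> W0" "card W0 = t" "finite W0"
    using W by (metis card_Suc_eq finite_insert)
  have env: "env E (X \<union> Y) W0 (50 * t + 100)" using grid_env[OF g fV e] W(1) w m t by simp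
  have We: "W0 \<noteq> {}" using w(3) t by auto
  have XW: "v \<notin> W" if "v \<in> X \<union> Y" for v using W(1) that graph_on_loop[OF g, of v] by force
  obtain x where x: "x \<in> X" using m(1) by fastforce
  obtain y where y: "y \<in> Y" using m(2) by fastforce
  have "card {x} < card X" using m(1) by simp
  then obtain x3 where x3: "x3 \<in> X" "x3 \<notin> {x}" using fresh[of "{x}" X] by auto
  have "card {y} < card Y" using m(2) by simp
  then obtain y3 where y3: "y3 \<in> Y" "y3 \<notin> {y}" using fresh[of "{y}" Y] by auto
  have ed: "{x, y} \<in> E" "{x, y3} \<in> E" "{x3, y} \<in> E" "{x3, y3} \<in> E" "{w, x} \<in> E" "{w, x3} \<in> E" "{w, y} \<in> E" "{w, y3} \<in> E"
    using x y x3 y3 e W w by auto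
  have L1: "lpath E x y 1 {x, y, w}" using ed by (intro lpath_tri[OF g]) (auto simp: insert_commute)
  have L2: "lpath E x x3 2 {x, w, y, x3, y3}"
    using ed x3 y3 graph_on_neq[OF g] by (intro lpath2[OF g]) (auto simp: insert_commute)
  have "lcyc E (2 * t + 1)"
    by (rule env_close[OF g env w(4) We _ _ _ L1])
      (use x y w XW t ed graph_on_neq[OF g] in auto)
  moreover have "lcyc E (2 * t + 2)"
    by (rule env_close[OF g env w(4) We _ _ _ L2])
      (use x y x3 y3 w XW t in auto)
  ultimately show ?thesis by simp
qed


section \<open>From canonical choices of common neighbours to both cycles\<close>

lemma enum_subset: "finite S \<Longrightarrow> d \<le> card S \<Longrightarrow> \<exists>\<phi>. inj_on \<phi> {..<d::nat} \<and> \<phi> ` {..<d} \<subseteq> S"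
  using card_le_inj[of "{..<d}" S] by auto

lemma common_neighbour_functions:
  assumes "graph_on V E" "finite V" "\<forall>x\<in>X. \<forall>y\<in>Y. d \<le> card (cn E x y)"
  obtains f :: "nat \<Rightarrow> 'a \<Rightarrow> 'a \<Rightarrow> 'a" where "\<And>i x y. i < d \<Longrightarrow> x \<in> X \<Longrightarrow> y \<in> Y \<Longrightarrow> f i x y \<in> cn E x y"
    "\<And>i j x y. i < d \<Longrightarrow> j < d \<Longrightarrow> i \<noteq> j \<Longrightarrow> x \<in> X \<Longrightarrow> y \<in> Y \<Longrightarrow> f i x y \<noteq> f j x y"
proof -
  have "\<forall>x y. \<exists>\<phi>. x \<in> X \<longrightarrow> y \<in> Y \<longrightarrow> inj_on \<phi> {..<d} \<and> \<phi> ` {..<d} \<subseteq> cn E x y"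
    using enum_subset[OF finite_cn[OF assms(1,2)]] assms(3) by meson
  then obtain \<phi> where \<phi>: "\<And>x y. x \<in> X \<Longrightarrow> y \<in> Y \<Longrightarrow> inj_on (\<phi> x y) {..<d} \<and> \<phi> x y ` {..<d} \<subseteq> cn E x y"
    by metis
  show thesis by (rule that[of "\<lambda>i x y. \<phi> x y i"]) (use \<phi> in \<open>auto simp: inj_on_def image_subset_iff\<close>)
qed

text \<open>Unless one choice is of the injective type, or two of them are injective functions of
  the same side, at least \<open>t - 1\<close> of the \<open>t + 1\<close> choices are constant.
  Their values are centres, and the at most two remaining choices, one for each side, make up for
  the missing ones.\<close>

lemma canonical_functions_cycles:
  assumes g: "graph_on V E" and fV: "finite V" and r: "rich E" and t: "2 \<le> t"
    and e: "\<forall>x\<in>X. \<forall>y\<in>Y. {x, y} \<in> E"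
    and f: "\<And>i x y. i < t + 1 \<Longrightarrow> x \<in> X \<Longrightarrow> y \<in> Y \<Longrightarrow> f i x y \<in> cn E x y"
    and d: "\<And>i j x y. i < t + 1 \<Longrightarrow> j < t + 1 \<Longrightarrow> i \<noteq> j \<Longrightarrow> x \<in> X \<Longrightarrow> y \<in> Y \<Longrightarrow> f i x y \<noteq> f j x y"
    and can: "\<And>i. i < t + 1 \<Longrightarrow> canonical X Y (f i)"
    and m: "50 * t + 100 \<le> card X" "50 * t + 100 \<le> card Y"
  shows "lcyc E (2 * t + 1) \<and> lcyc E (2 * t + 2)"
proof -
  obtain x0 where x0: "x0 \<in> X" using m(1) by fastforce
  obtain y0 where y0: "y0 \<in> Y" using m(2) by fastforce
  have e': "\<forall>y\<in>Y. \<forall>x\<in>X. {y, x} \<in> E" using e by (metis insert_commute)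
  have f': "f i x y \<in> cn E y x" if "i < t + 1" "x \<in> X" "y \<in> Y" for i x y using f[OF that] by (simp add: cn_commute)
  \<comment> \<open>There are at least three choices because \<open>t\<close> is at least 2; the
    third one is the reserve function of \<open>two_xgrid_cycles\<close>.\<close>
  have third: "\<exists>k<t + 1. k \<noteq> i \<and> k \<noteq> j" for i j
  proof -
    have "card {i, j} < card {..<t + 1}" using card_length[of "[i, j]"] t by simp
    then show ?thesis using fresh[of "{i, j}" "{..<t + 1}"] by auto
  qed
  define C where "C = {i. i < t + 1 \<and> cgrid X Y (f i)}"
  define P where "P = {i. i < t + 1 \<and> i \<notin> C \<and> xgrid X Y (f i)}"
  define H where "H = {i. i < t + 1 \<and> i \<notin> C \<and> ygrid X Y (f i)}"
  have fin: "finite C" "finite P" "finite H" by (auto simp: C_def P_def H_def)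
  show ?thesis
  proof (cases "\<exists>i<t + 1. igrid X Y (f i)")
    case True
    then show ?thesis using igrid_cycles[OF g fV r t e _ _ m] f by blast
  next
    case noi: False
    show ?thesis
    proof (cases "\<exists>i\<in>P. \<exists>j\<in>P. i \<noteq> j")
      case True
      then obtain i j where ij: "i \<in> P" "j \<in> P" "i \<noteq> j" by auto
      then have lt: "i < t + 1" "j < t + 1" by (auto simp: P_def)
      obtain p where p: "inj_on p X" "\<forall>x\<in>X. \<forall>y\<in>Y. f i x y = p x" using ij by (auto simp: P_def xgrid_def)
      obtain q where q: "inj_on q X" "\<forall>x\<in>X. \<forall>y\<in>Y. f j x y = q x" using ij by (auto simp: P_def xgrid_def)
      obtain k where k: "k < t + 1" "k \<noteq> i" "k \<noteq> j" using third by blast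
      show ?thesis
        by (rule two_xgrid_cycles[OF g fV r t e p(1) _ q(1), of "f k"])
          (use f[OF lt(1)] f[OF lt(2)] f[OF k(1)] d[OF lt ij(3)] d[OF k(1) lt(1) k(2)] d[OF k(1) lt(2) k(3)] p q m y0 in auto)
    next
      case P1: False
      show ?thesis
      proof (cases "\<exists>i\<in>H. \<exists>j\<in>H. i \<noteq> j")
        case True
        then obtain i j where ij: "i \<in> H" "j \<in> H" "i \<noteq> j" by auto
        then have lt: "i < t + 1" "j < t + 1" by (auto simp: H_def)
        obtain p where p: "inj_on p Y" "\<forall>x\<in>X. \<forall>y\<in>Y. f i x y = p y" using ij by (auto simp: H_def ygrid_def)
        obtain q where q: "inj_on q Y" "\<forall>x\<in>X. \<forall>y\<in>Y. f j x y = q y" using ij by (auto simp: H_def ygrid_def)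
        obtain k where k: "k < t + 1" "k \<noteq> i" "k \<noteq> j" using third by blast
        show ?thesis
          by (rule two_xgrid_cycles[OF g fV r t e' p(1) _ q(1), of "\<lambda>y x. f k x y"])
            (use f'[OF lt(1)] f'[OF lt(2)] f'[OF k(1)] d[OF lt ij(3)] d[OF k(1) lt(1) k(2)] d[OF k(1) lt(2) k(3)] p q m x0 in auto)
      next
        case H1: False
        have "card P \<le> 1" using P1 card_le_Suc0_iff_eq[OF fin(2)] by (simp add: Ball_def) 
        moreover have "card H \<le> 1" using H1 card_le_Suc0_iff_eq[OF fin(3)] by (simp add: Ball_def)
        moreover have "{..<t + 1} \<subseteq> C \<union> P \<union> H"
          using can noi by (auto simp: C_def P_def H_def canonical_def)
        then have "card {..<t + 1} \<le> card (C \<union> P \<union> H)" using fin by (intro card_mono) auto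
        then have "t + 1 \<le> card C + card P + card H"
          using card_Un_le[of "C \<union> P" H] card_Un_le[of C P] by simp
        ultimately have cC: "t + 1 \<le> card C + (if P = {} then 0 else 1) + (if H = {} then 0 else 1)"
          using fin by (auto split: if_splits)
        define c where "c i = f i x0 y0" for i
        have c: "f i x y = c i" if "i \<in> C" "x \<in> X" "y \<in> Y" for i x y
          using that x0 y0 unfolding C_def cgrid_def c_def by auto
        have injc: "inj_on c C" using d x0 y0 unfolding inj_on_def C_def c_def by blast
        have cW: "\<exists>W\<subseteq>c ` C. finite W \<and> card W = s" if sC: "s \<le> card C" for s
        proof -
          obtain W where "W \<subseteq> c ` C" "card W = s"
            using subset_of_card[of s "c ` C"] card_image[OF injc] sC by auto
          then show ?thesis using fin(1) finite_subset[of W "c ` C"] by blast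
        qed
        have W1: "\<forall>w\<in>W. \<forall>x\<in>X \<union> Y. {w, x} \<in> E" if Wc: "W \<subseteq> c ` C" for W
        proof (intro ballI)
          fix w x assume a: "w \<in> W" "x \<in> X \<union> Y"
          obtain i where i: "i \<in> C" "w = c i" using a(1) Wc by auto
          then have "i < t + 1" by (simp add: C_def)
          then show "{w, x} \<in> E"
            using f[of i x y0] f[of i x0 x] c[of i x y0] c[of i x0 x] a i x0 y0 by (auto simp: cn_iff insert_commute)
        qed
        \<comment> \<open>Constant choices never collide with the other choices, because the choices
          for one edge are pairwise distinct.\<close>
        have nP: "f i x y \<notin> W" if i: "i < t + 1" "i \<notin> C" and xy: "x \<in> X" "y \<in> Y" and Wc: "W \<subseteq> c ` C" for i x y W
        proof
          assume "f i x y \<in> W"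
          then obtain k where k: "k \<in> C" "f i x y = c k" using Wc by auto
          have "f i x y = f k x y" using c[OF k(1) xy] k(2) by simp
          moreover have "k < t + 1" "i \<noteq> k" using k i by (auto simp: C_def)
          ultimately show False using d[of i k x y] i xy by simp
        qed
        show ?thesis
        proof (cases "P = {}")
          case PE: True
          show ?thesis
          proof (cases "H = {}")
            case True
            then obtain W where W: "W \<subseteq> c ` C" "finite W" "card W = Suc t" using cW[of "Suc t"] cC PE by auto
            show ?thesis by (rule env_cycles[OF g fV t e W1[OF W(1)] W(2,3) m])
          next
            case False
            then obtain j where j: "j < t + 1" "j \<notin> C" "ygrid X Y (f j)" by (auto simp: H_def)
            obtain h where h: "inj_on h Y" "\<forall>x\<in>X. \<forall>y\<in>Y. f j x y = h y" using j by (auto simp: ygrid_def)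
            obtain W where W: "W \<subseteq> c ` C" "finite W" "card W = t" using cW[of t] cC PE False by auto
            show ?thesis
              by (rule xgrid_env_cycles[OF g fV t e' h(1) _ _ W(2,3)])
                (use W1[OF W(1)] nP[OF j(1,2) _ _ W(1)] f'[OF j(1)] h x0 m in auto)
          qed
        next
          case False
          then obtain i where i: "i < t + 1" "i \<notin> C" "xgrid X Y (f i)" by (auto simp: P_def)
          obtain p where p: "inj_on p X" "\<forall>x\<in>X. \<forall>y\<in>Y. f i x y = p x" using i by (auto simp: xgrid_def)
          show ?thesis
          proof (cases "H = {}")
            case True
            then obtain W where W: "W \<subseteq> c ` C" "finite W" "card W = t" using cW[of t] cC False by auto
            show ?thesis
              by (rule xgrid_env_cycles[OF g fV t e p(1) _ _ W(2,3)])
                (use W1[OF W(1)] nP[OF i(1,2) _ _ W(1)] f[OF i(1)] p y0 m in auto)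
          next
            case HN: False
            then obtain j where j: "j < t + 1" "j \<notin> C" "ygrid X Y (f j)" by (auto simp: H_def)
            obtain h where h: "inj_on h Y" "\<forall>x\<in>X. \<forall>y\<in>Y. f j x y = h y" using j by (auto simp: ygrid_def)
            have "t - 1 \<le> card C" using cC False HN by auto
            then obtain W where W: "W \<subseteq> c ` C" "finite W" "card W = t - 1" using cW by blast
            show ?thesis
              by (rule mixed_grid_cycles[OF g fV t e p(1) _ h(1) _ _ W(2,3)])
                (use W1[OF W(1)] nP[OF i(1,2) _ _ W(1)] nP[OF j(1,2) _ _ W(1)] f[OF i(1)] f[OF j(1)] p h x0 y0 m in auto)
          qed
        qed
      qed
    qed
  qed
qed

text \<open>On a huge grid with codegrees above \<open>t\<close>, Ramsey's theorem makes
  \<open>t + 1\<close> disjoint choices canonical on a subgrid simultaneously.\<close>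

lemma full_grid_cycles:
  assumes t: "2 \<le> t"
  shows "\<exists>M. \<forall>(V :: 'a set) E X Y. graph_on V E \<longrightarrow> finite V \<longrightarrow> rich E \<longrightarrow> finite X \<longrightarrow> finite Y \<longrightarrow>
    M \<le> card X \<longrightarrow> M \<le> card Y \<longrightarrow> (\<forall>x\<in>X. \<forall>y\<in>Y. {x, y} \<in> E \<and> t + 1 \<le> card (cn E x y)) \<longrightarrow>
    lcyc E (2 * t + 1) \<and> lcyc E (2 * t + 2)"
proof -
  obtain M where M: "\<forall>(X :: 'a set) (Y :: 'a set) (f :: nat \<Rightarrow> 'a \<Rightarrow> 'a \<Rightarrow> 'a). finite X \<longrightarrow> finite Y \<longrightarrow> M \<le> card X \<longrightarrow> M \<le> card Y \<longrightarrow>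
    (\<exists>X'\<subseteq>X. \<exists>Y'\<subseteq>Y. card X' = 50 * t + 100 \<and> card Y' = 50 * t + 100 \<and> (\<forall>i<t + 1. canonical X' Y' (f i)))"
    using canonical_ramsey_many[of "50 * t + 100" "t + 1"] by (elim exE) (rule that)
  show ?thesis
  proof (intro exI[of _ M] allI impI)
    fix V :: "'a set" and E X Y
    assume a: "graph_on V E" "finite V" "rich E" "finite X" "finite Y" "M \<le> card X" "M \<le> card Y"
      "\<forall>x\<in>X. \<forall>y\<in>Y. {x, y} \<in> E \<and> t + 1 \<le> card (cn E x y)"
    have cc: "\<forall>x\<in>X. \<forall>y\<in>Y. t + 1 \<le> card (cn E x y)" using a(8) by blast
    obtain f where f: "\<And>i x y. i < t + 1 \<Longrightarrow> x \<in> X \<Longrightarrow> y \<in> Y \<Longrightarrow> f i x y \<in> cn E x y"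
      "\<And>i j x y. i < t + 1 \<Longrightarrow> j < t + 1 \<Longrightarrow> i \<noteq> j \<Longrightarrow> x \<in> X \<Longrightarrow> y \<in> Y \<Longrightarrow> f i x y \<noteq> f j x y"
      by (rule common_neighbour_functions[OF a(1,2) cc]) (rule that)
    obtain X' Y' where XY: "X' \<subseteq> X" "Y' \<subseteq> Y" "card X' = 50 * t + 100" "card Y' = 50 * t + 100" "\<forall>i<t + 1. canonical X' Y' (f i)"
      using M[rule_format, OF a(4-7), of f] by blast
    show "lcyc E (2 * t + 1) \<and> lcyc E (2 * t + 2)"
    proof (rule canonical_functions_cycles[OF a(1-3) t, of X' Y' f])
      show "\<forall>x\<in>X'. \<forall>y\<in>Y'. {x, y} \<in> E" using a(8) XY(1,2) by blast
      show "f i x y \<in> cn E x y" if "i < t + 1" "x \<in> X'" "y \<in> Y'" for i x y using f(1) that XY(1,2) by blast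
      show "f i x y \<noteq> f j x y" if "i < t + 1" "j < t + 1" "i \<noteq> j" "x \<in> X'" "y \<in> Y'" for i j x y
        using f(2) that XY(1,2) by blast
    qed (use XY in auto)
  qed
qed

section \<open>Tight graphs and the centres of a grid\<close>

text \<open>Neither deletion of \<open>peel_tight\<close> applies: every edge lies in at least
  \<open>t\<close> triangles, and no triangle has two edges lying in exactly \<open>t\<close>
  triangles.\<close>

definition tight :: "nat \<Rightarrow> 'a set set \<Rightarrow> bool" where
  "tight t E \<longleftrightarrow> (\<forall>x y. {x, y} \<in> E \<longrightarrow> t \<le> card (cn E x y)) \<and>
     (\<forall>x y z. {x, y} \<in> E \<longrightarrow> {x, z} \<in> E \<longrightarrow> {y, z} \<in> E \<longrightarrow> t < card (cn E x z) \<or> t < card (cn E y z))"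

lemma tight_rich: "tight t E \<Longrightarrow> 2 \<le> t \<Longrightarrow> rich E"
  unfolding rich_def
proof (intro conjI allI impI)
  assume a: "tight t E" "2 \<le> t"
  fix x y z
  show "2 \<le> card (cn E x y)" if "{x, y} \<in> E" for x y using a that unfolding tight_def by fastforce
  assume e: "{x, y} \<in> E" "{x, z} \<in> E" "{y, z} \<in> E"
  then have "t \<le> card (cn E x z)" "t \<le> card (cn E y z)" "t < card (cn E x z) \<or> t < card (cn E y z)"
    using a(1) unfolding tight_def by blast+
  then show "5 \<le> card (cn E x z) + card (cn E y z)" using a(2) by linarith
qed

text \<open>By Ramsey's theorem the codegrees on a subgrid may be taken to be all above
  \<open>t\<close> or all equal to \<open>t\<close>; the first is excluded by
  \<open>full_grid_cycles\<close>. In the second case \<open>t\<close> choices exhaust the common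
  neighbours. A choice of the injective type gives both cycles directly, and one that depends
  injectively on a single side produces another grid with codegrees above \<open>t\<close>. So all
  choices are constant, and their values are the centres.\<close>

lemma constant_grid:
  assumes t: "2 \<le> t"
  shows "\<exists>M. \<forall>(V :: 'a set) E X Y. graph_on V E \<longrightarrow> finite V \<longrightarrow> tight t E \<longrightarrow>
    \<not> (lcyc E (2 * t + 1) \<and> lcyc E (2 * t + 2)) \<longrightarrow> finite X \<longrightarrow> finite Y \<longrightarrow>
    M \<le> card X \<longrightarrow> M \<le> card Y \<longrightarrow> (\<forall>x\<in>X. \<forall>y\<in>Y. {x, y} \<in> E) \<longrightarrow>
    (\<exists>X'\<subseteq>X. \<exists>Y'\<subseteq>Y. \<exists>W. card X' = m \<and> card Y' = m \<and> finite W \<and> card W = t \<and> (\<forall>w\<in>W. \<forall>x\<in>X' \<union> Y'. {w, x} \<in> E))"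
proof -
  obtain MT where MT: "\<forall>(V :: 'a set) E X Y. graph_on V E \<longrightarrow> finite V \<longrightarrow> rich E \<longrightarrow> finite X \<longrightarrow> finite Y \<longrightarrow>
    MT \<le> card X \<longrightarrow> MT \<le> card Y \<longrightarrow> (\<forall>x\<in>X. \<forall>y\<in>Y. {x, y} \<in> E \<and> t + 1 \<le> card (cn E x y)) \<longrightarrow>
    lcyc E (2 * t + 1) \<and> lcyc E (2 * t + 2)" using full_grid_cycles[OF t] by (elim exE) (rule that)
  define m' where "m' = m + MT + 50 * t + 100"
  obtain M1 where M1: "\<forall>(X :: 'a set) (Y :: 'a set) (f :: nat \<Rightarrow> 'a \<Rightarrow> 'a \<Rightarrow> 'a). finite X \<longrightarrow> finite Y \<longrightarrow> M1 \<le> card X \<longrightarrow> M1 \<le> card Y \<longrightarrow>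
    (\<exists>X'\<subseteq>X. \<exists>Y'\<subseteq>Y. card X' = m' \<and> card Y' = m' \<and> (\<forall>i<t. canonical X' Y' (f i)))"
    using canonical_ramsey_many[of m' t] by (elim exE) (rule that)
  obtain M2 where M2: "\<forall>(X :: 'a set) (Y :: 'a set) P. finite X \<longrightarrow> finite Y \<longrightarrow> M2 \<le> card X \<longrightarrow> M2 \<le> card Y \<longrightarrow>
    (\<exists>X'\<subseteq>X. \<exists>Y'\<subseteq>Y. card X' = M1 + MT \<and> card Y' = M1 + MT \<and> ((\<forall>x\<in>X'. \<forall>y\<in>Y'. P x y) \<or> (\<forall>x\<in>X'. \<forall>y\<in>Y'. \<not> P x y)))"
    using two_colour_ramsey[of "M1 + MT"] by (elim exE) (rule that)
  show ?thesis
  proof (intro exI[of _ M2] allI impI)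
    fix V :: "'a set" and E X Y
    assume a: "graph_on V E" "finite V" "tight t E" and nl: "\<not> (lcyc E (2 * t + 1) \<and> lcyc E (2 * t + 2))"
      and b: "finite X" "finite Y" "M2 \<le> card X" "M2 \<le> card Y" and e: "\<forall>x\<in>X. \<forall>y\<in>Y. {x, y} \<in> E"
    note r = tight_rich[OF a(3) t]
    have full: False if "finite X'" "finite Y'" "MT \<le> card X'" "MT \<le> card Y'"
      "\<forall>x\<in>X'. \<forall>y\<in>Y'. {x, y} \<in> E \<and> t + 1 \<le> card (cn E x y)" for X' Y'
      using MT[rule_format, OF a(1,2) r that(1-4)] that(5) nl by blast
    obtain X1 Y1 where 1: "X1 \<subseteq> X" "Y1 \<subseteq> Y" "card X1 = M1 + MT" "card Y1 = M1 + MT"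
      "(\<forall>x\<in>X1. \<forall>y\<in>Y1. t + 1 \<le> card (cn E x y)) \<or> (\<forall>x\<in>X1. \<forall>y\<in>Y1. \<not> t + 1 \<le> card (cn E x y))"
      using M2[rule_format, OF b, of "\<lambda>x y. t + 1 \<le> card (cn E x y)"] by blast
    have f1: "finite X1" "finite Y1" using 1 b finite_subset by blast+
    have e1: "{x, y} \<in> E" if "x \<in> X1" "y \<in> Y1" for x y using that 1 e by blast
    have "\<not> (\<forall>x\<in>X1. \<forall>y\<in>Y1. t + 1 \<le> card (cn E x y))" using full[of X1 Y1] f1 1(3,4) e1 by auto
    then have "\<forall>x\<in>X1. \<forall>y\<in>Y1. \<not> t + 1 \<le> card (cn E x y)" using 1(5) by blast
    then have low: "\<not> t < card (cn E x y)" if "x \<in> X1" "y \<in> Y1" for x y using that by fastforce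
    have high: "\<forall>x\<in>X1. \<forall>y\<in>Y1. t \<le> card (cn E x y)" using a(3) e1 by (auto simp: tight_def)
    obtain f where f: "\<And>i x y. i < t \<Longrightarrow> x \<in> X1 \<Longrightarrow> y \<in> Y1 \<Longrightarrow> f i x y \<in> cn E x y"
      "\<And>i j x y. i < t \<Longrightarrow> j < t \<Longrightarrow> i \<noteq> j \<Longrightarrow> x \<in> X1 \<Longrightarrow> y \<in> Y1 \<Longrightarrow> f i x y \<noteq> f j x y"
      by (rule common_neighbour_functions[OF a(1,2) high]) (rule that)
    have "M1 \<le> card X1" "M1 \<le> card Y1" using 1 by auto
    then obtain X2 Y2 where 2: "X2 \<subseteq> X1" "Y2 \<subseteq> Y1" "card X2 = m'" "card Y2 = m'" "\<forall>i<t. canonical X2 Y2 (f i)"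
      using M1[rule_format, OF f1, of f] by blast
    have f2: "finite X2" "finite Y2" using 2 f1 finite_subset by blast+
    have big: "50 * t + 100 \<le> card X2" "50 * t + 100 \<le> card Y2" using 2 by (auto simp: m'_def)
    have fe: "f i x y \<in> cn E x y" "{x, f i x y} \<in> E" "{y, f i x y} \<in> E" "{x, y} \<in> E" "\<not> t < card (cn E x y)"
      if "i < t" "x \<in> X2" "y \<in> Y2" for i x y
      using that 2(1,2) f(1)[of i x y] e1[of x y] low[of x y] by (auto simp: cn_iff)
    have "cgrid X2 Y2 (f i)" if i: "i < t" for i
    proof -
      have "\<not> igrid X2 Y2 (f i)"
        using igrid_cycles[OF a(1,2) r t _ _ _ big, of "f i"] fe[OF i] nl by blast
      moreover have "\<not> xgrid X2 Y2 (f i)"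
      proof
        assume "xgrid X2 Y2 (f i)"
        then obtain p where p: "inj_on p X2" "\<And>x y. x \<in> X2 \<Longrightarrow> y \<in> Y2 \<Longrightarrow> f i x y = p x" by (auto simp: xgrid_def)
        \<comment> \<open>The edge \<open>xy\<close> has codegree exactly \<open>t\<close>, so
          tightness pushes the codegree of every other edge of the triangle \<open>x\<close>,
          \<open>y\<close>, \<open>p x\<close> above \<open>t\<close>. Hence the image of
          \<open>X2\<close> under \<open>p\<close> and \<open>Y2\<close> form a forbidden
          grid.\<close>
        have "{p x, y} \<in> E \<and> t < card (cn E (p x) y)" if "x \<in> X2" "y \<in> Y2" for x y
        proof -
          have "{x, p x} \<in> E" "{x, y} \<in> E" "{p x, y} \<in> E"
            using fe[OF i that] p(2)[OF that] by (auto simp: insert_commute)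
          moreover from this have "t < card (cn E x y) \<or> t < card (cn E (p x) y)"
            using a(3) unfolding tight_def by blast
          ultimately show ?thesis using fe(5)[OF i that] by blast
        qed
        then show False using full[of "p ` X2" Y2] f2 card_image[OF p(1)] 2(3,4) by (auto simp: m'_def Suc_le_eq)
      qed
      moreover have "\<not> ygrid X2 Y2 (f i)"
      proof
        assume "ygrid X2 Y2 (f i)"
        then obtain h where h: "inj_on h Y2" "\<And>x y. x \<in> X2 \<Longrightarrow> y \<in> Y2 \<Longrightarrow> f i x y = h y" by (auto simp: ygrid_def)
        have "{x, h y} \<in> E \<and> t < card (cn E x (h y))" if "x \<in> X2" "y \<in> Y2" for x y
        proof -
          have "{y, h y} \<in> E" "{y, x} \<in> E" "{h y, x} \<in> E"
            using fe[OF i that] h(2)[OF that] by (auto simp: insert_commute)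
          moreover from this have "t < card (cn E y x) \<or> t < card (cn E (h y) x)"
            using a(3) unfolding tight_def by blast
          ultimately show ?thesis using fe(5)[OF i that] by (simp add: cn_commute insert_commute)
        qed
        then show False using full[of X2 "h ` Y2"] f2 card_image[OF h(1)] 2(3,4) by (auto simp: m'_def Suc_le_eq)
      qed
      ultimately show ?thesis using 2(5) i unfolding canonical_def by blast
    qed
    then have "\<forall>i. \<exists>c. i < t \<longrightarrow> (\<forall>x\<in>X2. \<forall>y\<in>Y2. f i x y = c)" unfolding cgrid_def by blast
    then obtain c where c: "\<And>i x y. i < t \<Longrightarrow> x \<in> X2 \<Longrightarrow> y \<in> Y2 \<Longrightarrow> f i x y = c i" by metis
    obtain x0 where x0: "x0 \<in> X2" using big(1) by fastforce
    obtain y0 where y0: "y0 \<in> Y2" using big(2) by fastforce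
    define W where "W = c ` {..<t}"
    have "inj_on c {..<t}"
    proof (rule inj_onI)
      fix i j assume "i \<in> {..<t}" "j \<in> {..<t}" "c i = c j"
      then have "f i x0 y0 = f j x0 y0" using c x0 y0 by simp
      then show "i = j" using f(2)[of i j x0 y0] \<open>i \<in> {..<t}\<close> \<open>j \<in> {..<t}\<close> x0 y0 2 by auto
    qed
    then have W: "finite W" "card W = t" by (auto simp: W_def card_image)
    have We: "{w, x} \<in> E" if wx: "w \<in> W" "x \<in> X2 \<union> Y2" for w x
    proof -
      obtain i where i: "i < t" "w = c i" using wx by (auto simp: W_def)
      show ?thesis using wx(2) fe(2)[OF i(1) _ y0, of x] fe(3)[OF i(1) x0, of x] c[OF i(1) _ y0, of x] c[OF i(1) x0, of x] i
        by (auto simp: insert_commute)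
    qed
    obtain X' where X': "X' \<subseteq> X2" "card X' = m" using subset_of_card[of m X2] 2(3) by (auto simp: m'_def)
    obtain Y' where Y': "Y' \<subseteq> Y2" "card Y' = m" using subset_of_card[of m Y2] 2(4) by (auto simp: m'_def)
    have sub: "X' \<subseteq> X" "Y' \<subseteq> Y" using X'(1) Y'(1) 1(1,2) 2(1,2) by (meson subset_trans)+
    have "\<forall>w\<in>W. \<forall>x\<in>X' \<union> Y'. {w, x} \<in> E" using We X'(1) Y'(1) by blast
    then have "\<exists>W. card X' = m \<and> card Y' = m \<and> finite W \<and> card W = t \<and> (\<forall>w\<in>W. \<forall>x\<in>X' \<union> Y'. {w, x} \<in> E)"
      using X'(2) Y'(2) W by blast
    then show "\<exists>X'\<subseteq>X. \<exists>Y'\<subseteq>Y. \<exists>W. card X' = m \<and> card Y' = m \<and> finite W \<and> card W = t \<and> (\<forall>w\<in>W. \<forall>x\<in>X' \<union> Y'. {w, x} \<in> E)"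
      using sub by blast
  qed
qed

text \<open>Grids with a common side have the same centres: otherwise \<open>W\<close> and
  \<open>W'\<close> together offer at least \<open>t + 1\<close> centres over \<open>X\<close>. The
  centres in \<open>W\<close> need not be joined to \<open>Y'\<close>, nor those in
  \<open>W'\<close> to \<open>Y\<close>, so the environment is taken over \<open>X\<close> only, and
  the starting paths use two centres \<open>w\<close>, \<open>w1\<close> of the same set
  \<open>W\<close>.\<close>

lemma shared_side_cycles:
  assumes g: "graph_on V E" and fV: "finite V" and t: "2 \<le> t"
    and W: "finite W" "card W = t" "finite W'" "card W' = t" "W \<noteq> W'"
    and XY: "\<forall>x\<in>X. \<forall>y\<in>Y. {x, y} \<in> E" "\<forall>x\<in>X. \<forall>y\<in>Y'. {x, y} \<in> E"
    and WX: "\<forall>w\<in>W. \<forall>x\<in>X \<union> Y. {w, x} \<in> E" "\<forall>w\<in>W'. \<forall>x\<in>X \<union> Y'. {w, x} \<in> E"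
    and m: "50 * t + 100 \<le> card X" "50 * t + 100 \<le> card Y" "50 * t + 100 \<le> card Y'"
  shows "lcyc E (2 * t + 1) \<and> lcyc E (2 * t + 2)"
proof -
  define S where "S = W \<union> W'"
  have fS: "finite S" using W by (simp add: S_def)
  have "W \<subset> S" using W card_subset_eq[of W W'] unfolding S_def by (metis Un_upper1 Un_upper2 psubsetI)
  then have cS: "t + 1 \<le> card S" using psubset_card_mono[OF fS, of W] W by simp
  have env: "env E X S (50 * t + 100)" unfolding env_def
  proof (intro conjI ballI)
    fix w x assume a: "w \<in> S" "x \<in> X"
    show "{w, x} \<in> E" using a WX by (auto simp: S_def)
    have "Y \<subseteq> cn E w x \<or> Y' \<subseteq> cn E w x" using a WX XY by (auto simp: S_def cn_iff)
    then show "50 * t + 100 \<le> card (cn E w x)"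
      using card_mono[OF finite_cn[OF g fV, of w x]] m by (meson order_trans)
  qed (rule m(1))
  have XS: "x \<notin> S" if "x \<in> X" for x using env that graph_on_loop[OF g, of x] by (force simp: env_def)
  have YW: "y \<notin> W" if "y \<in> Y" for y using WX that graph_on_loop[OF g, of y] by force
  obtain x where x: "x \<in> X" using m(1) by fastforce
  have "card {x} < card X" using m(1) by simp
  then obtain x2 where x2: "x2 \<in> X" "x2 \<notin> {x}" using fresh[of "{x}" X] by auto
  have "card {x, x2} < card X" using m(1) card_length[of "[x, x2]"] by simp
  then obtain x3 where x3: "x3 \<in> X" "x3 \<notin> {x, x2}" using fresh[of "{x, x2}" X] by auto
  have "card W' < card Y" using m(2) W by simp
  then obtain y where y: "y \<in> Y" "y \<notin> W'" using fresh[of W' Y] W by auto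
  have "card (insert y W') < card Y" using m(2) W card_insert_bound[of W' y] by simp
  then obtain y3 where y3: "y3 \<in> Y" "y3 \<notin> insert y W'" using fresh[of "insert y W'" Y] W by auto
  have "\<not> card W \<le> Suc 0" using t W(2) by simp
  then obtain w w1 where w: "w \<in> W" "w1 \<in> W" "w \<noteq> w1"
    using card_le_Suc0_iff_eq[OF W(1)] by blast
  have wE: "{w, v} \<in> E" "{w1, v} \<in> E" if "v \<in> {x, x2, x3, y, y3}" for v
    using WX(1) w that x x2 x3 y y3 by blast+
  have xE: "{u, v} \<in> E" "{v, u} \<in> E" if "u \<in> {x, x2, x3}" "v \<in> {y, y3}" for u v
    using XY(1) that x x2 x3 y y3 by (auto simp: insert_commute)
  have "t - 1 \<le> card (S - {w, w1})" using cS w card_Diff_subset[of "{w, w1}" S] by (auto simp: S_def)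
  then obtain W1 where W1: "W1 \<subseteq> S - {w, w1}" "card W1 = t - 1" using subset_of_card[of "t - 1" "S - {w, w1}"] by auto
  have "t \<le> card (S - {w})" using cS w by (auto simp: S_def)
  then obtain W2 where W2: "W2 \<subseteq> S - {w}" "card W2 = t" using subset_of_card[of t "S - {w}"] by auto
  have fW: "finite W1" "finite W2" using W1 W2 fS finite_subset by blast+
  have ne: "W1 \<noteq> {}" "W2 \<noteq> {}" using W1 W2 t by auto
  have ys: "y \<notin> S" "y3 \<notin> S" using YW y y3 by (auto simp: S_def)
  have ne': "u \<noteq> v" if "u \<in> {x, x2, x3}" "v \<in> {y, y3}" for u v using xE(1)[OF that] graph_on_neq[OF g] by blast
  have nxy: "x \<noteq> y" "x2 \<noteq> y" "x3 \<noteq> y" "x \<noteq> y3" "x2 \<noteq> y3" "x3 \<noteq> y3" by (rule ne'; simp)+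
  have "w \<in> S" "w1 \<in> S" "x \<notin> S" "x2 \<notin> S" "x3 \<notin> S" using w XS x x2 x3 by (simp_all add: S_def)
  then have dst: "distinct [x, x2, x3, w, w1]" "distinct [y, y3, w, w1]" "x \<noteq> y" "x2 \<noteq> y" "x3 \<noteq> y" "x \<noteq> y3" "x2 \<noteq> y3" "x3 \<noteq> y3"
    using ys w(3) x2(2) x3(2) y3(2) nxy by auto
  \<comment> \<open>The core is \<open>x\<close>, \<open>y\<close>, \<open>w1\<close>,
    \<open>x3\<close> with apexes \<open>w\<close>, \<open>x2\<close>, \<open>y3\<close>. Both
    \<open>w\<close> and \<open>w1\<close> are spent, and \<open>t - 1\<close> centres remain for
    closing.\<close>
  have L3: "lpath E x x3 3 {x, y, w, w1, x2, x3, y3}"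
    using xE(1)[of x y] xE(1)[of x2 y] xE(1)[of x2 y3] xE(1)[of x3 y3] wE(1)[of x] wE(1)[of y] wE(2)[of y] wE(2)[of x2] wE(2)[of x3] wE(2)[of y3] dst
    by (intro lpath3[OF g]) (auto simp: insert_commute)
  have L2: "lpath E x x3 2 {x, w, y, x3, y3}"
    using xE(1)[of x y] xE(1)[of x3 y3] wE(1)[of x] wE(1)[of y] wE(1)[of x3] wE(1)[of y3] dst
    by (intro lpath2[OF g]) (auto simp: insert_commute)
  have "lcyc E (2 * t + 1)"
    by (rule env_close[OF g env_subset[OF env] fW(1) ne(1) _ _ _ L3])
      (use x x2 x3 XS ys W1 t in auto)
  moreover have "lcyc E (2 * t + 2)"
    by (rule env_close[OF g env_subset[OF env] fW(2) ne(2) _ _ _ L2])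
      (use x x3 XS ys W2 t in auto)
  ultimately show ?thesis by simp
qed

subsection \<open>Counting triangles\<close>

definition tdeg :: "'a set \<Rightarrow> 'a set set \<Rightarrow> 'a \<Rightarrow> nat" where
  "tdeg V E v = card {T \<in> triangles V E. v \<in> T}"

text \<open>Edges with an orientation, so that a sum over edges splits into sums over first and over
  second ends.\<close>

definition arcs :: "'a set set \<Rightarrow> ('a \<times> 'a) set" where
  "arcs E = {(x, y). {x, y} \<in> E}"

lemma finite_triangles: "finite V \<Longrightarrow> finite (triangles V E)"
  by (rule finite_subset[of _ "Pow V"]) (auto simp: triangles_def)

lemma triangleI:
  assumes "graph_on V E" "{x, y} \<in> E" "{x, z} \<in> E" "{y, z} \<in> E"
  shows "{x, y, z} \<in> triangles V E"
proof -
  have "x \<noteq> y" "x \<noteq> z" "y \<noteq> z" "x \<in> V" "y \<in> V" "z \<in> V"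
    using assms graph_on_neq[OF assms(1)] graph_on_in[OF assms(1)] by blast+
  then show ?thesis using assms by (auto simp: triangles_def insert_commute)
qed

lemma triangleD: "T \<in> triangles V E \<Longrightarrow> x \<in> T \<Longrightarrow> y \<in> T \<Longrightarrow> x \<noteq> y \<Longrightarrow> {x, y} \<in> E"
  by (auto simp: triangles_def)

lemma triangle_card: "T \<in> triangles V E \<Longrightarrow> card T = 3 \<and> finite T"
  by (auto simp: triangles_def intro: card_ge_0_finite)

lemma triangles_on_edge:
  assumes g: "graph_on V E" and e: "{x, y} \<in> E"
  shows "card {T \<in> triangles V E. {x, y} \<subseteq> T} = card (cn E x y)"
proof -
  have ne: "x \<noteq> y" using graph_on_neq[OF g e] .
  have "bij_betw (\<lambda>z. {x, y, z}) (cn E x y) {T \<in> triangles V E. {x, y} \<subseteq> T}"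
  proof (rule bij_betw_imageI)
    show "inj_on (\<lambda>z. {x, y, z}) (cn E x y)"
    proof (rule inj_onI)
      fix z z' assume a: "z \<in> cn E x y" "z' \<in> cn E x y" "{x, y, z} = {x, y, z'}"
      then have "z \<noteq> x" "z \<noteq> y" using graph_on_loop[OF g] by (auto simp: cn_iff)
      then show "z = z'" using a(3) by auto
    qed
    show "(\<lambda>z. {x, y, z}) ` cn E x y = {T \<in> triangles V E. {x, y} \<subseteq> T}"
    proof (intro equalityI subsetI)
      fix T assume "T \<in> (\<lambda>z. {x, y, z}) ` cn E x y"
      then show "T \<in> {T \<in> triangles V E. {x, y} \<subseteq> T}" using triangleI[OF g e] by (auto simp: cn_iff)
    next
      fix T assume T: "T \<in> {T \<in> triangles V E. {x, y} \<subseteq> T}"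
      then have "card (T - {x, y}) = 1" using triangle_card[of T V E] ne by (simp add: card_Diff_subset)
      then obtain z where z: "T - {x, y} = {z}" by (rule card_1_singletonE)
      then have "T = {x, y, z}" "z \<noteq> x" "z \<noteq> y" using T by auto
      moreover from this have "z \<in> cn E x y" using T by (auto simp: cn_iff triangles_def)
      ultimately show "T \<in> (\<lambda>z. {x, y, z}) ` cn E x y" by auto
    qed
  qed
  then show ?thesis by (simp add: bij_betw_same_card)
qed

section \<open>Peeling off edges in few triangles\<close>

lemma triangles_remove_edge:
  assumes g: "graph_on V E" and fV: "finite V" and e: "{x, y} \<in> E"
  shows "card (triangles V E) = card (triangles V (E - {{x, y}})) + card (cn E x y)"
proof -
  have ne: "x \<noteq> y" using graph_on_neq[OF g e] .
  have "triangles V (E - {{x, y}}) = triangles V E - {T \<in> triangles V E. {x, y} \<subseteq> T}"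
    using ne by (auto simp: triangles_def doubleton_eq_iff)
  then have "card (triangles V (E - {{x, y}})) = card (triangles V E) - card {T \<in> triangles V E. {x, y} \<subseteq> T}"
    using finite_triangles[OF fV] by (subst \<open>triangles V (E - {{x, y}}) = _\<close>, intro card_Diff_subset) auto
  moreover have "card {T \<in> triangles V E. {x, y} \<subseteq> T} \<le> card (triangles V E)"
    using finite_triangles[OF fV] by (intro card_mono) auto
  ultimately show ?thesis using triangles_on_edge[OF g e] by simp
qed

text \<open>Deleting an edge that lies in at most \<open>d\<close> triangles does not decrease the
  number of triangles minus \<open>d\<close> times the number of edges.\<close>

lemma peel:
  assumes "graph_on V E" "finite V"
  shows "\<exists>E'\<subseteq>E. (\<forall>x y. {x, y} \<in> E' \<longrightarrow> d < card (cn E' x y)) \<and>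
    card (triangles V E) + d * card E' \<le> card (triangles V E') + d * card E"
  using assms
proof (induction "card E" arbitrary: E rule: less_induct)
  case less
  show ?case
  proof (cases "\<forall>x y. {x, y} \<in> E \<longrightarrow> d < card (cn E x y)")
    case True
    then show ?thesis by blast
  next
    case False
    then obtain x y where xy: "{x, y} \<in> E" "card (cn E x y) \<le> d" by auto
    define E1 where "E1 = E - {{x, y}}"
    have fE: "finite E" using graph_on_finite less.prems by blast
    have c: "card E = Suc (card E1)" using xy fE unfolding E1_def by (metis card_Suc_Diff1)
    have "graph_on V E1" using graph_on_subset[OF less.prems(1)] by (auto simp: E1_def)
    then obtain E' where E': "E' \<subseteq> E1" "\<forall>x y. {x, y} \<in> E' \<longrightarrow> d < card (cn E' x y)"
      "card (triangles V E1) + d * card E' \<le> card (triangles V E') + d * card E1"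
      using less.hyps[of E1] c less.prems(2) by auto
    have "card (triangles V E) \<le> card (triangles V E1) + d"
      using triangles_remove_edge[OF less.prems xy(1)] xy(2) by (simp add: E1_def)
    then show ?thesis using E' c by (intro exI[of _ E']) (auto simp: E1_def)
  qed
qed

text \<open>Deleting an edge in fewer than \<open>t\<close> triangles, or two edges in exactly \<open>t\<close> triangles one of which
  they share, costs at most \<open>t - 1 / 2\<close> triangles per edge.\<close>
lemma peel_tight:
  assumes "graph_on V E" "finite V" "1 \<le> t"
  shows "\<exists>E'\<subseteq>E. tight t E' \<and>
    2 * card (triangles V E) + (2 * t - 1) * card E' \<le> 2 * card (triangles V E') + (2 * t - 1) * card E"
  using assms
proof (induction "card E" arbitrary: E rule: less_induct)
  case less
  have fE: "finite E" using graph_on_finite less.prems by blast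
  show ?case
  proof (cases "tight t E")
    case True
    then show ?thesis by blast
  next
    case False
    have "\<exists>E1\<subset>E. 2 * card (triangles V E) + (2 * t - 1) * card E1 \<le> 2 * card (triangles V E1) + (2 * t - 1) * card E"
    proof (cases "\<forall>x y. {x, y} \<in> E \<longrightarrow> t \<le> card (cn E x y)")
      case True
      then obtain x y z where xyz: "{x, y} \<in> E" "{x, z} \<in> E" "{y, z} \<in> E" "card (cn E x z) \<le> t" "card (cn E y z) \<le> t"
        using False unfolding tight_def by (meson not_less)
      have ne: "{x, z} \<noteq> {y, z}" using graph_on_neq[OF less.prems(1) xyz(1)] by (auto simp: doubleton_eq_iff)
      define E1 where "E1 = E - {{x, z}}"
      define E2 where "E2 = E1 - {{y, z}}"
      have g1: "graph_on V E1" using graph_on_subset[OF less.prems(1)] by (auto simp: E1_def)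
      have yz: "{y, z} \<in> E1" using xyz ne by (auto simp: E1_def)
      have 1: "card (triangles V E) \<le> card (triangles V E1) + t"
        using triangles_remove_edge[OF less.prems(1,2) xyz(2)] xyz(4) by (simp add: E1_def)
      \<comment> \<open>Deleting \<open>xz\<close> has already destroyed the triangle
        \<open>xyz\<close>, so the second deletion costs at most \<open>t - 1\<close>, and the two
        together at most \<open>2 * t - 1\<close>.\<close>
      have "cn E1 y z \<subseteq> cn E y z - {x}" by (auto simp: cn_iff E1_def insert_commute)
      then have "card (cn E1 y z) \<le> card (cn E y z - {x})"
        using finite_cn[OF less.prems(1,2)] by (intro card_mono) auto
      moreover have "x \<in> cn E y z" using xyz by (auto simp: cn_iff insert_commute)
      ultimately have "card (cn E1 y z) \<le> t - 1" using xyz(5) by simp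
      then have 2: "card (triangles V E1) \<le> card (triangles V E2) + (t - 1)"
        using triangles_remove_edge[OF g1 less.prems(2) yz] by (simp add: E2_def)
      have c: "card E = card E2 + 2"
        using xyz yz fE card_Suc_Diff1[of E "{x, z}"] card_Suc_Diff1[of E1 "{y, z}"] by (simp add: E1_def E2_def)
      have "2 * card (triangles V E) \<le> 2 * card (triangles V E2) + 2 * (2 * t - 1)"
        using 1 2 less.prems(3) by linarith
      then show ?thesis using c xyz by (intro exI[of _ E2]) (auto simp: E1_def E2_def algebra_simps)
    next
      case False
      then obtain x y where xy: "{x, y} \<in> E" "card (cn E x y) < t" by (auto simp: not_le)
      define E1 where "E1 = E - {{x, y}}"
      have c: "card E = Suc (card E1)" using xy fE unfolding E1_def by (metis card_Suc_Diff1)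
      have "2 * card (triangles V E) \<le> 2 * card (triangles V E1) + (2 * t - 1)"
        using triangles_remove_edge[OF less.prems(1,2) xy(1)] xy(2) by (simp add: E1_def)
      moreover have "E1 \<subset> E" using xy by (auto simp: E1_def)
      ultimately show ?thesis using c by (intro exI[of _ E1]) simp
    qed
    then obtain E1 where E1: "E1 \<subset> E"
      "2 * card (triangles V E) + (2 * t - 1) * card E1 \<le> 2 * card (triangles V E1) + (2 * t - 1) * card E" by blast
    have "graph_on V E1" using graph_on_subset[OF less.prems(1)] E1 by blast
    then obtain E' where E': "E' \<subseteq> E1" "tight t E'"
      "2 * card (triangles V E1) + (2 * t - 1) * card E' \<le> 2 * card (triangles V E') + (2 * t - 1) * card E1"
      using less.hyps[of E1] psubset_card_mono[OF fE E1(1)] less.prems by blast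
    then show ?thesis using E1 by (intro exI[of _ E'] conjI) (blast, blast, linarith)
  qed
qed

text \<open>A greedy path is easy to grow; the difficulty is to close it. Therefore every core
  vertex is chosen in the neighbourhood of a fixed vertex \<open>v\<close>, which is inserted as the
  last core vertex and is joined to both ends.\<close>

lemma high_codegree_lcyc:
  assumes g: "graph_on V E" and fV: "finite V" and d: "\<forall>x y. {x, y} \<in> E \<longrightarrow> 2 * k + 5 < card (cn E x y)"
    and k: "3 \<le> k" and ne: "E \<noteq> {}"
  shows "lcyc E k"
proof -
  obtain v y where vy: "{v, y} \<in> E" using ne graph_on_edge[OF g] by blast
  have "\<exists>c U. lpath E c y l U \<and> {v, c} \<in> E \<and> v \<notin> U" if "l \<le> k" for l
    using that
  proof (induction l)
    case 0
    then show ?case using vy graph_on_neq[OF g vy] by (intro exI[of _ y] exI[of _ "{y}"]) (auto intro: lpath.base)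
  next
    case (Suc l)
    then obtain c U where c: "lpath E c y l U" "{v, c} \<in> E" "v \<notin> U" by auto
    have U: "finite U" "card U = 2 * l + 1" using lpath_card[OF c(1)] by auto
    have "card U < card (cn E v c)" using U d c(2) Suc.prems by fastforce
    then obtain c' where c': "c' \<in> cn E v c" "c' \<notin> U" using fresh[OF U(1)] by blast
    have e: "{c', c} \<in> E" "{v, c'} \<in> E" using c' by (auto simp: cn_iff insert_commute)
    have "card (insert v U) < card (cn E c' c)" using U d[rule_format, OF e(1)] Suc.prems card_insert_bound[OF U(1), of v] by linarith
    then obtain a where a: "a \<in> cn E c' c" "a \<notin> insert v U" using fresh[of "insert v U"] U(1) by blast
    have "c' \<noteq> a" "v \<noteq> c'" using a(1) e graph_on_neq[OF g] by (auto simp: cn_iff)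
    then have "lpath E c' y (Suc l) (insert c' (insert a U))"
      using a c' e by (intro lpath.step[OF c(1)]) (auto simp: cn_iff)
    then show ?case using e(2) a c(3) \<open>v \<noteq> c'\<close> by (intro exI[of _ c'] exI[of _ "insert c' (insert a U)"] conjI) auto
  qed
  then obtain c U where c: "lpath E c y (k - 2) U" "{v, c} \<in> E" "v \<notin> U" by (meson diff_le_self)
  have U: "finite U" "card U = 2 * (k - 2) + 1" using lpath_card[OF c(1)] by auto
  have "card U < card (cn E v c)" using U d[rule_format, OF c(2)] by linarith
  then obtain a where a: "a \<in> cn E v c" "a \<notin> U" using fresh[OF U(1)] by blast
  have va: "v \<noteq> a" using a graph_on_neq[OF g] by (auto simp: cn_iff)
  have p: "lpath E v y (Suc (k - 2)) (insert v (insert a U))"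
    using a c va by (intro lpath.step[OF c(1)]) (auto simp: cn_iff)
  define U' where "U' = insert v (insert a U)"
  have U': "finite U'" "card U' \<le> 2 * k" using lpath_card[OF p] k by (auto simp: U'_def)
  have "card U' < card (cn E v y)" using U' d[rule_format, OF vy] by linarith
  then obtain b where b: "b \<in> cn E v y" "b \<notin> U'" using fresh[OF U'(1)] by blast
  have "Suc (k - 2) = k - 1" using k by linarith
  then have "lpath E v y (k - 1) U'" using p by (simp add: U'_def)
  then show ?thesis unfolding lcyc_def using b vy by (auto simp: cn_iff)
qed

text \<open>The absence of either cycle implies it, so both halves of the theorem share everything
  that is derived from it.\<close>

definition free :: "nat \<Rightarrow> 'a set set \<Rightarrow> bool" where
  "free t E \<longleftrightarrow> \<not> (lcyc E (2 * t + 1) \<and> lcyc E (2 * t + 2))"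

lemma free_subset: "free t E \<Longrightarrow> E' \<subseteq> E \<Longrightarrow> free t E'"
  using lcyc_mono unfolding free_def by blast

text \<open>The constant is \<open>2 * k + 5\<close> for the longer cycle,
  \<open>k = 2 * t + 2\<close>. Peeling at this codegree leaves no edge at all.\<close>

lemma triangles_linear:
  assumes g: "graph_on V E" and fV: "finite V" and fr: "free t E" and t: "1 \<le> t"
  shows "card (triangles V E) \<le> (4 * t + 9) * card E"
proof -
  obtain E' where E': "E' \<subseteq> E" "\<forall>x y. {x, y} \<in> E' \<longrightarrow> 4 * t + 9 < card (cn E' x y)"
    "card (triangles V E) + (4 * t + 9) * card E' \<le> card (triangles V E') + (4 * t + 9) * card E"
    using peel[OF g fV, of "4 * t + 9"] by blast
  have g': "graph_on V E'" using graph_on_subset[OF g E'(1)] .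
  have "E' = {}"
  proof (rule ccontr)
    assume ne: "E' \<noteq> {}"
    have "lcyc E' (2 * t + 1)" by (rule high_codegree_lcyc[OF g' fV _ _ ne]) (use E'(2) t in force)+
    moreover have "lcyc E' (2 * t + 2)" by (rule high_codegree_lcyc[OF g' fV _ _ ne]) (use E'(2) t in force)+
    ultimately show False using free_subset[OF fr E'(1)] by (simp add: free_def)
  qed
  moreover have "triangles V {} = {}"
  proof (rule ccontr)
    assume "triangles V {} \<noteq> ({} :: 'a set set)"
    then obtain T where T: "T \<in> triangles V ({} :: 'a set set)" by blast
    then have "\<not> card T \<le> Suc 0" "finite T" using triangle_card[OF T] by auto
    then obtain x y where "x \<in> T" "y \<in> T" "x \<noteq> y" using card_le_Suc0_iff_eq[of T] by blast
    then show False using triangleD[OF T] by blast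
  qed
  ultimately show ?thesis using E'(3) by simp
qed

section \<open>Double counting over ordered edges\<close>

lemma arcs_Sigma: "graph_on V E \<Longrightarrow> arcs E = Sigma V (nb E)"
  using graph_on_in by (fastforce simp: arcs_def nb_def)

lemma finite_arcs: "graph_on V E \<Longrightarrow> finite V \<Longrightarrow> finite (arcs E)"
  by (simp add: arcs_Sigma finite_nb)

lemma sum_arcs_edges:
  assumes g: "graph_on V E" and fV: "finite V"
  shows "(\<Sum>p\<in>arcs E. f {fst p, snd p}) = 2 * (\<Sum>e\<in>E. f e :: nat)"
proof -
  have im: "(\<lambda>p. {fst p, snd p}) ` arcs E = E"
  proof (intro equalityI subsetI)
    fix e assume "e \<in> E"
    then obtain x y where "e = {x, y}" "{x, y} \<in> E" using graph_on_edge[OF g] by metis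
    then show "e \<in> (\<lambda>p. {fst p, snd p}) ` arcs E" by (auto simp: arcs_def image_iff intro!: bexI[of _ "(x, y)"])
  qed (auto simp: arcs_def)
  have "(\<Sum>p\<in>arcs E. f {fst p, snd p}) = (\<Sum>e\<in>E. \<Sum>p\<in>{p \<in> arcs E. {fst p, snd p} = e}. f {fst p, snd p})"
    using sum.image_gen[OF finite_arcs[OF g fV], of "\<lambda>p. f {fst p, snd p}" "\<lambda>p. {fst p, snd p}"] im by simp
  also have "\<dots> = (\<Sum>e\<in>E. 2 * f e)"
  proof (rule sum.cong[OF refl])
    fix e assume "e \<in> E"
    then obtain x y where xy: "e = {x, y}" "x \<noteq> y" "{x, y} \<in> E" using graph_on_edge[OF g] by metis
    then have "{p \<in> arcs E. {fst p, snd p} = e} = {(x, y), (y, x)}"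
      by (auto simp: arcs_def doubleton_eq_iff insert_commute)
    then show "(\<Sum>p\<in>{p \<in> arcs E. {fst p, snd p} = e}. f {fst p, snd p}) = 2 * f e"
      using xy by (simp add: insert_commute)
  qed
  finally show ?thesis by (simp add: sum_distrib_left)
qed

lemma card_arcs: "graph_on V E \<Longrightarrow> finite V \<Longrightarrow> card (arcs E) = 2 * card E"
  using sum_arcs_edges[of V E "\<lambda>_. 1"] by simp

lemma sum_arcs_fst:
  assumes "graph_on V E" "finite V"
  shows "(\<Sum>p\<in>arcs E. f (fst p)) = (\<Sum>x\<in>V. card (nb E x) * (f x :: nat))"
proof -
  have "(\<Sum>p\<in>arcs E. f (fst p)) = (\<Sum>(x, y)\<in>Sigma V (nb E). f x)"
    unfolding arcs_Sigma[OF assms(1)] by (rule sum.cong) auto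
  also have "\<dots> = (\<Sum>x\<in>V. \<Sum>y\<in>nb E x. f x)"
    using assms finite_nb[OF assms] by (subst sum.Sigma[symmetric]) auto
  finally show ?thesis by simp
qed

lemma sum_arcs_snd: "(\<Sum>p\<in>arcs E. f (snd p)) = (\<Sum>p\<in>arcs E. f (fst p) :: nat)"
  by (rule sum.reindex_bij_witness[of _ prod.swap prod.swap]) (auto simp: arcs_def insert_commute)

lemma handshake: "graph_on V E \<Longrightarrow> finite V \<Longrightarrow> (\<Sum>x\<in>V. card (nb E x)) = 2 * card E"
  using sum_arcs_fst[of V E "\<lambda>_. 1"] card_arcs[of V E] by simp

lemma sum_codegree:
  assumes g: "graph_on V E" and fV: "finite V"
  shows "(\<Sum>p\<in>arcs E. card (cn E (fst p) (snd p))) = 6 * card (triangles V E)"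
proof -
  have fE: "finite E" using graph_on_finite[OF g fV] .
  have "(\<Sum>p\<in>arcs E. card (cn E (fst p) (snd p))) = (\<Sum>p\<in>arcs E. card {T \<in> triangles V E. {fst p, snd p} \<subseteq> T})"
    by (rule sum.cong[OF refl]) (auto simp: arcs_def triangles_on_edge[OF g] simp del: insert_subset)
  also have "\<dots> = 2 * (\<Sum>e\<in>E. card {T \<in> triangles V E. e \<subseteq> T})"
    by (rule sum_arcs_edges[OF g fV, of "\<lambda>e. card {T \<in> triangles V E. e \<subseteq> T}"])
  also have "(\<Sum>e\<in>E. card {T \<in> triangles V E. e \<subseteq> T}) = (\<Sum>T\<in>triangles V E. 3)"
  proof (rule sum_multicount_gen[OF fE finite_triangles[OF fV]])
    show "\<forall>T\<in>triangles V E. card {e \<in> E. e \<subseteq> T} = 3"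
    proof
      fix T assume T: "T \<in> triangles V E"
      have "{e \<in> E. e \<subseteq> T} = {e. e \<subseteq> T \<and> card e = 2}"
        using triangleD[OF T] g by (auto simp: graph_on_def card_2_iff)
      then show "card {e \<in> E. e \<subseteq> T} = 3"
        using n_subsets[of T 2] triangle_card[OF T] by (simp add: choose_two)
    qed
  qed
  finally show ?thesis by simp
qed

lemma sum_tdeg:
  assumes fV: "finite V"
  shows "(\<Sum>x\<in>V. tdeg V E x) = 3 * card (triangles V E)"
proof -
  have "(\<Sum>x\<in>V. tdeg V E x) = (\<Sum>T\<in>triangles V E. 3)" unfolding tdeg_def
  proof (rule sum_multicount_gen[OF fV finite_triangles[OF fV]])
    show "\<forall>T\<in>triangles V E. card {x \<in> V. x \<in> T} = 3"
    proof
      fix T assume T: "T \<in> triangles V E"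
      then have "{x \<in> V. x \<in> T} = T" by (auto simp: triangles_def)
      then show "card {x \<in> V. x \<in> T} = 3" using triangle_card[OF T] by simp
    qed
  qed
  then show ?thesis by simp
qed

lemma edges_in_neighbourhood:
  assumes g: "graph_on V E" and fV: "finite V"
  shows "card {e \<in> E. e \<subseteq> nb E v} \<le> tdeg V E v"
  unfolding tdeg_def
proof (rule card_inj_on_le[of "insert v"])
  have v: "v \<notin> nb E v" using graph_on_loop[OF g, of v] by (simp add: nb_def)
  show "inj_on (insert v) {e \<in> E. e \<subseteq> nb E v}" using v by (intro inj_onI) (metis insert_ident mem_Collect_eq subsetD)
  show "insert v ` {e \<in> E. e \<subseteq> nb E v} \<subseteq> {T \<in> triangles V E. v \<in> T}"
  proof
    fix T assume "T \<in> insert v ` {e \<in> E. e \<subseteq> nb E v}"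
    then obtain e where e: "T = insert v e" "e \<in> E" "e \<subseteq> nb E v" by auto
    then obtain x y where "e = {x, y}" "{x, y} \<in> E" using graph_on_edge[OF g] by metis
    then show "T \<in> {T \<in> triangles V E. v \<in> T}" using triangleI[OF g, of v x y] e by (auto simp: nb_def)
  qed
  show "finite {T \<in> triangles V E. v \<in> T}" using finite_triangles[OF fV] by simp
qed

lemma degree_sum_le:
  assumes g: "graph_on V E" and fV: "finite V"
  shows "card (nb E x) + card (nb E y) = card (nb E x \<union> nb E y) + card (cn E x y)"
  unfolding cn_def using card_Un_Int[OF finite_nb[OF g fV] finite_nb[OF g fV]] by simp

lemma sum_square_ge:
  assumes "finite V"
  shows "(\<Sum>x\<in>V. f x)\<^sup>2 \<le> real (card V) * (\<Sum>x\<in>V. (f x :: real)\<^sup>2)"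
proof (cases "card V = 0")
  case True
  then show ?thesis using assms by simp
next
  case False
  define s where "s = (\<Sum>x\<in>V. f x)"
  define c where "c = s / real (card V)"
  have "0 \<le> (\<Sum>x\<in>V. (f x - c)\<^sup>2)" by (intro sum_nonneg) auto
  also have "\<dots> = (\<Sum>x\<in>V. (f x)\<^sup>2 - 2 * c * f x + c\<^sup>2)" by (simp add: power2_diff algebra_simps)
  also have "\<dots> = (\<Sum>x\<in>V. (f x)\<^sup>2) - 2 * c * s + real (card V) * c\<^sup>2"
    by (simp add: sum.distrib sum_subtractf sum_distrib_left[symmetric] s_def)
  also have "\<dots> = (\<Sum>x\<in>V. (f x)\<^sup>2) - s\<^sup>2 / real (card V)"
    using False by (simp add: c_def power2_eq_square field_simps)
  finally show ?thesis using False by (simp add: s_def field_simps)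
qed

lemma sum_degree_squares:
  assumes g: "graph_on V E" and fV: "finite V"
  shows "4 * (real (card E))\<^sup>2 \<le> real (card V) * real (\<Sum>x\<in>V. (card (nb E x))\<^sup>2)"
proof -
  have "(\<Sum>x\<in>V. real (card (nb E x)))\<^sup>2 \<le> real (card V) * (\<Sum>x\<in>V. (real (card (nb E x)))\<^sup>2)"
    by (rule sum_square_ge[OF fV])
  moreover have "(\<Sum>x\<in>V. real (card (nb E x))) = 2 * real (card E)"
    using arg_cong[OF handshake[OF g fV], of real] by simp
  ultimately show ?thesis by (simp add: power_mult_distrib)
qed

text \<open>Mantel's argument with an error term: the degrees of the ends of an edge sum to at most
  the number of vertices plus the codegree. Summing over ordered edges gives the squares of the
  degrees on one side and the few triangles on the other, and the Cauchy-Schwarz inequality turns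
  this into a bound on the edges.\<close>

lemma edges_upper:
  assumes g: "graph_on V E" and fV: "finite V" and tr: "card (triangles V E) \<le> D * card E"
  shows "4 * card E \<le> (card V)\<^sup>2 + 3 * D * card V"
proof -
  have "2 * (\<Sum>x\<in>V. (card (nb E x))\<^sup>2) = (\<Sum>p\<in>arcs E. card (nb E (fst p)) + card (nb E (snd p)))"
    unfolding sum.distrib sum_arcs_snd[of "\<lambda>x. card (nb E x)"] sum_arcs_fst[OF g fV, of "\<lambda>x. card (nb E x)"]
    by (simp add: power2_eq_square)
  also have "\<dots> \<le> (\<Sum>p\<in>arcs E. card V + card (cn E (fst p) (snd p)))"
    unfolding degree_sum_le[OF g fV]
    by (intro sum_mono add_right_mono card_mono[OF fV]) (use nb_subset[OF g] in auto)
  also have "\<dots> = 2 * card E * card V + 6 * card (triangles V E)"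
    by (simp add: sum.distrib card_arcs[OF g fV] sum_codegree[OF g fV])
  finally have 1: "(\<Sum>x\<in>V. (card (nb E x))\<^sup>2) \<le> card E * card V + 3 * D * card E" using tr by simp
  have "real (\<Sum>x\<in>V. (card (nb E x))\<^sup>2) \<le> real (card E * card V + 3 * D * card E)"
    using 1 of_nat_le_iff by blast
  then have "4 * (real (card E))\<^sup>2 \<le> real (card V) * real (card E * card V + 3 * D * card E)"
    using sum_degree_squares[OF g fV] mult_left_mono[of _ _ "real (card V)"] by fastforce
  also have "\<dots> = real (card E) * real ((card V)\<^sup>2 + 3 * D * card V)"
    by (simp add: power2_eq_square algebra_simps)
  finally have "real (card E) * (4 * real (card E)) \<le> real (card E) * real ((card V)\<^sup>2 + 3 * D * card V)"
    by (simp add: power2_eq_square algebra_simps)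
  then show ?thesis
  proof (cases "card E = 0")
    case False
    then have "4 * real (card E) \<le> real ((card V)\<^sup>2 + 3 * D * card V)"
      using \<open>real (card E) * (4 * real (card E)) \<le> _\<close> by (simp only: mult_le_cancel_left_pos of_nat_0_less_iff)
    then show ?thesis by (metis of_nat_le_iff of_nat_mult of_nat_numeral)
  qed simp
qed

section \<open>Complete bipartite subgraphs of dense relations\<close>

text \<open>A qualitative form of the Kovari-Sos-Turan theorem. A fixed number \<open>R\<close> of
  rows of large degree leaves only \<open>2 ^ R\<close> traces for the columns, and some trace of
  size at least \<open>M\<close> is shared by at least \<open>M\<close> columns.\<close>

lemma dense_grid:
  assumes "0 < (\<delta>::real)"
  shows "\<exists>N. \<forall>(A :: 'a set) (B :: 'b set) P n. finite A \<longrightarrow> finite B \<longrightarrow> card A \<le> n \<longrightarrow> card B \<le> n \<longrightarrow> N \<le> n \<longrightarrow>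
    \<delta> * (real n)\<^sup>2 \<le> real (card {p \<in> A \<times> B. P (fst p) (snd p)}) \<longrightarrow>
    (\<exists>X\<subseteq>A. \<exists>Y\<subseteq>B. card X = M \<and> card Y = M \<and> (\<forall>x\<in>X. \<forall>y\<in>Y. P x y))"
proof -
  \<comment> \<open>\<open>R\<close> rows of degree at least \<open>\<delta> * n / 2\<close> carry
    more than \<open>2 * M * n\<close> incidences. Column by column, traces smaller than
    \<open>M\<close> account for at most \<open>M * n\<close> of them; if each larger trace occurred
    fewer than \<open>M\<close> times, these would add at most \<open>2 ^ R * M * R\<close>, which
    is at most \<open>M * n\<close> once \<open>n\<close> exceeds \<open>N\<close>.\<close>
  obtain R :: nat where R: "4 * real M + 4 < R * \<delta>"
    using reals_Archimedean3[OF assms] by blast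
  obtain N1 :: nat where N1: "real R * 2 < N1 * \<delta>" using reals_Archimedean3[OF assms] by blast
  define N where "N = N1 + 2 ^ R * R + 1"
  show ?thesis
  proof (intro exI[of _ N] allI impI)
    fix A :: "'a set" and B :: "'b set" and P n
    assume fin: "finite A" "finite B" and c: "card A \<le> n" "card B \<le> n" and n: "N \<le> n"
      and d: "\<delta> * (real n)\<^sup>2 \<le> real (card {p \<in> A \<times> B. P (fst p) (snd p)})"
    define deg where "deg x = card {y \<in> B. P x y}" for x
    have n0: "0 < real n" using n by (simp add: N_def)
    have "{p \<in> A \<times> B. P (fst p) (snd p)} = Sigma A (\<lambda>x. {y \<in> B. P x y})" by auto
    then have sd: "card {p \<in> A \<times> B. P (fst p) (snd p)} = (\<Sum>x\<in>A. deg x)"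
      using fin by (simp add: deg_def)
    define A1 where "A1 = {x \<in> A. \<delta> * real n / 2 \<le> real (deg x)}"
    have dn: "deg x \<le> n" for x unfolding deg_def using c(2) card_mono[OF fin(2), of "{y \<in> B. P x y}"] by force
    have "R \<le> card A1"
    proof (rule ccontr)
      assume "\<not> R \<le> card A1"
      then have A1: "real (card A1) \<le> real R" by simp
      have "real (\<Sum>x\<in>A. deg x) = (\<Sum>x\<in>A1. real (deg x)) + (\<Sum>x\<in>A - A1. real (deg x))"
        using fin by (simp add: A1_def sum.subset_diff[of A1 A] )
      also have "\<dots> \<le> (\<Sum>x\<in>A1. real n) + (\<Sum>x\<in>A - A1. \<delta> * real n / 2)"
        using dn by (intro add_mono sum_mono) (auto simp: A1_def)
      also have "\<dots> \<le> real R * real n + real n * (\<delta> * real n / 2)"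
      proof (rule add_mono)
        show "(\<Sum>x\<in>A1. real n) \<le> real R * real n" using A1 n0 by (simp add: mult_right_mono)
        have "real (card (A - A1)) \<le> real n" using c(1) card_mono[OF fin(1), of "A - A1"] by force
        then show "(\<Sum>x\<in>A - A1. \<delta> * real n / 2) \<le> real n * (\<delta> * real n / 2)"
          using assms n0 by (simp add: mult_right_mono)
      qed
      finally have "\<delta> * (real n)\<^sup>2 \<le> real R * real n + real n * (\<delta> * real n / 2)" using d sd by simp
      then have "real n * (\<delta> * real n) \<le> real n * (2 * real R)" by (simp add: power2_eq_square algebra_simps)
      then have "\<delta> * real n \<le> 2 * real R" using n0 by simp
      moreover have "real N1 * \<delta> \<le> \<delta> * real n" using n assms by (simp add: N_def mult.commute)
      ultimately show False using N1 by simp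
    qed
    then obtain XR where XR: "XR \<subseteq> A1" "card XR = R" using subset_of_card by blast
    have fXR: "finite XR" using XR fin finite_subset[of XR A] by (auto simp: A1_def)
    define T where "T y = {x \<in> XR. P x y}" for y
    have "\<exists>S\<in>Pow XR. M \<le> card S \<and> M \<le> card {y \<in> B. T y = S}"
    proof (rule ccontr)
      assume no: "\<not> ?thesis"
      have "real R * (\<delta> * real n / 2) \<le> (\<Sum>x\<in>XR. real (deg x))"
        using sum_mono[of XR "\<lambda>_. \<delta> * real n / 2" "\<lambda>x. real (deg x)"] XR by (auto simp: A1_def)
      also have "(\<Sum>x\<in>XR. real (deg x)) = real (\<Sum>x\<in>XR. deg x)" by simp
      also have "(\<Sum>x\<in>XR. deg x) = (\<Sum>y\<in>B. card (T y))"
        unfolding deg_def T_def by (rule sum_multicount_gen[OF fXR fin(2)]) auto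
      also have "\<dots> \<le> (\<Sum>y\<in>B. M + (if M \<le> card (T y) then R else 0))"
      proof (rule sum_mono)
        fix y
        have "card (T y) \<le> R" using XR(2) card_mono[OF fXR, of "T y"] by (auto simp: T_def)
        then show "card (T y) \<le> M + (if M \<le> card (T y) then R else 0)" by auto
      qed
      also have "\<dots> = card B * M + (\<Sum>y\<in>B. if M \<le> card (T y) then R else 0)" by (simp add: sum.distrib)
      also have "(\<Sum>y\<in>B. if M \<le> card (T y) then R else 0) = (\<Sum>S\<in>T ` B. \<Sum>y\<in>{y \<in> B. T y = S}. if M \<le> card (T y) then R else 0)"
        by (rule sum.image_gen[OF fin(2)])
      also have "\<dots> \<le> (\<Sum>S\<in>T ` B. M * R)"
      proof (rule sum_mono)
        fix S assume "S \<in> T ` B"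
        then have S: "S \<in> Pow XR" by (auto simp: T_def)
        have "(\<Sum>y\<in>{y \<in> B. T y = S}. if M \<le> card (T y) then R else 0) = card {y \<in> B. T y = S} * (if M \<le> card S then R else 0)"
          by simp
        also have "\<dots> \<le> M * R"
        proof (cases "M \<le> card S")
          case True
          then have "card {y \<in> B. T y = S} \<le> M" using no S by force
          then show ?thesis using True by simp
        qed simp
        finally show "(\<Sum>y\<in>{y \<in> B. T y = S}. if M \<le> card (T y) then R else 0) \<le> M * R" .
      qed
      also have "\<dots> \<le> 2 ^ R * (M * R)"
      proof -
        have "card (T ` B) \<le> card (Pow XR)" using fXR by (intro card_mono) (auto simp: T_def)
        then show ?thesis using XR(2) fXR by (simp add: card_Pow)
      qed
      finally have "real R * (\<delta> * real n / 2) \<le> real (card B * M + 2 ^ R * (M * R))" by simp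
      also have "card B * M + 2 ^ R * (M * R) \<le> n * M + n * M"
        using c(2) n by (intro add_mono) (auto simp: N_def mult.assoc[symmetric] mult.commute[of M R] intro!: mult_right_mono)
      finally have "real R * (\<delta> * real n / 2) \<le> real n * (2 * real M)" by (simp add: mult.commute[of "real n"])
      then have "real n * (real R * \<delta>) \<le> real n * (4 * real M)" by argo
      then have "real R * \<delta> \<le> 4 * real M" using n0 by simp
      then show False using R by simp
    qed
    then obtain S where S: "S \<subseteq> XR" "M \<le> card S" "M \<le> card {y \<in> B. T y = S}" by auto
    obtain X where X: "X \<subseteq> S" "card X = M" using subset_of_card[OF S(2)] by blast
    obtain Y where Y: "Y \<subseteq> {y \<in> B. T y = S}" "card Y = M" using subset_of_card[OF S(3)] by blast
    have "X \<subseteq> A" using X S XR by (auto simp: A1_def)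
    moreover have "Y \<subseteq> B" using Y by auto
    moreover have "\<forall>x\<in>X. \<forall>y\<in>Y. P x y" using X Y by (auto simp: T_def)
    ultimately show "\<exists>X\<subseteq>A. \<exists>Y\<subseteq>B. card X = M \<and> card Y = M \<and> (\<forall>x\<in>X. \<forall>y\<in>Y. P x y)"
      using X(2) Y(2) by blast
  qed
qed


subsection \<open>Near-extremal graphs are almost bipartite\<close>

lemma eventually_linear_le: "0 < (\<delta>::real) \<Longrightarrow> \<exists>N. \<forall>n\<ge>N. c * real n \<le> \<delta> * (real n)\<^sup>2"
proof -
  assume d: "0 < \<delta>"
  obtain N :: nat where N: "c < real N * \<delta>" using reals_Archimedean3[OF d] by blast
  show ?thesis
  proof (intro exI[of _ N] allI impI)
    fix n assume "N \<le> n"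
    then have "real N * \<delta> \<le> real n * \<delta>" using d by (intro mult_right_mono) auto
    then have "c * real n \<le> (real n * \<delta>) * real n" using N by (intro mult_right_mono) auto
    then show "c * real n \<le> \<delta> * (real n)\<^sup>2" by (simp add: power2_eq_square algebra_simps)
  qed
qed

lemma eventually_const_le: "0 < (\<delta>::real) \<Longrightarrow> \<exists>N. \<forall>n\<ge>N. c \<le> \<delta> * real n"
proof -
  assume d: "0 < \<delta>"
  obtain N :: nat where N: "c < real N * \<delta>" using reals_Archimedean3[OF d] by blast
  show ?thesis
  proof (intro exI[of _ N] allI impI)
    fix n assume "N \<le> n"
    then have "real N * \<delta> \<le> real n * \<delta>" using d by (intro mult_right_mono) auto
    then show "c \<le> \<delta> * real n" using N by (simp add: mult.commute)
  qed
qed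

text \<open>Codegrees above \<open>t\<close> make the graph tight, hence rich, and positive density
  would supply a grid for \<open>full_grid_cycles\<close>.\<close>

lemma high_codegree_sparse:
  assumes t: "2 \<le> t" and \<delta>: "0 < (\<delta>::real)"
  shows "\<exists>N. \<forall>(V :: 'a set) E. graph_on V E \<longrightarrow> finite V \<longrightarrow> N \<le> card V \<longrightarrow> free t E \<longrightarrow>
    (\<forall>x y. {x, y} \<in> E \<longrightarrow> t < card (cn E x y)) \<longrightarrow> real (card E) \<le> \<delta> * (real (card V))\<^sup>2"
proof -
  obtain M where M: "\<forall>(V :: 'a set) E X Y. graph_on V E \<longrightarrow> finite V \<longrightarrow> rich E \<longrightarrow> finite X \<longrightarrow> finite Y \<longrightarrow>
    M \<le> card X \<longrightarrow> M \<le> card Y \<longrightarrow> (\<forall>x\<in>X. \<forall>y\<in>Y. {x, y} \<in> E \<and> t + 1 \<le> card (cn E x y)) \<longrightarrow>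
    lcyc E (2 * t + 1) \<and> lcyc E (2 * t + 2)" using full_grid_cycles[OF t] by (elim exE) (rule that)
  obtain N where N: "\<forall>(A :: 'a set) (B :: 'a set) P n. finite A \<longrightarrow> finite B \<longrightarrow> card A \<le> n \<longrightarrow> card B \<le> n \<longrightarrow> N \<le> n \<longrightarrow>
    \<delta> * (real n)\<^sup>2 \<le> real (card {p \<in> A \<times> B. P (fst p) (snd p)}) \<longrightarrow>
    (\<exists>X\<subseteq>A. \<exists>Y\<subseteq>B. card X = M \<and> card Y = M \<and> (\<forall>x\<in>X. \<forall>y\<in>Y. P x y))"
    using dense_grid[OF \<delta>, of M] by (elim exE) (rule that)
  show ?thesis
  proof (intro exI[of _ N] allI impI, rule ccontr)
    fix V :: "'a set" and E
    assume g: "graph_on V E" and fV: "finite V" and n: "N \<le> card V" and fr: "free t E"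
      and cd: "\<forall>x y. {x, y} \<in> E \<longrightarrow> t < card (cn E x y)" and big: "\<not> real (card E) \<le> \<delta> * (real (card V))\<^sup>2"
    have "arcs E = {p \<in> V \<times> V. {fst p, snd p} \<in> E}" using graph_on_in[OF g] by (auto simp: arcs_def)
    then have "\<delta> * (real (card V))\<^sup>2 \<le> real (card {p \<in> V \<times> V. {fst p, snd p} \<in> E})"
      using big card_arcs[OF g fV] by simp
    then obtain X Y where XY: "X \<subseteq> V" "Y \<subseteq> V" "card X = M" "card Y = M" "\<forall>x\<in>X. \<forall>y\<in>Y. {x, y} \<in> E"
      using N[rule_format, OF fV fV order.refl order.refl n, of "\<lambda>x y. {x, y} \<in> E"] by auto
    have "tight t E" using cd unfolding tight_def by fastforce
    then have r: "rich E" using tight_rich t by blast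
    have fin: "finite X" "finite Y" using XY fV finite_subset by auto
    have "\<forall>x\<in>X. \<forall>y\<in>Y. {x, y} \<in> E \<and> t + 1 \<le> card (cn E x y)" using XY(5) cd by fastforce
    then show False using M[rule_format, OF g fV r fin] XY(3,4) fr by (simp add: free_def)
  qed
qed

text \<open>Peeling at codegree \<open>t\<close> loses at most \<open>t\<close> triangles per edge.
  What is left is sparse by the previous lemma and has only a bounded number of triangles per
  edge.\<close>

lemma triangles_asymptotic:
  assumes t: "2 \<le> t" and \<delta>: "0 < (\<delta>::real)"
  shows "\<exists>N. \<forall>(V :: 'a set) E. graph_on V E \<longrightarrow> finite V \<longrightarrow> N \<le> card V \<longrightarrow> free t E \<longrightarrow>
    real (card (triangles V E)) \<le> real t * real (card E) + \<delta> * (real (card V))\<^sup>2"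
proof -
  define D where "D = 4 * t + 9"
  have d': "0 < \<delta> / real D" using \<delta> by (simp add: D_def)
  obtain N where N: "\<forall>(V :: 'a set) E. graph_on V E \<longrightarrow> finite V \<longrightarrow> N \<le> card V \<longrightarrow> free t E \<longrightarrow>
    (\<forall>x y. {x, y} \<in> E \<longrightarrow> t < card (cn E x y)) \<longrightarrow> real (card E) \<le> \<delta> / real D * (real (card V))\<^sup>2"
    using high_codegree_sparse[OF t d'] by (elim exE) (rule that)
  show ?thesis
  proof (intro exI[of _ N] allI impI)
    fix V :: "'a set" and E
    assume g: "graph_on V E" and fV: "finite V" and n: "N \<le> card V" and fr: "free t E"
    obtain E' where E': "E' \<subseteq> E" "\<forall>x y. {x, y} \<in> E' \<longrightarrow> t < card (cn E' x y)"
      "card (triangles V E) + t * card E' \<le> card (triangles V E') + t * card E"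
      using peel[OF g fV, of t] by blast
    have g': "graph_on V E'" and fr': "free t E'" using graph_on_subset[OF g E'(1)] free_subset[OF fr E'(1)] .
    have "real (card E') \<le> \<delta> / real D * (real (card V))\<^sup>2" using N[rule_format, OF g' fV n fr'] E'(2) by blast
    then have "real D * real (card E') \<le> \<delta> * (real (card V))\<^sup>2"
      using \<delta> by (simp add: D_def field_simps)
    moreover have "card (triangles V E') \<le> D * card E'" using triangles_linear[OF g' fV fr'] t by (simp add: D_def)
    then have "real (card (triangles V E')) \<le> real D * real (card E')" by (metis of_nat_le_iff of_nat_mult)
    moreover have "real (card (triangles V E)) + real t * real (card E') \<le> real (card (triangles V E')) + real t * real (card E)"
      using E'(3) by (metis of_nat_le_iff of_nat_mult of_nat_add)
    moreover have "0 \<le> real t * real (card E')" by simp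
    ultimately show "real (card (triangles V E)) \<le> real t * real (card E) + \<delta> * (real (card V))\<^sup>2" by linarith
  qed
qed

text \<open>Write \<open>e\<close>, \<open>e'\<close> for the numbers of edges before and after
  \<open>peel_tight\<close>. Up to lower order terms, twice the number of triangles is at least
  \<open>2 * t * n^2 / 4\<close> before and at most \<open>2 * t * e'\<close> after, while
  \<open>e\<close> is at most \<open>n^2 / 4\<close>. Since peeling costs only
  \<open>2 * t - 1\<close> per edge in this doubled count, the terms cancel to \<open>e'\<close>
  being at least \<open>n^2 / 4\<close>.\<close>

lemma tight_subgraph:
  assumes t: "2 \<le> t" and \<delta>: "0 < (\<delta>::real)"
  shows "\<exists>N. \<forall>(V :: 'a set) E. graph_on V E \<longrightarrow> finite V \<longrightarrow> N \<le> card V \<longrightarrow> free t E \<longrightarrow>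
    real t * (real (card V))\<^sup>2 / 4 - c * real (card V) \<le> real (card (triangles V E)) \<longrightarrow>
    (\<exists>E'\<subseteq>E. tight t E' \<and> (real (card V))\<^sup>2 / 4 - \<delta> * (real (card V))\<^sup>2 \<le> real (card E'))"
proof -
  define D where "D = 4 * t + 9"
  have \<delta>1: "0 < \<delta> / 4" using \<delta> by simp
  obtain N1 where N1: "\<forall>(V :: 'a set) E. graph_on V E \<longrightarrow> finite V \<longrightarrow> N1 \<le> card V \<longrightarrow> free t E \<longrightarrow>
    real (card (triangles V E)) \<le> real t * real (card E) + \<delta> / 4 * (real (card V))\<^sup>2"
    using triangles_asymptotic[OF t \<delta>1] by (elim exE) (rule that)
  obtain N2 where N2: "\<And>n. N2 \<le> n \<Longrightarrow> (2 * c + real (2 * t - 1) * real D) * real n \<le> \<delta> / 4 * (real n)\<^sup>2"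
    using eventually_linear_le[OF \<delta>1] by blast
  show ?thesis
  proof (intro exI[of _ "N1 + N2"] allI impI)
    fix V :: "'a set" and E
    assume g: "graph_on V E" and fV: "finite V" and n: "N1 + N2 \<le> card V" and fr: "free t E"
      and tr: "real t * (real (card V))\<^sup>2 / 4 - c * real (card V) \<le> real (card (triangles V E))"
    define n where "n = real (card V)"
    have t1: "1 \<le> t" using t by simp
    obtain E' where E': "E' \<subseteq> E" "tight t E'"
      "2 * card (triangles V E) + (2 * t - 1) * card E' \<le> 2 * card (triangles V E') + (2 * t - 1) * card E"
      using peel_tight[OF g fV t1] by blast
    have g': "graph_on V E'" and fr': "free t E'" using graph_on_subset[OF g E'(1)] free_subset[OF fr E'(1)] .
    have 1: "real (card (triangles V E')) \<le> real t * real (card E') + \<delta> / 4 * n\<^sup>2"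
      using N1[rule_format, OF g' fV _ fr'] n by (simp add: n_def)
    have "4 * card E \<le> (card V)\<^sup>2 + 3 * D * card V"
      using edges_upper[OF g fV triangles_linear[OF g fV fr t1]] by (simp add: D_def)
    then have 2: "4 * real (card E) \<le> n\<^sup>2 + 3 * real D * n"
      unfolding n_def by (metis (mono_tags, lifting) of_nat_add of_nat_le_iff of_nat_mult of_nat_numeral of_nat_power)
    define q where "q = real (2 * t - 1)"
    have q: "q = 2 * real t - 1" using t by (simp add: q_def of_nat_diff)
    have 3: "2 * real (card (triangles V E)) + q * real (card E') \<le> 2 * real (card (triangles V E')) + q * real (card E)"
      unfolding q_def using E'(3) by (metis (mono_tags, lifting) of_nat_add of_nat_le_iff of_nat_mult of_nat_numeral)
    have "(2 * c + q * real D) * n \<le> \<delta> / 4 * n\<^sup>2" using N2[of "card V"] n by (simp add: q_def n_def)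
    then have 4: "2 * (c * n) + q * (real D * n) \<le> \<delta> / 4 * n\<^sup>2" by (simp add: algebra_simps)
    have "q * (4 * real (card E)) \<le> q * (n\<^sup>2 + 3 * real D * n)" using 2 q t by (intro mult_left_mono) auto
    then have 5: "4 * (q * real (card E)) \<le> q * n\<^sup>2 + 3 * (q * (real D * n))" by (simp add: algebra_simps)
    have 6: "q * real (card E') = 2 * (real t * real (card E')) - real (card E')" "q * n\<^sup>2 = 2 * (real t * n\<^sup>2) - n\<^sup>2"
      by (simp_all add: q algebra_simps)
    have tr': "real t * n\<^sup>2 / 4 - c * n \<le> real (card (triangles V E))" using tr by (simp add: n_def)
    have 7: "0 \<le> q * (real D * n)" using q t by (simp add: n_def)
    have 8: "0 \<le> \<delta> * n\<^sup>2" using \<delta> by simp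
    have "n\<^sup>2 / 4 - \<delta> * n\<^sup>2 \<le> real (card E')"
      using 1 3 4 5 6 tr' 7 8 by simp
    then show "\<exists>E'\<subseteq>E. tight t E' \<and> (real (card V))\<^sup>2 / 4 - \<delta> * (real (card V))\<^sup>2 \<le> real (card E')"
      using E' by (auto simp: n_def)
  qed
qed

section \<open>An almost bipartition from two neighbourhoods\<close>

lemma edges_touching:
  assumes g: "graph_on V E" and fV: "finite V" and Z: "Z \<subseteq> V"
  shows "card {e \<in> E. e \<inter> Z \<noteq> {}} \<le> card Z * card V"
proof -
  have "{e \<in> E. e \<inter> Z \<noteq> {}} \<subseteq> (\<lambda>p. {fst p, snd p}) ` (Z \<times> V)"
  proof
    fix e assume e: "e \<in> {e \<in> E. e \<inter> Z \<noteq> {}}"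
    then obtain x y where xy: "e = {x, y}" "x \<in> V" "y \<in> V" using graph_on_edge[OF g] by blast
    then have "x \<in> Z \<or> y \<in> Z" using e by auto
    then show "e \<in> (\<lambda>p. {fst p, snd p}) ` (Z \<times> V)"
      using xy by (auto simp: image_iff intro: bexI[of _ "(x, y)"] bexI[of _ "(y, x)"])
  qed
  moreover have fin: "finite (Z \<times> V)" using Z fV finite_subset by blast
  ultimately have "card {e \<in> E. e \<inter> Z \<noteq> {}} \<le> card ((\<lambda>p. {fst p, snd p}) ` (Z \<times> V))"
    by (intro card_mono) auto
  also have "\<dots> \<le> card (Z \<times> V)" using fin by (rule card_image_le)
  finally show ?thesis by (simp add: card_cartesian_product)
qed

text \<open>If few edges lie inside \<open>nb E u\<close> and \<open>nb E v\<close>, i.e. if \<open>tdeg V E u\<close> and \<open>tdeg V E v\<close> are small,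
  then the two neighbourhoods are the parts of an almost bipartition of \<open>V\<close>.
  Such an edge is found by averaging over all edges.\<close>
lemma good_arc:
  assumes g: "graph_on V E" and fV: "finite V" and D: "0 < D" "card (triangles V E) \<le> D * card E"
    and \<epsilon>: "0 < \<epsilon>" "\<epsilon> < 1 / 8" and n: "3 * real D + 1 \<le> \<epsilon> * real (card V)"
    and e: "(real (card V))\<^sup>2 / 4 - \<epsilon> * (real (card V))\<^sup>2 \<le> real (card E)"
  obtains u v where "{u, v} \<in> E"
    "real (card V) - 6 * \<epsilon> * real (card V) \<le> real (card (nb E u \<union> nb E v)) - \<epsilon> / (3 * real D) * real (tdeg V E u + tdeg V E v)"
proof -
  define n where "n = real (card V)"
  define m where "m = real (card E)"
  \<comment> \<open>The penalty for triangles is scaled so that its sum over all ordered edges is at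
    most \<open>2 * \<epsilon> * n * m\<close>, where \<open>m\<close> is the number of
    edges.\<close>
  define \<mu> where "\<mu> = \<epsilon> / (3 * real D)"
  define T where "T = real (card (triangles V E))"
  have n0: "0 < n"
  proof (rule ccontr)
    assume "\<not> 0 < n"
    then have "n = 0" by (simp add: n_def)
    then show False using n by (simp add: n_def)
  qed
  have T: "T \<le> real D * m" unfolding T_def m_def using D(2) by (metis of_nat_le_iff of_nat_mult)
  have l0: "0 < \<mu>" using \<epsilon> D by (simp add: \<mu>_def)
  define \<Phi> where "\<Phi> p = real (card (nb E (fst p) \<union> nb E (snd p))) - \<mu> * real (tdeg V E (fst p) + tdeg V E (snd p))" for p
  have "\<exists>p\<in>arcs E. n - 6 * \<epsilon> * n \<le> \<Phi> p"
  proof (rule ccontr)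
    assume "\<not> ?thesis"
    then have "(\<Sum>p\<in>arcs E. \<Phi> p) \<le> (\<Sum>p\<in>arcs E. n - 6 * \<epsilon> * n)" by (intro sum_mono) auto
    also have "\<dots> = 2 * m * (n - 6 * \<epsilon> * n)" by (simp add: card_arcs[OF g fV] m_def)
    finally have up: "(\<Sum>p\<in>arcs E. \<Phi> p) \<le> 2 * m * (n - 6 * \<epsilon> * n)" .
    define S where "S = (\<Sum>x\<in>V. (card (nb E x))\<^sup>2)"
    have s1: "(\<Sum>p\<in>arcs E. card (nb E (fst p) \<union> nb E (snd p))) + 6 * card (triangles V E) = 2 * S"
    proof -
      have "(\<Sum>p\<in>arcs E. card (nb E (fst p) \<union> nb E (snd p))) + 6 * card (triangles V E)
          = (\<Sum>p\<in>arcs E. card (nb E (fst p)) + card (nb E (snd p)))"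
        unfolding degree_sum_le[OF g fV] sum.distrib[symmetric] sum_codegree[OF g fV, symmetric] by simp
      also have "\<dots> = 2 * S"
        unfolding sum.distrib sum_arcs_snd[of "\<lambda>x. card (nb E x)"] sum_arcs_fst[OF g fV, of "\<lambda>x. card (nb E x)"]
        by (simp add: power2_eq_square S_def)
      finally show ?thesis .
    qed
    have s2: "(\<Sum>p\<in>arcs E. tdeg V E (fst p) + tdeg V E (snd p)) \<le> 6 * card V * card (triangles V E)"
    proof -
      have "(\<Sum>p\<in>arcs E. tdeg V E (fst p) + tdeg V E (snd p)) = 2 * (\<Sum>x\<in>V. card (nb E x) * tdeg V E x)"
        unfolding sum.distrib sum_arcs_snd[of "tdeg V E"] sum_arcs_fst[OF g fV, of "tdeg V E"] by simp
      also have "\<dots> \<le> 2 * (\<Sum>x\<in>V. card V * tdeg V E x)"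
        using card_mono[OF fV nb_subset[OF g]] by (intro mult_left_mono sum_mono mult_right_mono) auto
      also have "\<dots> = 6 * card V * card (triangles V E)"
        by (simp add: sum_distrib_left[symmetric] sum_tdeg[OF fV])
      finally show ?thesis .
    qed
    have "(\<Sum>p\<in>arcs E. \<Phi> p) = real (\<Sum>p\<in>arcs E. card (nb E (fst p) \<union> nb E (snd p)))
        - \<mu> * real (\<Sum>p\<in>arcs E. tdeg V E (fst p) + tdeg V E (snd p))"
      by (simp add: \<Phi>_def sum_subtractf sum_distrib_left)
    moreover have "real (\<Sum>p\<in>arcs E. card (nb E (fst p) \<union> nb E (snd p))) + 6 * T = 2 * real S"
      using arg_cong[OF s1, of real] by (simp add: T_def)
    moreover have "\<mu> * real (\<Sum>p\<in>arcs E. tdeg V E (fst p) + tdeg V E (snd p)) \<le> \<mu> * (6 * n * T)"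
    proof (rule mult_left_mono)
      show "real (\<Sum>p\<in>arcs E. tdeg V E (fst p) + tdeg V E (snd p)) \<le> 6 * n * T"
        using s2 unfolding n_def T_def by (metis of_nat_le_iff of_nat_mult of_nat_numeral)
    qed (use l0 in simp)
    ultimately have "2 * real S - 6 * T - \<mu> * (6 * n * T) \<le> 2 * m * (n - 6 * \<epsilon> * n)" using up by linarith
    moreover have "\<mu> * (6 * n * T) \<le> \<mu> * (6 * n * (real D * m))" using T l0 n0 by (intro mult_left_mono) auto
    moreover have "\<mu> * (6 * n * (real D * m)) = 2 * \<epsilon> * n * m" using D by (simp add: \<mu>_def field_simps)
    ultimately have a: "2 * real S \<le> 2 * m * (n - 6 * \<epsilon> * n) + 6 * (real D * m) + 2 * \<epsilon> * n * m" using T by linarith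
    have b: "4 * m\<^sup>2 \<le> n * real S" using sum_degree_squares[OF g fV] by (simp add: m_def n_def S_def)
    have "n * (2 * real S) \<le> n * (2 * m * (n - 6 * \<epsilon> * n) + 6 * (real D * m) + 2 * \<epsilon> * n * m)"
      using a n0 by (intro mult_left_mono) auto
    then have "8 * m\<^sup>2 \<le> n * (2 * m * (n - 6 * \<epsilon> * n) + 6 * (real D * m) + 2 * \<epsilon> * n * m)" using b by linarith
    then have c: "(2 * m) * (4 * m) \<le> (2 * m) * (n * (n - 5 * \<epsilon> * n + 3 * real D))"
      by (simp add: power2_eq_square algebra_simps)
    have "0 < n\<^sup>2 * (1 / 4 - \<epsilon>)" using n0 \<epsilon> by (intro mult_pos_pos) auto
    then have m0: "0 < m" using e by (simp add: m_def n_def algebra_simps)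
    have "4 * m \<le> n * (n - 5 * \<epsilon> * n + 3 * real D)" using c m0 by (simp only: mult_le_cancel_left_pos mult_pos_pos zero_less_numeral)
    moreover have "n * (n - 4 * \<epsilon> * n) \<le> 4 * m" using e by (simp add: m_def n_def power2_eq_square algebra_simps)
    \<comment> \<open>If every edge failed, the number of edges would be at most about
      \<open>n^2 / 4 - 5 / 4 * \<epsilon> * n^2\<close>, below the assumed
      \<open>n^2 / 4 - \<epsilon> * n^2\<close> by a margin that exceeds the term with
      \<open>D\<close>.\<close>
    ultimately have "n * (n - 4 * \<epsilon> * n) \<le> n * (n - 5 * \<epsilon> * n + 3 * real D)" by linarith
    then have "n - 4 * \<epsilon> * n \<le> n - 5 * \<epsilon> * n + 3 * real D" using n0 by simp
    then show False using n by (simp add: n_def)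
  qed
  then obtain u v where "{u, v} \<in> E" "n - 6 * \<epsilon> * n \<le> \<Phi> (u, v)" by (auto simp: arcs_def)
  then show thesis using that by (simp add: \<Phi>_def n_def \<mu>_def)
qed

text \<open>The parts are the neighbourhoods of the ends of a good edge, the second without the
  first. Of the \<open>8 * \<epsilon>\<close>, one is assumed, six are for edges touching the
  uncovered set \<open>Z\<close>, and one is for the linearly many edges inside the two
  neighbourhoods.\<close>

lemma bipartite_core:
  assumes D: "0 < (D::nat)" and \<epsilon>: "0 < (\<epsilon>::real)" "\<epsilon> < 1 / 8"
  shows "\<exists>N. \<forall>(V :: 'a set) E. graph_on V E \<longrightarrow> finite V \<longrightarrow> N \<le> card V \<longrightarrow> card (triangles V E) \<le> D * card E \<longrightarrow>
    (real (card V))\<^sup>2 / 4 - \<epsilon> * (real (card V))\<^sup>2 \<le> real (card E) \<longrightarrow>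
    (\<exists>A B. A \<subseteq> V \<and> B \<subseteq> V \<and> A \<inter> B = {} \<and>
      (real (card V))\<^sup>2 / 4 - 8 * \<epsilon> * (real (card V))\<^sup>2 \<le> real (card {p \<in> A \<times> B. {fst p, snd p} \<in> E}))"
proof -
  obtain N1 where N1: "\<And>n. N1 \<le> n \<Longrightarrow> 3 * real D + 1 \<le> \<epsilon> * real n" using eventually_const_le[OF \<epsilon>(1)] by blast
  obtain N2 where N2: "\<And>n. N2 \<le> n \<Longrightarrow> (18 * real D) * real n \<le> \<epsilon> * (real n)\<^sup>2" using eventually_linear_le[OF \<epsilon>(1)] by blast
  show ?thesis
  proof (intro exI[of _ "N1 + N2"] allI impI)
    fix V :: "'a set" and E
    assume g: "graph_on V E" and fV: "finite V" and nN: "N1 + N2 \<le> card V" and tr: "card (triangles V E) \<le> D * card E"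
      and e: "(real (card V))\<^sup>2 / 4 - \<epsilon> * (real (card V))\<^sup>2 \<le> real (card E)"
    define n where "n = real (card V)"
    obtain u v where uv: "{u, v} \<in> E"
      "n - 6 * \<epsilon> * n \<le> real (card (nb E u \<union> nb E v)) - \<epsilon> / (3 * real D) * real (tdeg V E u + tdeg V E v)"
      using good_arc[OF g fV D tr \<epsilon> N1 e] nN by (auto simp: n_def)
    define A where "A = nb E u"
    define B where "B = nb E v - nb E u"
    define Z where "Z = V - (A \<union> B)"
    have AB: "A \<subseteq> V" "B \<subseteq> V" "A \<inter> B = {}" "A \<union> B = nb E u \<union> nb E v" using nb_subset[OF g] by (auto simp: A_def B_def)
    have l0: "0 \<le> \<epsilon> / (3 * real D) * real (tdeg V E u + tdeg V E v)" using \<epsilon> by simp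
    have "card Z = card V - card (A \<union> B)" unfolding Z_def
      using AB finite_subset[OF AB(1) fV] finite_subset[OF AB(2) fV] by (intro card_Diff_subset) blast+
    moreover have "card (A \<union> B) \<le> card V" using AB fV by (intro card_mono) auto
    ultimately have Z: "real (card Z) = n - real (card (A \<union> B))" by (simp add: n_def of_nat_diff)
    then have Z6: "real (card Z) \<le> 6 * \<epsilon> * n" using uv(2) l0 AB(4) by simp
    have "\<epsilon> / (3 * real D) * real (tdeg V E u + tdeg V E v) \<le> 6 * \<epsilon> * n" using uv(2) Z AB(4) by simp
    then have "\<epsilon> * real (tdeg V E u + tdeg V E v) \<le> \<epsilon> * (18 * real D * n)" using D by (simp add: field_simps)
    then have td: "real (tdeg V E u + tdeg V E v) \<le> 18 * real D * n" using \<epsilon> mult_le_cancel_left_pos by blast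
    have fE: "finite E" using graph_on_finite[OF g fV] .
    define Q where "Q = {p \<in> A \<times> B. {fst p, snd p} \<in> E}"
    have "finite A" "finite B" using finite_subset[OF AB(1) fV] finite_subset[OF AB(2) fV] .
    then have fQ: "finite Q" unfolding Q_def by auto
    have "E \<subseteq> {e \<in> E. e \<subseteq> nb E u} \<union> {e \<in> E. e \<subseteq> nb E v} \<union> {e \<in> E. e \<inter> Z \<noteq> {}} \<union> (\<lambda>p. {fst p, snd p}) ` Q"
    proof
      fix e assume e: "e \<in> E"
      then obtain x y where xy: "e = {x, y}" "x \<in> V" "y \<in> V" using graph_on_edge[OF g] by blast
      show "e \<in> {e \<in> E. e \<subseteq> nb E u} \<union> {e \<in> E. e \<subseteq> nb E v} \<union> {e \<in> E. e \<inter> Z \<noteq> {}} \<union> (\<lambda>p. {fst p, snd p}) ` Q"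
      proof (cases "x \<in> Z \<or> y \<in> Z")
        case False
        then have "x \<in> A \<union> B" "y \<in> A \<union> B" using xy by (auto simp: Z_def)
        then consider "x \<in> A \<and> y \<in> A" | "x \<in> B \<and> y \<in> B" | "x \<in> A \<and> y \<in> B" | "y \<in> A \<and> x \<in> B" by blast
        then show ?thesis
        proof cases
          case 3
          then have "(x, y) \<in> Q" using e xy by (auto simp: Q_def)
          then show ?thesis using xy by (force simp: image_iff)
        next
          case 4
          then have "(y, x) \<in> Q" using e xy by (auto simp: Q_def insert_commute)
          then show ?thesis using xy by (force simp: image_iff insert_commute)
        qed (use e xy in \<open>auto simp: A_def B_def\<close>)
      qed (use e xy in auto)
    qed
    then have "card E \<le> card ({e \<in> E. e \<subseteq> nb E u} \<union> {e \<in> E. e \<subseteq> nb E v} \<union> {e \<in> E. e \<inter> Z \<noteq> {}} \<union> (\<lambda>p. {fst p, snd p}) ` Q)"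
      using fE fQ by (intro card_mono) auto
    also have "\<dots> \<le> card {e \<in> E. e \<subseteq> nb E u} + card {e \<in> E. e \<subseteq> nb E v} + card {e \<in> E. e \<inter> Z \<noteq> {}} + card ((\<lambda>p. {fst p, snd p}) ` Q)"
      by (intro order.trans[OF card_Un_le] add_right_mono order.refl)
    also have "\<dots> \<le> tdeg V E u + tdeg V E v + card Z * card V + card Q"
      using edges_in_neighbourhood[OF g fV] edges_touching[OF g fV, of Z] card_image_le[OF fQ]
      by (intro add_mono) (auto simp: Z_def)
    finally have "real (card E) \<le> real (tdeg V E u + tdeg V E v) + real (card Z) * n + real (card Q)"
      unfolding n_def by (metis (mono_tags, lifting) of_nat_add of_nat_le_iff of_nat_mult)
    moreover have "real (card Z) * n \<le> 6 * \<epsilon> * n * n" using Z6 by (intro mult_right_mono) (auto simp: n_def)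
    moreover have "18 * real D * n \<le> \<epsilon> * n\<^sup>2" using N2[of "card V"] nN by (simp add: n_def)
    ultimately have "n\<^sup>2 / 4 - 8 * \<epsilon> * n\<^sup>2 \<le> real (card Q)"
      using e td by (simp add: n_def power2_eq_square)
    then show "\<exists>A B. A \<subseteq> V \<and> B \<subseteq> V \<and> A \<inter> B = {} \<and>
      (real (card V))\<^sup>2 / 4 - 8 * \<epsilon> * (real (card V))\<^sup>2 \<le> real (card {p \<in> A \<times> B. {fst p, snd p} \<in> E})"
      using AB by (intro exI[of _ A] exI[of _ B]) (auto simp: n_def Q_def)
  qed
qed

text \<open>Markov's inequality: at most \<open>\<kappa>\<^sup>2 * n\<^sup>2\<close> missing pairs
  cannot give more than \<open>\<kappa> * n\<close> vertices with more than
  \<open>\<kappa> * n\<close> missing partners each.\<close>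

lemma few_bad_vertices:
  assumes fA: "finite A" "finite B" and k: "0 < \<kappa>" "0 < n"
    and p: "real (card A) * real (card B) - \<kappa>\<^sup>2 * n\<^sup>2 \<le> real (card {p \<in> A \<times> B. P (fst p) (snd p)})"
  shows "real (card {a \<in> A. \<kappa> * n < real (card {b \<in> B. \<not> P a b})}) \<le> \<kappa> * n"
proof -
  define X where "X = {a \<in> A. \<kappa> * n < real (card {b \<in> B. \<not> P a b})}"
  have "A \<times> B \<inter> {p. P (fst p) (snd p)} = {p \<in> A \<times> B. P (fst p) (snd p)}"
    "A \<times> B - {p. P (fst p) (snd p)} = {p \<in> A \<times> B. \<not> P (fst p) (snd p)}" by auto
  then have "card (A \<times> B) = card {p \<in> A \<times> B. P (fst p) (snd p)} + card {p \<in> A \<times> B. \<not> P (fst p) (snd p)}"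
    using card_Int_Diff[of "A \<times> B" "{p. P (fst p) (snd p)}"] fA by simp
  then have "real (card A) * real (card B) = real (card {p \<in> A \<times> B. P (fst p) (snd p)}) + real (card {p \<in> A \<times> B. \<not> P (fst p) (snd p)})"
    using of_nat_mult[of "card A" "card B", where ?'a = real] by (simp only: card_cartesian_product of_nat_add)
  then have "real (card {p \<in> A \<times> B. \<not> P (fst p) (snd p)}) \<le> \<kappa>\<^sup>2 * n\<^sup>2" using p by linarith
  moreover have "{p \<in> A \<times> B. \<not> P (fst p) (snd p)} = Sigma A (\<lambda>a. {b \<in> B. \<not> P a b})" by auto
  then have "card {p \<in> A \<times> B. \<not> P (fst p) (snd p)} = (\<Sum>a\<in>A. card {b \<in> B. \<not> P a b})" using fA by simp
  ultimately have "real (\<Sum>a\<in>A. card {b \<in> B. \<not> P a b}) \<le> \<kappa>\<^sup>2 * n\<^sup>2" by simp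
  moreover have "real (card X) * (\<kappa> * n) \<le> real (\<Sum>a\<in>A. card {b \<in> B. \<not> P a b})"
  proof -
    have "real (card X) * (\<kappa> * n) = (\<Sum>a\<in>X. \<kappa> * n)" by simp
    also have "\<dots> \<le> (\<Sum>a\<in>X. real (card {b \<in> B. \<not> P a b}))" by (intro sum_mono) (auto simp: X_def)
    also have "\<dots> \<le> (\<Sum>a\<in>A. real (card {b \<in> B. \<not> P a b}))" using fA by (intro sum_mono2) (auto simp: X_def)
    finally show ?thesis by simp
  qed
  ultimately have "real (card X) * (\<kappa> * n) \<le> (\<kappa> * n) * (\<kappa> * n)" by (simp add: power2_eq_square algebra_simps)
  then have "real (card X) \<le> \<kappa> * n" using k by (simp only: mult_le_cancel_right_pos mult_pos_pos)
  then show ?thesis by (simp add: X_def)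
qed

lemma typical_core:
  assumes fV: "finite V" and n: "n = real (card V)" "0 < n" and k: "0 < \<kappa>"
    and AB: "A \<subseteq> V" "B \<subseteq> V" "A \<inter> B = {}"
    and p: "n\<^sup>2 / 4 - \<kappa>\<^sup>2 * n\<^sup>2 \<le> real (card {p \<in> A \<times> B. P (fst p) (snd p)})"
  obtains A1 B1 where "A1 \<subseteq> A" "B1 \<subseteq> B" "n / 2 - 2 * \<kappa> * n \<le> real (card A1)" "n / 2 - 2 * \<kappa> * n \<le> real (card B1)"
    "\<And>a. a \<in> A1 \<Longrightarrow> real (card {b \<in> B1. \<not> P a b}) \<le> \<kappa> * n"
    "\<And>b. b \<in> B1 \<Longrightarrow> real (card {a \<in> A1. \<not> P a b}) \<le> \<kappa> * n"
proof -
  have fin: "finite A" "finite B" using finite_subset[OF AB(1) fV] finite_subset[OF AB(2) fV] .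
  define a where "a = real (card A)"
  define b where "b = real (card B)"
  have "card A + card B \<le> card V" using card_Un_disjoint[OF fin AB(3)] card_mono[OF fV, of "A \<union> B"] AB by auto
  then have ab: "a + b \<le> n" unfolding a_def b_def n(1) by linarith
  have ab0: "0 \<le> a" "0 \<le> b" by (auto simp: a_def b_def)
  have am: "(a + b)\<^sup>2 \<le> n\<^sup>2" using ab ab0 by (intro power_mono) auto
  have "card {p \<in> A \<times> B. P (fst p) (snd p)} \<le> card (A \<times> B)" using fin by (intro card_mono) auto
  then have "real (card {p \<in> A \<times> B. P (fst p) (snd p)}) \<le> a * b" unfolding a_def b_def
    by (simp only: card_cartesian_product of_nat_le_iff of_nat_mult[symmetric])
  then have pab: "n\<^sup>2 / 4 - \<kappa>\<^sup>2 * n\<^sup>2 \<le> a * b" using p by linarith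
  \<comment> \<open>A product this close to its maximum forces both factors close to
    \<open>n / 2\<close>: a deviation \<open>d\<close> costs \<open>d^2\<close>.\<close>
  have bal: "n / 2 - \<kappa> * n \<le> x" if "x + y \<le> n" "0 \<le> x" "0 \<le> y" "n\<^sup>2 / 4 - \<kappa>\<^sup>2 * n\<^sup>2 \<le> x * y" for x y :: real
  proof (rule ccontr)
    assume "\<not> n / 2 - \<kappa> * n \<le> x"
    then have "\<kappa> * n < n / 2 - x" by simp
    then have "(\<kappa> * n)\<^sup>2 < (n / 2 - x)\<^sup>2" using k n(2) by (intro power_strict_mono) auto
    moreover have "x * y \<le> x * (n - x)" using that by (intro mult_left_mono) auto
    ultimately show False using that(4) by (simp add: power2_eq_square algebra_simps)
  qed
  have A0: "n / 2 - \<kappa> * n \<le> a" "n / 2 - \<kappa> * n \<le> b" using bal[of a b] bal[of b a] ab ab0 pab by (auto simp: mult.commute add.commute)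
  define XA where "XA = {a \<in> A. \<kappa> * n < real (card {b \<in> B. \<not> P a b})}"
  define XB where "XB = {b \<in> B. \<kappa> * n < real (card {a \<in> A. \<not> P a b})}"
  have "a * b - \<kappa>\<^sup>2 * n\<^sup>2 \<le> real (card {p \<in> A \<times> B. P (fst p) (snd p)})"
  proof -
    have "4 * (a * b) \<le> (a + b)\<^sup>2" using zero_le_power2[of "a - b"] by (simp add: power2_eq_square algebra_simps)
    then show ?thesis using am p by linarith
  qed
  note p' = this
  have XA: "real (card XA) \<le> \<kappa> * n" unfolding XA_def
    using p' by (intro few_bad_vertices[OF fin k n(2)]) (simp add: a_def b_def)
  have sw: "card {p \<in> B \<times> A. P (snd p) (fst p)} = card {p \<in> A \<times> B. P (fst p) (snd p)}"
    by (rule bij_betw_same_card[of prod.swap]) (auto intro!: bij_betw_byWitness[of _ prod.swap])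
  have XB: "real (card XB) \<le> \<kappa> * n" unfolding XB_def
    using p' sw by (intro few_bad_vertices[OF fin(2,1) k n(2)]) (simp add: a_def b_def mult.commute)
  have c1: "n / 2 - 2 * \<kappa> * n \<le> real (card (A - XA))" "n / 2 - 2 * \<kappa> * n \<le> real (card (B - XB))"
    using A0 XA XB fin card_Diff_subset[of XA A] card_Diff_subset[of XB B] card_mono[of A XA] card_mono[of B XB]
    by (auto simp: XA_def XB_def a_def b_def of_nat_diff)
  have m: "real (card {b \<in> B - XB. \<not> P a b}) \<le> \<kappa> * n" if "a \<in> A - XA" for a
  proof -
    have "card {b \<in> B - XB. \<not> P a b} \<le> card {b \<in> B. \<not> P a b}" using fin by (intro card_mono) auto
    then show ?thesis using that by (auto simp: XA_def)
  qed
  have m': "real (card {a \<in> A - XA. \<not> P a b}) \<le> \<kappa> * n" if "b \<in> B - XB" for b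
  proof -
    have "card {a \<in> A - XA. \<not> P a b} \<le> card {a \<in> A. \<not> P a b}" using fin by (intro card_mono) auto
    then show ?thesis using that by (auto simp: XB_def)
  qed
  show thesis by (rule that[of "A - XA" "B - XB"]) (use c1 m m' in auto)
qed


section \<open>Centres shared by almost all vertices\<close>

lemma pairs_lower:
  assumes "finite A" "finite B" "\<And>a. a \<in> A \<Longrightarrow> real (card {b \<in> B. \<not> P a b}) \<le> c"
  shows "real (card A) * (real (card B) - c) \<le> real (card {p \<in> A \<times> B. P (fst p) (snd p)})"
proof -
  have "{p \<in> A \<times> B. P (fst p) (snd p)} = Sigma A (\<lambda>a. {b \<in> B. P a b})" by auto
  then have eq: "card {p \<in> A \<times> B. P (fst p) (snd p)} = (\<Sum>a\<in>A. card {b \<in> B. P a b})" using assms(1,2) by simp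
  have "real (card B) - c \<le> real (card {b \<in> B. P a b})" if "a \<in> A" for a
  proof -
    have "B \<inter> {b. P a b} = {b \<in> B. P a b}" "B - {b. P a b} = {b \<in> B. \<not> P a b}" by auto
    then have "card B = card {b \<in> B. P a b} + card {b \<in> B. \<not> P a b}"
      using card_Int_Diff[OF assms(2), of "{b. P a b}"] by simp
    then show ?thesis using assms(3)[OF that] by simp
  qed
  then have "(\<Sum>a\<in>A. real (card B) - c) \<le> (\<Sum>a\<in>A. real (card {b \<in> B. P a b}))" by (rule sum_mono)
  then show ?thesis using eq by simp
qed

text \<open>The centres of one grid serve almost all vertices. If they failed on many vertices of
  \<open>A\<close>, a second grid built on the failing vertices would have centres of its own, and
  an intermediate grid sharing one side with each of the two forces both sets of centres to
  coincide, by \<open>shared_side_cycles\<close>.\<close>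

lemma common_centres:
  assumes t: "2 \<le> t"
  shows "\<exists>\<kappa>0>0. \<forall>\<kappa>. 0 < \<kappa> \<longrightarrow> \<kappa> \<le> \<kappa>0 \<longrightarrow> (\<exists>N. \<forall>(V :: 'a set) E A B. graph_on V E \<longrightarrow> finite V \<longrightarrow> N \<le> card V \<longrightarrow>
    tight t E \<longrightarrow> free t E \<longrightarrow> A \<subseteq> V \<longrightarrow> B \<subseteq> V \<longrightarrow>
    real (card V) / 2 - 2 * \<kappa> * real (card V) \<le> real (card A) \<longrightarrow>
    real (card V) / 2 - 2 * \<kappa> * real (card V) \<le> real (card B) \<longrightarrow>
    (\<forall>a\<in>A. real (card {b \<in> B. {a, b} \<notin> E}) \<le> \<kappa> * real (card V)) \<longrightarrow>
    (\<forall>b\<in>B. real (card {a \<in> A. {b, a} \<notin> E}) \<le> \<kappa> * real (card V)) \<longrightarrow>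
    (\<exists>W. finite W \<and> card W = t \<and> real (card {a \<in> A. \<exists>w\<in>W. {w, a} \<notin> E}) \<le> \<kappa> * real (card V) \<and>
      real (card {b \<in> B. \<exists>w\<in>W. {w, b} \<notin> E}) \<le> \<kappa> * real (card V)))"
proof -
  define m where "m = 50 * t + 100"
  obtain M0 where M0: "\<forall>(V :: 'a set) E X Y. graph_on V E \<longrightarrow> finite V \<longrightarrow> tight t E \<longrightarrow>
    \<not> (lcyc E (2 * t + 1) \<and> lcyc E (2 * t + 2)) \<longrightarrow> finite X \<longrightarrow> finite Y \<longrightarrow>
    M0 \<le> card X \<longrightarrow> M0 \<le> card Y \<longrightarrow> (\<forall>x\<in>X. \<forall>y\<in>Y. {x, y} \<in> E) \<longrightarrow>
    (\<exists>X'\<subseteq>X. \<exists>Y'\<subseteq>Y. \<exists>W. card X' = m \<and> card Y' = m \<and> finite W \<and> card W = t \<and> (\<forall>w\<in>W. \<forall>x\<in>X' \<union> Y'. {w, x} \<in> E))"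
    using constant_grid[OF t, of m] by (elim exE) (rule that)
  define s where "s = M0 + m"
  obtain M1 where M1: "\<forall>(V :: 'a set) E X Y. graph_on V E \<longrightarrow> finite V \<longrightarrow> tight t E \<longrightarrow>
    \<not> (lcyc E (2 * t + 1) \<and> lcyc E (2 * t + 2)) \<longrightarrow> finite X \<longrightarrow> finite Y \<longrightarrow>
    M1 \<le> card X \<longrightarrow> M1 \<le> card Y \<longrightarrow> (\<forall>x\<in>X. \<forall>y\<in>Y. {x, y} \<in> E) \<longrightarrow>
    (\<exists>X'\<subseteq>X. \<exists>Y'\<subseteq>Y. \<exists>W. card X' = s \<and> card Y' = s \<and> finite W \<and> card W = t \<and> (\<forall>w\<in>W. \<forall>x\<in>X' \<union> Y'. {w, x} \<in> E))"
    using constant_grid[OF t, of s] by (elim exE) (rule that)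
  \<comment> \<open>The \<open>s\<close> vertices of a grid side together miss at most
    \<open>s * \<kappa> * n\<close>, hence at most \<open>n / 16\<close>, vertices of the opposite
    part.\<close>
  define \<kappa>0 where "\<kappa>0 = 1 / (16 * (real s + 1))"
  have k0: "0 < \<kappa>0" "real s * \<kappa>0 \<le> 1 / 16" "\<kappa>0 \<le> 1 / 16" by (auto simp: \<kappa>0_def field_simps)
  have *: "\<exists>N. \<forall>(V :: 'a set) E A B. graph_on V E \<longrightarrow> finite V \<longrightarrow> N \<le> card V \<longrightarrow>
    tight t E \<longrightarrow> free t E \<longrightarrow> A \<subseteq> V \<longrightarrow> B \<subseteq> V \<longrightarrow>
    real (card V) / 2 - 2 * \<kappa> * real (card V) \<le> real (card A) \<longrightarrow>
    real (card V) / 2 - 2 * \<kappa> * real (card V) \<le> real (card B) \<longrightarrow>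
    (\<forall>a\<in>A. real (card {b \<in> B. {a, b} \<notin> E}) \<le> \<kappa> * real (card V)) \<longrightarrow>
    (\<forall>b\<in>B. real (card {a \<in> A. {b, a} \<notin> E}) \<le> \<kappa> * real (card V)) \<longrightarrow>
    (\<exists>W. finite W \<and> card W = t \<and> real (card {a \<in> A. \<exists>w\<in>W. {w, a} \<notin> E}) \<le> \<kappa> * real (card V) \<and>
      real (card {b \<in> B. \<exists>w\<in>W. {w, b} \<notin> E}) \<le> \<kappa> * real (card V))"
    if k: "0 < \<kappa>" "\<kappa> \<le> \<kappa>0" for \<kappa>
  proof -
    have k4: "0 < \<kappa> / 4" using k by simp
    have "real s * \<kappa> \<le> real s * \<kappa>0" using k by (intro mult_left_mono) auto
    then have ks: "real s * \<kappa> \<le> 1 / 16" "\<kappa> \<le> 1 / 16" using k0 k by auto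
    obtain N where N: "\<forall>(A :: 'a set) (B :: 'a set) P n. finite A \<longrightarrow> finite B \<longrightarrow> card A \<le> n \<longrightarrow> card B \<le> n \<longrightarrow> N \<le> n \<longrightarrow>
      \<kappa> / 4 * (real n)\<^sup>2 \<le> real (card {p \<in> A \<times> B. P (fst p) (snd p)}) \<longrightarrow>
      (\<exists>X\<subseteq>A. \<exists>Y\<subseteq>B. card X = M1 \<and> card Y = M1 \<and> (\<forall>x\<in>X. \<forall>y\<in>Y. P x y))"
      using dense_grid[OF k4, of M1] by (elim exE) (rule that)
    show ?thesis
    proof (intro exI[of _ N] allI impI)
      fix V :: "'a set" and E A0 B0
      assume g: "graph_on V E" and fV: "finite V" and nN: "N \<le> card V" and ti: "tight t E" and fr: "free t E"
        and AB: "A0 \<subseteq> V" "B0 \<subseteq> V"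
        and cA: "real (card V) / 2 - 2 * \<kappa> * real (card V) \<le> real (card A0)"
        and cB: "real (card V) / 2 - 2 * \<kappa> * real (card V) \<le> real (card B0)"
        and mA: "\<forall>a\<in>A0. real (card {b \<in> B0. {a, b} \<notin> E}) \<le> \<kappa> * real (card V)"
        and mB: "\<forall>b\<in>B0. real (card {a \<in> A0. {b, a} \<notin> E}) \<le> \<kappa> * real (card V)"
      define n where "n = real (card V)"
      have nl: "\<not> (lcyc E (2 * t + 1) \<and> lcyc E (2 * t + 2))" using fr by (simp add: free_def)
      have grid: "\<exists>X\<subseteq>A. \<exists>Y\<subseteq>B. card X = M1 \<and> card Y = M1 \<and> (\<forall>x\<in>X. \<forall>y\<in>Y. {x, y} \<in> E)"
        if "A \<subseteq> V" "B \<subseteq> V" "\<kappa> * n \<le> real (card A)" "n / 4 \<le> real (card B) - \<kappa> * n"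
          "\<And>a. a \<in> A \<Longrightarrow> real (card {b \<in> B. {a, b} \<notin> E}) \<le> \<kappa> * n" for A B
      proof -
        have fin: "finite A" "finite B" using finite_subset[OF that(1) fV] finite_subset[OF that(2) fV] .
        have "\<kappa> / 4 * n\<^sup>2 = (\<kappa> * n) * (n / 4)" by (simp add: power2_eq_square)
        also have "\<dots> \<le> real (card A) * (real (card B) - \<kappa> * n)"
          using that(3,4) k by (intro mult_mono) (auto simp: n_def)
        also have "\<dots> \<le> real (card {p \<in> A \<times> B. {fst p, snd p} \<in> E})"
          using that(5) by (intro pairs_lower[OF fin]) auto
        finally show ?thesis
          using N[rule_format, OF fin card_mono[OF fV that(1)] card_mono[OF fV that(2)] nN, of "\<lambda>a b. {a, b} \<in> E"]
          by (simp add: n_def)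
      qed
      have sgrid: "\<exists>X'\<subseteq>X. \<exists>Y'\<subseteq>Y. \<exists>W. card X' = s \<and> card Y' = s \<and> finite W \<and> card W = t \<and> (\<forall>w\<in>W. \<forall>x\<in>X' \<union> Y'. {w, x} \<in> E)"
        if XY: "X \<subseteq> V" "Y \<subseteq> V" "card X = M1" "card Y = M1" "\<forall>x\<in>X. \<forall>y\<in>Y. {x, y} \<in> E" for X Y
        using M1[rule_format, OF g fV ti nl finite_subset[OF XY(1) fV] finite_subset[OF XY(2) fV]] XY by auto
      have uniq: "W = W'" if "finite W" "card W = t" "finite W'" "card W' = t"
        "\<forall>x\<in>X. \<forall>y\<in>Y. {x, y} \<in> E" "\<forall>x\<in>X. \<forall>y\<in>Y'. {x, y} \<in> E"
        "\<forall>w\<in>W. \<forall>x\<in>X \<union> Y. {w, x} \<in> E" "\<forall>w\<in>W'. \<forall>x\<in>X \<union> Y'. {w, x} \<in> E"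
        "m \<le> card X" "m \<le> card Y" "m \<le> card Y'" for W W' X Y Y'
        using shared_side_cycles[OF g fV t that(1-4) _ that(5-8)] that(9-11) nl unfolding m_def by blast
      have bad: "real (card {a \<in> A. \<exists>w\<in>W. {w, a} \<notin> E}) \<le> \<kappa> * n"
        if A: "A \<subseteq> V" and B: "B \<subseteq> V" and cB: "n / 2 - 2 * \<kappa> * n \<le> real (card B)"
          and mA: "\<forall>a\<in>A. real (card {b \<in> B. {a, b} \<notin> E}) \<le> \<kappa> * n"
          and X0: "X0 \<subseteq> A" "card X0 = s" and Y0: "Y0 \<subseteq> B" "card Y0 = s" and e0: "\<forall>x\<in>X0. \<forall>y\<in>Y0. {x, y} \<in> E"
          and W: "finite W" "card W = t" "\<forall>w\<in>W. \<forall>x\<in>X0 \<union> Y0. {w, x} \<in> E" for A B X0 Y0 W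
      proof (rule ccontr)
        assume no: "\<not> ?thesis"
        define Xb where "Xb = {a \<in> A. \<exists>w\<in>W. {w, a} \<notin> E}"
        \<comment> \<open>The second grid takes its other side from the vertices joined to all of
          \<open>X0\<close>; this makes \<open>X0\<close> and \<open>Y2\<close> a grid as well, the
          intermediate one.\<close>
        define B2 where "B2 = {b \<in> B. \<forall>x\<in>X0. {x, b} \<in> E}"
        have fB: "finite B" using finite_subset[OF B fV] .
        have fX0: "finite X0" using finite_subset[OF X0(1) finite_subset[OF A fV]] .
        have "B \<subseteq> B2 \<union> (\<Union>x\<in>X0. {b \<in> B. {x, b} \<notin> E})" by (auto simp: B2_def)
        then have "card B \<le> card (B2 \<union> (\<Union>x\<in>X0. {b \<in> B. {x, b} \<notin> E}))"
          using fB fX0 by (intro card_mono) (auto simp: B2_def)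
        also have "\<dots> \<le> card B2 + (\<Sum>x\<in>X0. card {b \<in> B. {x, b} \<notin> E})"
          using card_UN_le[OF fX0, of "\<lambda>x. {b \<in> B. {x, b} \<notin> E}"] by (intro order.trans[OF card_Un_le]) auto
        finally have "real (card B) \<le> real (card B2 + (\<Sum>x\<in>X0. card {b \<in> B. {x, b} \<notin> E}))"
          by (simp only: of_nat_le_iff)
        then have "real (card B) \<le> real (card B2) + (\<Sum>x\<in>X0. real (card {b \<in> B. {x, b} \<notin> E}))" by simp
        also have "(\<Sum>x\<in>X0. real (card {b \<in> B. {x, b} \<notin> E})) \<le> (\<Sum>x\<in>X0. \<kappa> * n)"
          using mA X0 by (intro sum_mono) auto
        also have "\<dots> = (real s * \<kappa>) * n" using X0(2) by simp
        also have "\<dots> \<le> 1 / 16 * n" using ks by (intro mult_right_mono) (auto simp: n_def)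
        finally have "real (card B) \<le> real (card B2) + n / 16" by simp
        moreover have kn: "\<kappa> * n \<le> n / 16" using ks mult_right_mono[of \<kappa> "1 / 16" n] by (simp add: n_def)
        ultimately have B2: "n / 4 \<le> real (card B2) - \<kappa> * n" using cB by linarith
        have m2: "real (card {b \<in> B2. {a, b} \<notin> E}) \<le> \<kappa> * n" if "a \<in> Xb" for a
        proof -
          have "card {b \<in> B2. {a, b} \<notin> E} \<le> card {b \<in> B. {a, b} \<notin> E}" using fB by (intro card_mono) (auto simp: B2_def)
          moreover have "real (card {b \<in> B. {a, b} \<notin> E}) \<le> \<kappa> * n" using mA that by (auto simp: Xb_def)
          ultimately show ?thesis by linarith
        qed
        have sub: "Xb \<subseteq> V" "B2 \<subseteq> V" using A B by (auto simp: Xb_def B2_def)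
        have cXb: "\<kappa> * n \<le> real (card Xb)" using no by (simp add: Xb_def)
        obtain X1 Y1 where 1: "X1 \<subseteq> Xb" "Y1 \<subseteq> B2" "card X1 = M1" "card Y1 = M1" "\<forall>x\<in>X1. \<forall>y\<in>Y1. {x, y} \<in> E"
          using grid[OF sub cXb B2 m2] by blast
        have "X1 \<subseteq> V" "Y1 \<subseteq> V" using 1(1,2) sub by auto
        then obtain X2 Y2 W2 where 2: "X2 \<subseteq> X1" "Y2 \<subseteq> Y1" "card X2 = s" "card Y2 = s" "finite W2" "card W2 = t"
          "\<forall>w\<in>W2. \<forall>x\<in>X2 \<union> Y2. {w, x} \<in> E" using sgrid[of X1 Y1] 1(3-5) by blast
        have XY: "\<forall>x\<in>X0. \<forall>y\<in>Y2. {x, y} \<in> E" using 1(2) 2(2) by (auto simp: B2_def)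
        have fY2: "finite Y2" using 2(2) 1(2) fB finite_subset[of Y2 B] by (auto simp: B2_def)
        have "M0 \<le> card X0" "M0 \<le> card Y2" using X0 2 by (auto simp: s_def)
        then obtain X3 Y3 W3 where 3: "X3 \<subseteq> X0" "Y3 \<subseteq> Y2" "card X3 = m" "card Y3 = m" "finite W3" "card W3 = t"
          "\<forall>w\<in>W3. \<forall>x\<in>X3 \<union> Y3. {w, x} \<in> E"
          using M0[rule_format, OF g fV ti nl fX0 fY2] XY by blast
        have "W3 = W"
        proof (rule uniq[OF 3(5,6) W(1,2), of X3 Y3 Y0])
          show "\<forall>x\<in>X3. \<forall>y\<in>Y3. {x, y} \<in> E" using XY 3(1,2) by blast
          show "\<forall>x\<in>X3. \<forall>y\<in>Y0. {x, y} \<in> E" using e0 3(1) by blast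
          show "\<forall>w\<in>W. \<forall>x\<in>X3 \<union> Y0. {w, x} \<in> E" using W(3) 3(1) by blast
        qed (use 3 Y0 in \<open>auto simp: s_def\<close>)
        \<comment> \<open>Here the shared side is \<open>Y3\<close>, so the roles of the two sides
          are exchanged. The contradiction is that \<open>W2\<close> is joined to vertices on which
          \<open>W\<close> fails.\<close>
        moreover have "W3 = W2"
        proof (rule uniq[OF 3(5,6) 2(5,6), of Y3 X3 X2])
          show "\<forall>x\<in>Y3. \<forall>y\<in>X3. {x, y} \<in> E" using XY 3(1,2) by (metis insert_commute subsetD)
          show "\<forall>x\<in>Y3. \<forall>y\<in>X2. {x, y} \<in> E" using 1(5) 2(1,2) 3(2) by (metis insert_commute subsetD)
          show "\<forall>w\<in>W2. \<forall>x\<in>Y3 \<union> X2. {w, x} \<in> E" using 2(7) 3(2) by blast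
          show "\<forall>w\<in>W3. \<forall>x\<in>Y3 \<union> X3. {w, x} \<in> E" using 3(7) by blast
        qed (use 3 2 in \<open>auto simp: s_def\<close>)
        moreover have "card X2 \<noteq> 0" using 2 by (simp add: s_def m_def)
        then obtain x where "x \<in> X2" by fastforce
        ultimately show False using 2(7) 2(1) 1(1) by (auto simp: Xb_def)
      qed
      have ABn: "n / 2 - 2 * \<kappa> * n \<le> real (card A0)" "n / 2 - 2 * \<kappa> * n \<le> real (card B0)"
        and mn: "\<forall>a\<in>A0. real (card {b \<in> B0. {a, b} \<notin> E}) \<le> \<kappa> * n" "\<forall>b\<in>B0. real (card {a \<in> A0. {b, a} \<notin> E}) \<le> \<kappa> * n"
        using cA cB mA mB by (auto simp: n_def)
      have kn: "\<kappa> * n \<le> n / 16" "0 \<le> n" using ks mult_right_mono[of \<kappa> "1 / 16" n] by (auto simp: n_def)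
      have "\<kappa> * n \<le> real (card A0)" "n / 4 \<le> real (card B0) - \<kappa> * n" using ABn kn by linarith+
      then obtain X1 Y1 where 1: "X1 \<subseteq> A0" "Y1 \<subseteq> B0" "card X1 = M1" "card Y1 = M1" "\<forall>x\<in>X1. \<forall>y\<in>Y1. {x, y} \<in> E"
        using grid[OF AB] mn(1) by blast
      have "X1 \<subseteq> V" "Y1 \<subseteq> V" using 1(1,2) AB by auto
      then obtain X0 Y0 W where 0: "X0 \<subseteq> X1" "Y0 \<subseteq> Y1" "card X0 = s" "card Y0 = s" "finite W" "card W = t"
        "\<forall>w\<in>W. \<forall>x\<in>X0 \<union> Y0. {w, x} \<in> E" using sgrid[of X1 Y1] 1(3-5) by blast
      have sub: "X0 \<subseteq> A0" "Y0 \<subseteq> B0" using 0 1 by auto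
      have e0: "\<forall>x\<in>X0. \<forall>y\<in>Y0. {x, y} \<in> E" "\<forall>y\<in>Y0. \<forall>x\<in>X0. {y, x} \<in> E" using 1(5) 0(1,2) by (metis insert_commute subsetD)+
      have W': "\<forall>w\<in>W. \<forall>x\<in>Y0 \<union> X0. {w, x} \<in> E" using 0(7) by blast
      have "real (card {a \<in> A0. \<exists>w\<in>W. {w, a} \<notin> E}) \<le> \<kappa> * n"
        by (rule bad[OF AB ABn(2) mn(1) sub(1) 0(3) sub(2) 0(4) e0(1) 0(5,6,7)])
      moreover have "real (card {b \<in> B0. \<exists>w\<in>W. {w, b} \<notin> E}) \<le> \<kappa> * n"
        by (rule bad[OF AB(2,1) ABn(1) mn(2) sub(2) 0(4) sub(1) 0(3) e0(2) 0(5,6) W'])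
      ultimately show "\<exists>W. finite W \<and> card W = t \<and> real (card {a \<in> A0. \<exists>w\<in>W. {w, a} \<notin> E}) \<le> \<kappa> * real (card V) \<and>
        real (card {b \<in> B0. \<exists>w\<in>W. {w, b} \<notin> E}) \<le> \<kappa> * real (card V)"
        using 0(5,6) by (auto simp: n_def)
    qed
  qed
  show ?thesis using k0(1) * by blast
qed

text \<open>The vertices missing some of the common centres are removed from the typical core. The
  structure is found in the tight subgraph, but what is kept of it consists of lower bounds and
  adjacencies, which pass to \<open>E\<close>.\<close>

lemma near_extremal_structure:
  assumes t: "2 \<le> t" and \<beta>: "0 < (\<beta>::real)"
  shows "\<exists>N. \<forall>(V :: 'a set) E. graph_on V E \<longrightarrow> finite V \<longrightarrow> N \<le> card V \<longrightarrow> free t E \<longrightarrow>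
    real t * (real (card V))\<^sup>2 / 4 - c * real (card V) \<le> real (card (triangles V E)) \<longrightarrow>
    (\<exists>W A B. finite W \<and> card W = t \<and> A \<subseteq> V \<and> B \<subseteq> V \<and> A \<inter> B = {} \<and>
      real (card V) / 2 - \<beta> * real (card V) \<le> real (card A) \<and> real (card V) / 2 - \<beta> * real (card V) \<le> real (card B) \<and>
      (\<forall>w\<in>W. \<forall>x\<in>A \<union> B. {w, x} \<in> E) \<and>
      (\<forall>a\<in>A. real (card V) / 2 - \<beta> * real (card V) \<le> real (card (nb E a \<inter> B))) \<and>
      (\<forall>b\<in>B. real (card V) / 2 - \<beta> * real (card V) \<le> real (card (nb E b \<inter> A))))"
proof -
  obtain \<kappa>0 where k0: "0 < \<kappa>0" and K: "\<forall>\<kappa>. 0 < \<kappa> \<longrightarrow> \<kappa> \<le> \<kappa>0 \<longrightarrow> (\<exists>N. \<forall>(V :: 'a set) E A B. graph_on V E \<longrightarrow> finite V \<longrightarrow> N \<le> card V \<longrightarrow>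
    tight t E \<longrightarrow> free t E \<longrightarrow> A \<subseteq> V \<longrightarrow> B \<subseteq> V \<longrightarrow>
    real (card V) / 2 - 2 * \<kappa> * real (card V) \<le> real (card A) \<longrightarrow>
    real (card V) / 2 - 2 * \<kappa> * real (card V) \<le> real (card B) \<longrightarrow>
    (\<forall>a\<in>A. real (card {b \<in> B. {a, b} \<notin> E}) \<le> \<kappa> * real (card V)) \<longrightarrow>
    (\<forall>b\<in>B. real (card {a \<in> A. {b, a} \<notin> E}) \<le> \<kappa> * real (card V)) \<longrightarrow>
    (\<exists>W. finite W \<and> card W = t \<and> real (card {a \<in> A. \<exists>w\<in>W. {w, a} \<notin> E}) \<le> \<kappa> * real (card V) \<and>
      real (card {b \<in> B. \<exists>w\<in>W. {w, b} \<notin> E}) \<le> \<kappa> * real (card V)))"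
    using common_centres[OF t] by (elim exE conjE) (rule that)
  \<comment> \<open>A part loses \<open>2 * \<kappa> * n\<close> in passing to the typical core and
    \<open>\<kappa> * n\<close> for vertices that miss a centre; a single vertex misses another
    \<open>\<kappa> * n\<close> of it. This is why \<open>4 * \<kappa>\<close> has to stay below
    \<open>\<beta>\<close>.\<close>
  define \<kappa> where "\<kappa> = min (\<kappa>0 / 2) (min (\<beta> / 4) (1 / 2))"
  have k: "0 < \<kappa>" "\<kappa> \<le> \<kappa>0" "4 * \<kappa> \<le> \<beta>" "\<kappa> \<le> 1 / 2" using k0 \<beta> by (auto simp: \<kappa>_def)
  obtain N1 where N1: "\<forall>(V :: 'a set) E A B. graph_on V E \<longrightarrow> finite V \<longrightarrow> N1 \<le> card V \<longrightarrow>
    tight t E \<longrightarrow> free t E \<longrightarrow> A \<subseteq> V \<longrightarrow> B \<subseteq> V \<longrightarrow>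
    real (card V) / 2 - 2 * \<kappa> * real (card V) \<le> real (card A) \<longrightarrow>
    real (card V) / 2 - 2 * \<kappa> * real (card V) \<le> real (card B) \<longrightarrow>
    (\<forall>a\<in>A. real (card {b \<in> B. {a, b} \<notin> E}) \<le> \<kappa> * real (card V)) \<longrightarrow>
    (\<forall>b\<in>B. real (card {a \<in> A. {b, a} \<notin> E}) \<le> \<kappa> * real (card V)) \<longrightarrow>
    (\<exists>W. finite W \<and> card W = t \<and> real (card {a \<in> A. \<exists>w\<in>W. {w, a} \<notin> E}) \<le> \<kappa> * real (card V) \<and>
      real (card {b \<in> B. \<exists>w\<in>W. {w, b} \<notin> E}) \<le> \<kappa> * real (card V))"
    using K[rule_format, OF k(1,2)] by (elim exE) (rule that)
  \<comment> \<open>\<open>bipartite_core\<close> loses \<open>8 * \<epsilon>\<close>, and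
    \<open>typical_core\<close> tolerates \<open>\<kappa>\<^sup>2\<close>.\<close>
  define \<epsilon> where "\<epsilon> = \<kappa>\<^sup>2 / 8"
  have "\<kappa>\<^sup>2 \<le> (1 / 2)\<^sup>2" using k by (intro power_mono) auto
  then have \<epsilon>: "0 < \<epsilon>" "\<epsilon> < 1 / 8" using k by (auto simp: \<epsilon>_def power2_eq_square)
  have D: "0 < 4 * t + 9" by simp
  obtain N2 where N2: "\<forall>(V :: 'a set) E. graph_on V E \<longrightarrow> finite V \<longrightarrow> N2 \<le> card V \<longrightarrow> free t E \<longrightarrow>
    real t * (real (card V))\<^sup>2 / 4 - c * real (card V) \<le> real (card (triangles V E)) \<longrightarrow>
    (\<exists>E'\<subseteq>E. tight t E' \<and> (real (card V))\<^sup>2 / 4 - \<epsilon> * (real (card V))\<^sup>2 \<le> real (card E'))"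
    using tight_subgraph[OF t \<epsilon>(1), of c] by (elim exE) (rule that)
  obtain N3 where N3: "\<forall>(V :: 'a set) E. graph_on V E \<longrightarrow> finite V \<longrightarrow> N3 \<le> card V \<longrightarrow> card (triangles V E) \<le> (4 * t + 9) * card E \<longrightarrow>
    (real (card V))\<^sup>2 / 4 - \<epsilon> * (real (card V))\<^sup>2 \<le> real (card E) \<longrightarrow>
    (\<exists>A B. A \<subseteq> V \<and> B \<subseteq> V \<and> A \<inter> B = {} \<and>
      (real (card V))\<^sup>2 / 4 - 8 * \<epsilon> * (real (card V))\<^sup>2 \<le> real (card {p \<in> A \<times> B. {fst p, snd p} \<in> E}))"
    using bipartite_core[OF D \<epsilon>] by (elim exE) (rule that)
  show ?thesis
  proof (intro exI[of _ "N1 + N2 + N3 + 1"] allI impI)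
    fix V :: "'a set" and E
    assume g: "graph_on V E" and fV: "finite V" and nN: "N1 + N2 + N3 + 1 \<le> card V" and fr: "free t E"
      and tr: "real t * (real (card V))\<^sup>2 / 4 - c * real (card V) \<le> real (card (triangles V E))"
    define n where "n = real (card V)"
    have n0: "0 < n" using nN by (simp add: n_def)
    have nn: "N1 \<le> card V" "N2 \<le> card V" "N3 \<le> card V" using nN by auto
    obtain E' where E': "E' \<subseteq> E" "tight t E'" "(real (card V))\<^sup>2 / 4 - \<epsilon> * (real (card V))\<^sup>2 \<le> real (card E')"
      using N2[rule_format, OF g fV nn(2) fr tr] by blast
    have g': "graph_on V E'" and fr': "free t E'" using graph_on_subset[OF g E'(1)] free_subset[OF fr E'(1)] .
    have "1 \<le> t" using t by simp
    from N3[rule_format, OF g' fV nn(3) triangles_linear[OF g' fV fr' this] E'(3)]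
    obtain A0 B0 where AB0: "A0 \<subseteq> V" "B0 \<subseteq> V" "A0 \<inter> B0 = {}"
      "(real (card V))\<^sup>2 / 4 - 8 * \<epsilon> * (real (card V))\<^sup>2 \<le> real (card {p \<in> A0 \<times> B0. {fst p, snd p} \<in> E'})" by blast
    have p: "n\<^sup>2 / 4 - \<kappa>\<^sup>2 * n\<^sup>2 \<le> real (card {p \<in> A0 \<times> B0. {fst p, snd p} \<in> E'})"
      using AB0(4) by (simp add: n_def \<epsilon>_def)
    obtain A1 B1 where AB1: "A1 \<subseteq> A0" "B1 \<subseteq> B0" "n / 2 - 2 * \<kappa> * n \<le> real (card A1)" "n / 2 - 2 * \<kappa> * n \<le> real (card B1)"
      "\<And>a. a \<in> A1 \<Longrightarrow> real (card {b \<in> B1. {a, b} \<notin> E'}) \<le> \<kappa> * n"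
      "\<And>b. b \<in> B1 \<Longrightarrow> real (card {a \<in> A1. {a, b} \<notin> E'}) \<le> \<kappa> * n"
      by (rule typical_core[OF fV n_def n0 k(1) AB0(1-3), of "\<lambda>a b. {a, b} \<in> E'", OF p]) (rule that)
    have subV: "A1 \<subseteq> V" "B1 \<subseteq> V" using AB0 AB1 by auto
    have f1: "finite A1" "finite B1" using finite_subset[OF subV(1) fV] finite_subset[OF subV(2) fV] .
    have mA: "\<forall>a\<in>A1. real (card {b \<in> B1. {a, b} \<notin> E'}) \<le> \<kappa> * n" using AB1(5) by blast
    have mB: "\<forall>b\<in>B1. real (card {a \<in> A1. {b, a} \<notin> E'}) \<le> \<kappa> * n" using AB1(6) by (simp add: insert_commute)
    obtain W where W: "finite W" "card W = t" "real (card {a \<in> A1. \<exists>w\<in>W. {w, a} \<notin> E'}) \<le> \<kappa> * n"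
      "real (card {b \<in> B1. \<exists>w\<in>W. {w, b} \<notin> E'}) \<le> \<kappa> * n"
      using N1[rule_format, OF g' fV nn(1) E'(2) fr' subV] AB1(3,4) mA mB by (auto simp: n_def)
    define A where "A = {a \<in> A1. \<forall>w\<in>W. {w, a} \<in> E'}"
    define B where "B = {b \<in> B1. \<forall>w\<in>W. {w, b} \<in> E'}"
    have split: "card S = card {x \<in> S. \<forall>w\<in>W. {w, x} \<in> E'} + card {x \<in> S. \<exists>w\<in>W. {w, x} \<notin> E'}" if "finite S" for S
    proof -
      have "S \<inter> {x. \<forall>w\<in>W. {w, x} \<in> E'} = {x \<in> S. \<forall>w\<in>W. {w, x} \<in> E'}"
        "S - {x. \<forall>w\<in>W. {w, x} \<in> E'} = {x \<in> S. \<exists>w\<in>W. {w, x} \<notin> E'}" by auto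
      then show ?thesis using card_Int_Diff[OF that, of "{x. \<forall>w\<in>W. {w, x} \<in> E'}"] by simp
    qed
    have cAB: "n / 2 - 3 * \<kappa> * n \<le> real (card A)" "n / 2 - 3 * \<kappa> * n \<le> real (card B)"
      using split[OF f1(1)] split[OF f1(2)] AB1(3,4) W(3,4) by (auto simp: A_def B_def)
    have fAB: "finite A" "finite B" using f1 by (auto simp: A_def B_def)
    have kb: "4 * \<kappa> * n \<le> \<beta> * n" "0 \<le> \<kappa> * n" using k n0 by auto
    have nbr: "n / 2 - \<beta> * n \<le> real (card (nb E x \<inter> S))"
      if S: "finite S" "n / 2 - 3 * \<kappa> * n \<le> real (card S)" "real (card {y \<in> S. {x, y} \<notin> E'}) \<le> \<kappa> * n" for x S
    proof -
      have "card S \<le> card ((nb E x \<inter> S) \<union> {y \<in> S. {x, y} \<notin> E'})"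
        using S(1) E'(1) by (intro card_mono) (auto simp: nb_def)
      also have "\<dots> \<le> card (nb E x \<inter> S) + card {y \<in> S. {x, y} \<notin> E'}" by (rule card_Un_le)
      finally show ?thesis using S(2,3) kb by linarith
    qed
    have "n / 2 - \<beta> * n \<le> real (card (nb E a \<inter> B))" if a: "a \<in> A" for a
    proof -
      have "card {y \<in> B. {a, y} \<notin> E'} \<le> card {b \<in> B1. {a, b} \<notin> E'}" using f1 by (intro card_mono) (auto simp: B_def)
      moreover have "real (card {b \<in> B1. {a, b} \<notin> E'}) \<le> \<kappa> * n" using mA a by (auto simp: A_def)
      ultimately have "real (card {y \<in> B. {a, y} \<notin> E'}) \<le> \<kappa> * n" by linarith
      then show ?thesis using nbr[OF fAB(2) cAB(2)] by blast
    qed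
    moreover have "n / 2 - \<beta> * n \<le> real (card (nb E b \<inter> A))" if b: "b \<in> B" for b
    proof -
      have "card {y \<in> A. {b, y} \<notin> E'} \<le> card {a \<in> A1. {b, a} \<notin> E'}" using f1 by (intro card_mono) (auto simp: A_def)
      moreover have "real (card {a \<in> A1. {b, a} \<notin> E'}) \<le> \<kappa> * n" using mB b by (auto simp: B_def)
      ultimately have "real (card {y \<in> A. {b, y} \<notin> E'}) \<le> \<kappa> * n" by linarith
      then show ?thesis using nbr[OF fAB(1) cAB(1)] by blast
    qed
    moreover have "n / 2 - \<beta> * n \<le> real (card A)" "n / 2 - \<beta> * n \<le> real (card B)" using cAB kb by linarith+
    moreover have "A \<subseteq> V" "B \<subseteq> V" "A \<inter> B = {}" using subV AB0(3) AB1(1,2) by (auto simp: A_def B_def)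
    moreover have "\<forall>w\<in>W. \<forall>x\<in>A \<union> B. {w, x} \<in> E" using E'(1) by (auto simp: A_def B_def)
    ultimately have "finite W \<and> card W = t \<and> A \<subseteq> V \<and> B \<subseteq> V \<and> A \<inter> B = {} \<and>
      real (card V) / 2 - \<beta> * real (card V) \<le> real (card A) \<and> real (card V) / 2 - \<beta> * real (card V) \<le> real (card B) \<and>
      (\<forall>w\<in>W. \<forall>x\<in>A \<union> B. {w, x} \<in> E) \<and>
      (\<forall>a\<in>A. real (card V) / 2 - \<beta> * real (card V) \<le> real (card (nb E a \<inter> B))) \<and>
      (\<forall>b\<in>B. real (card V) / 2 - \<beta> * real (card V) \<le> real (card (nb E b \<inter> A)))"
      using W(1,2) unfolding n_def by blast
    then show "\<exists>W A B. finite W \<and> card W = t \<and> A \<subseteq> V \<and> B \<subseteq> V \<and> A \<inter> B = {} \<and>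
      real (card V) / 2 - \<beta> * real (card V) \<le> real (card A) \<and> real (card V) / 2 - \<beta> * real (card V) \<le> real (card B) \<and>
      (\<forall>w\<in>W. \<forall>x\<in>A \<union> B. {w, x} \<in> E) \<and>
      (\<forall>a\<in>A. real (card V) / 2 - \<beta> * real (card V) \<le> real (card (nb E a \<inter> B))) \<and>
      (\<forall>b\<in>B. real (card V) / 2 - \<beta> * real (card V) \<le> real (card (nb E b \<inter> A)))"
      by (intro exI)
  qed
qed

subsection \<open>The exact count\<close>

text \<open>A vertex of degree at most one can be removed. With minimum degree two, a vertex of
  degree at least three would lie inside a path on four vertices, so all degrees are two.\<close>

lemma p4_free_edges:
  assumes "graph_on X G" "finite X"
    and "\<And>a b c d. {a, b} \<in> G \<Longrightarrow> {b, c} \<in> G \<Longrightarrow> {c, d} \<in> G \<Longrightarrow> distinct [a, b, c, d] \<Longrightarrow> False"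
  shows "card G \<le> card X"
  using assms
proof (induction "card X" arbitrary: X G rule: less_induct)
  case less
  note g = less.prems(1) and fX = less.prems(2)
  have fG: "finite G" using graph_on_finite[OF g fX] .
  show ?case
  proof (cases "\<exists>v\<in>X. card (nb G v) \<le> 1")
    case True
    then obtain v where v: "v \<in> X" "card (nb G v) \<le> 1" by blast
    define G' where "G' = {e \<in> G. v \<notin> e}"
    have g': "graph_on (X - {v}) G'" using g by (auto simp: graph_on_def G'_def)
    have c: "card (X - {v}) < card X" using v fX by (metis card_Diff1_less)
    have "card G' \<le> card (X - {v})"
      by (rule less.hyps[OF c g']) (use fX less.prems(3) in \<open>auto simp: G'_def\<close>)
    moreover have "G \<subseteq> G' \<union> (\<lambda>y. {v, y}) ` nb G v"
    proof
      fix e assume e: "e \<in> G"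
      then obtain x y where "e = {x, y}" using graph_on_edge[OF g] by blast
      then show "e \<in> G' \<union> (\<lambda>y. {v, y}) ` nb G v" using e by (auto simp: G'_def nb_def image_iff insert_commute)
    qed
    then have "card G \<le> card (G' \<union> (\<lambda>y. {v, y}) ` nb G v)"
      using fG finite_nb[OF g fX] by (intro card_mono) (auto simp: G'_def)
    then have "card G \<le> card G' + card ((\<lambda>y. {v, y}) ` nb G v)" using card_Un_le le_trans by blast
    moreover have "card ((\<lambda>y. {v, y}) ` nb G v) \<le> 1" using card_image_le[OF finite_nb[OF g fX], of "\<lambda>y. {v, y}" v] v(2) by simp
    ultimately show ?thesis using c by linarith
  next
    case False
    have "card (nb G v) \<le> 2" if v: "v \<in> X" for v
    proof (rule ccontr)
      assume big: "\<not> card (nb G v) \<le> 2"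
      then have "nb G v \<noteq> {}" by auto
      then obtain u where u: "u \<in> nb G v" by blast
      then have uv: "{v, u} \<in> G" by (simp add: nb_def)
      then have "u \<in> X" using graph_on_in[OF g] by blast
      then have "card {v} < card (nb G u)" using False by force
      then obtain x where x: "x \<in> nb G u" "x \<noteq> v" using fresh[of "{v}" "nb G u"] by auto
      have "card {u, x} < card (nb G v)" using big card_length[of "[u, x]"] by simp
      then obtain z where z: "z \<in> nb G v" "z \<notin> {u, x}" using fresh[of "{u, x}" "nb G v"] by auto
      have "{x, u} \<in> G" "{u, v} \<in> G" "{v, z} \<in> G" using x z uv by (auto simp: nb_def insert_commute)
      moreover have "x \<noteq> u" "u \<noteq> v" "v \<noteq> z" using calculation graph_on_neq[OF g] by blast+
      ultimately show False using less.prems(3)[of x u v z] x z by auto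
    qed
    then have "(\<Sum>v\<in>X. card (nb G v)) \<le> (\<Sum>v\<in>X. 2)" by (intro sum_mono) auto
    then show ?thesis using handshake[OF g fX] by simp
  qed
qed

text \<open>Two of the sets share a pair \<open>u\<close>, \<open>v\<close> and span four points. A
  set without this pair lies inside the four points, and its presence keeps all other sets inside
  them too, where there are only four triples.\<close>

lemma pairwise_two_common:
  assumes "finite F" "\<And>T. T \<in> F \<Longrightarrow> card T = 3" "\<And>T T'. T \<in> F \<Longrightarrow> T' \<in> F \<Longrightarrow> T \<noteq> T' \<Longrightarrow> card (T \<inter> T') = 2"
  shows "card F \<le> 4 \<or> (\<exists>u v. u \<noteq> v \<and> (\<forall>T\<in>F. {u, v} \<subseteq> T))"
proof (cases "card F \<le> 4")
  case False
  have "F \<noteq> {}" using False by auto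
  then obtain T1 where T1: "T1 \<in> F" by blast
  have "card {T1} < card F" using False by simp
  then obtain T2 where T2: "T2 \<in> F" "T2 \<notin> {T1}" using fresh[of "{T1}" F] by auto
  have c2: "card (T1 \<inter> T2) = 2" using assms(3)[OF T1 T2(1)] T2(2) by auto
  then obtain u v where uv: "T1 \<inter> T2 = {u, v}" "u \<noteq> v" by (auto simp: card_2_iff)
  have fin: "finite T" if "T \<in> F" for T using assms(2)[OF that] by (auto intro: card_ge_0_finite)
  have "\<forall>T\<in>F. {u, v} \<subseteq> T"
  proof (rule ccontr)
    assume "\<not> ?thesis"
    then obtain T3 where T3: "T3 \<in> F" "\<not> {u, v} \<subseteq> T3" by blast
    define S where "S = T1 \<union> T2"
    have S4: "card S = 4" "finite S" using card_Un_Int[OF fin[OF T1] fin[OF T2(1)]] assms(2) T1 T2 c2 fin by (auto simp: S_def)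
    have in_S: "T \<subseteq> S" if T: "T \<in> F" "\<not> {u, v} \<subseteq> T" for T
    proof -
      have ne: "T \<noteq> T1" "T \<noteq> T2" using T uv by auto
      have "card ((T \<inter> T1) \<union> (T \<inter> T2)) + card ((T \<inter> T1) \<inter> (T \<inter> T2)) = card (T \<inter> T1) + card (T \<inter> T2)"
        using card_Un_Int[of "T \<inter> T1" "T \<inter> T2"] fin T1 T2 by simp
      also have "\<dots> = 4" using assms(3)[OF T(1) T1 ne(1)] assms(3)[OF T(1) T2(1) ne(2)] by simp
      finally have four: "card ((T \<inter> T1) \<union> (T \<inter> T2)) + card ((T \<inter> T1) \<inter> (T \<inter> T2)) = 4" .
      have "card (T \<inter> S) + card (T \<inter> {u, v}) = 4" 
      proof -
        have "(T \<inter> T1) \<union> (T \<inter> T2) = T \<inter> S" unfolding S_def by (rule Int_Un_distrib[symmetric])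
        moreover have "(T \<inter> T1) \<inter> (T \<inter> T2) = T \<inter> {u, v}" unfolding uv(1)[symmetric] by blast
        ultimately show ?thesis using four by simp
      qed
      moreover have "T \<inter> {u, v} \<subset> {u, v}" using T by blast
      then have "card (T \<inter> {u, v}) < card {u, v}" by (intro psubset_card_mono) auto
      then have "card (T \<inter> {u, v}) < 2" using uv(2) by simp
      ultimately have "card T \<le> card (T \<inter> S)" using assms(2)[OF T(1)] by simp
      then show "T \<subseteq> S" using card_subset_eq[of T "T \<inter> S"] fin[OF T(1)] card_mono[OF fin[OF T(1)], of "T \<inter> S"] by auto
    qed
    have "T \<subseteq> S" if T: "T \<in> F" for T
    proof (cases "{u, v} \<subseteq> T")
      case True
      show ?thesis
      proof (rule ccontr)
        assume nS: "\<not> T \<subseteq> S"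
        then have ne: "T \<noteq> T3" using in_S[OF T3] by auto
        obtain x where x: "x \<in> T" "x \<notin> S" using nS by blast
        have uS: "u \<in> S" "v \<in> S" using uv(1) by (auto simp: S_def)
        have "u \<noteq> x" "v \<noteq> x" using uS x by blast+
        then have "card {u, v, x} = 3" using uv(2) by simp
        then have T: "T = {u, v, x}" using card_subset_eq[OF fin[OF T], of "{u, v, x}"] True x assms(2)[OF T] by auto
        have "T \<inter> T3 = {u, v} \<inter> T3" using T x in_S[OF T3] by auto
        moreover have "{u, v} \<inter> T3 \<subset> {u, v}" using T3 by blast
        then have "card ({u, v} \<inter> T3) < card {u, v}" by (intro psubset_card_mono) auto
        ultimately show False using assms(3)[OF that T3(1) ne] uv(2) by simp
      qed
    qed (rule in_S[OF T])
    then have "F \<subseteq> {T. T \<subseteq> S \<and> card T = 3}" using assms(2) by auto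
    then have "card F \<le> card {T. T \<subseteq> S \<and> card T = 3}" using S4 by (intro card_mono) auto
    also have "\<dots> = 4" using n_subsets[OF S4(2), of 3] S4 by (simp add: numeral_eq_Suc)
    finally show False using False by simp
  qed
  then show ?thesis using uv(2) by blast
qed simp

section \<open>The near-extremal configuration\<close>

text \<open>The degree threshold is \<open>1 / 3\<close> in place of nearly \<open>1 / 2\<close>, so
  that \<open>A\<close> and \<open>B\<close> can be taken maximal. It is above \<open>1 / 4\<close>,
  which gives vertices of the same part many common neighbours, and well below \<open>1 / 2\<close>,
  which makes a vertex that is joined to all of \<open>W\<close> but fits into no part poor in
  triangles. The \<open>2000 * t\<close> makes \<open>t\<close> times the number of leftover
  vertices at most \<open>n / 1000\<close>.\<close>

locale near_extremal =
  fixes V :: "'a set" and E :: "'a set set" and t :: nat and W A B :: "'a set"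
  assumes g: "graph_on V E" and fV: "finite V" and t: "2 \<le> t"
    and W: "finite W" "card W = t" and A: "A \<subseteq> V" and B: "B \<subseteq> V" and AB: "A \<inter> B = {}"
    and size: "real (card V) / 2 - real (card V) / (2000 * real t) \<le> real (card A)"
      "real (card V) / 2 - real (card V) / (2000 * real t) \<le> real (card B)"
    and WAB: "w \<in> W \<Longrightarrow> x \<in> A \<union> B \<Longrightarrow> {w, x} \<in> E"
    and nA: "a \<in> A \<Longrightarrow> real (card V) / 3 \<le> real (card (nb E a \<inter> B))"
    and nB: "b \<in> B \<Longrightarrow> real (card V) / 3 \<le> real (card (nb E b \<inter> A))"
    and maximal: "r \<in> V - (W \<union> A \<union> B) \<Longrightarrow> W \<subseteq> nb E r \<Longrightarrow>
      real (card (nb E r \<inter> A)) < real (card V) / 3 \<and> real (card (nb E r \<inter> B)) < real (card V) / 3"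
    and big: "100000 * real t * real t \<le> real (card V)"
begin

definition "R = V - (W \<union> A \<union> B)"
definition "n = real (card V)"
text \<open>In \<open>Splus_edges\<close> the triangles without a centre are the ones on the added
  edge; \<open>T1\<close> captures their analogues here.\<close>

definition "T1 = {T \<in> triangles V E. T \<inter> W = {} \<and> 2 \<le> card (T \<inter> (A \<union> B))}"
definition "inner = {e \<in> E. e \<subseteq> A \<or> e \<subseteq> B}"

text \<open>Facts proved for \<open>A\<close> transfer to \<open>B\<close> by interpreting the
  locale with the parts exchanged.\<close>

lemma swap: "near_extremal V E t W B A"
  by unfold_locales (use g fV t W A B AB size WAB nA nB maximal big in \<open>auto simp: Un_ac Int_commute\<close>)

lemma fin: "finite A" "finite B" "finite R"
  using finite_subset[OF A fV] finite_subset[OF B fV] fV by (auto simp: R_def)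

lemma n_big: "100000 * real t * real t \<le> n" "400000 \<le> n" "200000 * real t \<le> n"
proof -
  show a: "100000 * real t * real t \<le> n" using big by (simp add: n_def)
  have "2 \<le> real t" using t by simp
  then have "2 * 2 \<le> real t * real t" "2 * real t \<le> real t * real t" by (intro mult_mono mult_right_mono; simp)+
  then show "400000 \<le> n" "200000 * real t \<le> n" using a by auto
qed

lemma small: "n / (2000 * real t) \<le> n / 4000" "0 < n / (2000 * real t)"
proof -
  show "n / (2000 * real t) \<le> n / 4000" using t n_big(2) by (intro divide_left_mono) auto
  show "0 < n / (2000 * real t)" using t n_big(2) by auto
qed

lemma notin_W: "x \<in> A \<union> B \<Longrightarrow> x \<notin> W"
  using WAB graph_on_loop[OF g, of x] by force

lemma W_sub: "W \<subseteq> V"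
proof
  fix w assume "w \<in> W"
  have "A \<noteq> {}" using size(1) small n_big(2) by (auto simp: n_def)
  then show "w \<in> V" using WAB[OF \<open>w \<in> W\<close>] graph_on_in[OF g] by blast
qed

lemma V_split: "V = W \<union> A \<union> B \<union> R" "W \<inter> (A \<union> B) = {}" "W \<inter> R = {}" "(A \<union> B) \<inter> R = {}"
  using W_sub A B notin_W by (auto simp: R_def)

lemma card_V: "card V = t + card A + card B + card R"
proof -
  have "card V = card (W \<union> (A \<union> B)) + card R"
    using V_split W fin by (subst card_Un_disjoint[symmetric]) (auto simp: Un_assoc)
  also have "card (W \<union> (A \<union> B)) = card W + card (A \<union> B)" using V_split W fin by (intro card_Un_disjoint) auto
  also have "card (A \<union> B) = card A + card B" using AB fin by (intro card_Un_disjoint)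
  finally show ?thesis using W by simp
qed

lemma size_upper: "real (card A) \<le> n / 2 + n / (2000 * real t)" "real (card B) \<le> n / 2 + n / (2000 * real t)"
  "real (card R) \<le> 2 * (n / (2000 * real t))"
proof -
  have "n = real t + real (card A) + real (card B) + real (card R)" unfolding n_def card_V by simp
  then show "real (card A) \<le> n / 2 + n / (2000 * real t)" "real (card B) \<le> n / 2 + n / (2000 * real t)"
    "real (card R) \<le> 2 * (n / (2000 * real t))" using size unfolding n_def[symmetric] by linarith+
qed

lemma A_common: "n / 7 \<le> real (card (S \<inter> nb E a \<inter> B))" if "a \<in> A" "n / 3 \<le> real (card (S \<inter> B))" for S a
proof -
  have "card (S \<inter> B) + card (nb E a \<inter> B) = card ((S \<inter> B) \<union> (nb E a \<inter> B)) + card (S \<inter> nb E a \<inter> B)"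
    using card_Un_Int[of "S \<inter> B" "nb E a \<inter> B"] fin by (simp add: Int_ac)
  moreover have "card ((S \<inter> B) \<union> (nb E a \<inter> B)) \<le> card B" using fin by (intro card_mono) auto
  ultimately have "real (card (S \<inter> B)) + real (card (nb E a \<inter> B)) \<le> real (card B) + real (card (S \<inter> nb E a \<inter> B))" by linarith
  then show ?thesis using nA[OF that(1)] that(2) size_upper(2) small n_big(2) by (simp add: n_def)
qed

lemma envW: "env E (A \<union> B) W (100 * t + 200)"
  unfolding env_def
proof (intro conjI ballI)
  have n3: "real (100 * t + 200) \<le> n / 3" using n_big by simp
  have "real (100 * t + 200) \<le> real (card A)" using size(1) small n_big by (simp add: n_def)
  moreover have "card A \<le> card (A \<union> B)" using fin by (intro card_mono) auto
  ultimately show "100 * t + 200 \<le> card (A \<union> B)" by linarith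
  fix w x assume w: "w \<in> W" and x: "x \<in> A \<union> B"
  show "{w, x} \<in> E" using WAB w x .
  have "real (100 * t + 200) \<le> real (card (cn E w x))"
  proof (cases "x \<in> A")
    case True
    have "card (nb E x \<inter> B) \<le> card (cn E w x)"
      using WAB[OF w] by (intro card_mono finite_cn[OF g fV]) (auto simp: cn_iff nb_def)
    then show ?thesis using nA[OF True] n3 by (simp add: n_def)
  next
    case False
    then have xB: "x \<in> B" using x by simp
    have "card (nb E x \<inter> A) \<le> card (cn E w x)"
      using WAB[OF w] by (intro card_mono finite_cn[OF g fV]) (auto simp: cn_iff nb_def)
    then show ?thesis using nB[OF xB] n3 by (simp add: n_def)
  qed
  then show "100 * t + 200 \<le> card (cn E w x)" by linarith
qed

lemma close:
  assumes "p \<in> A \<union> B" "q \<in> A \<union> B" "p \<noteq> q" "lpath E p q l U" "W' \<subseteq> W" "W' \<noteq> {}" "U \<inter> W' = {}" "l \<le> 40"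
  shows "lcyc E (l + 2 * card W')"
proof (rule env_close[OF g env_subset[OF envW assms(5)] _ assms(6) assms(1-4,7)])
  show "finite W'" using assms(5) W finite_subset by blast
  have "card W' \<le> t" using card_mono[OF W(1) assms(5)] W(2) by simp
  then show "2 * l + 6 * card W' + 6 \<le> 100 * t + 200" using assms(8) by linarith
qed simp

lemma W_ne: "W \<noteq> {}" "w \<in> W \<Longrightarrow> W - {w} \<noteq> {}" "w \<in> W \<Longrightarrow> card (W - {w}) = t - 1"
proof -
  show "W \<noteq> {}" using W t by auto
  show c: "card (W - {w}) = t - 1" if "w \<in> W" using that W by simp
  show "W - {w} \<noteq> {}" if "w \<in> W" using c[OF that] t card.empty by (metis diff_is_0_eq not_less_eq_eq Suc_1 One_nat_def)
qed

lemma lcyc_W: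
  assumes "p \<in> A \<union> B" "q \<in> A \<union> B" "p \<noteq> q" "lpath E p q l U" "U \<inter> W = {}" "l \<le> 40" "k = l + 2 * t"
  shows "lcyc E k"
  using close[OF assms(1-4) order.refl W_ne(1) assms(5,6)] W assms(7) by simp

lemma lcyc_W1:
  assumes "p \<in> A \<union> B" "q \<in> A \<union> B" "p \<noteq> q" "lpath E p q l U" "w \<in> W" "U \<inter> (W - {w}) = {}" "l \<le> 40" "k + 2 = l + 2 * t"
  shows "lcyc E k"
proof -
  have "lcyc E (l + 2 * card (W - {w}))"
    by (rule close[OF assms(1-4)]) (use assms W_ne(2) in auto)
  moreover have "l + 2 * card (W - {w}) = k" using assms(8) W_ne(3)[OF assms(5)] t by simp
  ultimately show ?thesis by simp
qed

section \<open>Triangles that avoid the centres\<close>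

text \<open>Such a triangle is itself a starting path of length 1.\<close>

lemma light_triangle_odd:
  assumes "p \<in> A \<union> B" "q \<in> A \<union> B" "v \<notin> W" "{p, q} \<in> E" "{p, v} \<in> E" "{q, v} \<in> E"
  shows "lcyc E (2 * t + 1)"
  by (rule lcyc_W[OF assms(1,2) _ lpath_tri[OF g assms(4-6)]])
    (use assms notin_W graph_on_neq[OF g assms(4)] in auto)

lemma T1_D:
  assumes "T \<in> T1" "v \<in> T"
  obtains p s where "T = {v, p, s}" "p \<in> A \<union> B" "v \<noteq> p" "v \<noteq> s" "p \<noteq> s" "{v, p} \<in> E" "{v, s} \<in> E" "{p, s} \<in> E" "T \<inter> W = {}"
proof -
  have T: "T \<in> triangles V E" "T \<inter> W = {}" "2 \<le> card (T \<inter> (A \<union> B))" using assms by (auto simp: T1_def)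
  have c: "card T = 3" "finite T" using triangle_card[OF T(1)] by auto
  have "card {v} < card (T \<inter> (A \<union> B))" using T(3) by simp
  then obtain p where p: "p \<in> T" "p \<in> A \<union> B" "p \<noteq> v" using fresh[of "{v}" "T \<inter> (A \<union> B)"] by auto
  have "card (T - {v, p}) = 1" using c p assms by (simp add: card_Diff_subset)
  then obtain s where s: "T - {v, p} = {s}" by (rule card_1_singletonE)
  have "T = {v, p, s}" "v \<noteq> s" "p \<noteq> s" using s p assms by auto
  then show thesis using that[of p s] p T triangleD[OF T(1)] by auto
qed

lemma T1_odd: "\<not> lcyc E (2 * t + 1) \<Longrightarrow> T1 = {}"
proof (rule ccontr)
  assume no: "\<not> lcyc E (2 * t + 1)" "T1 \<noteq> {}"
  then obtain T where T: "T \<in> T1" by blast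
  then have "2 \<le> card (T \<inter> (A \<union> B))" by (simp add: T1_def)
  then have "T \<inter> (A \<union> B) \<noteq> {}" by auto
  then obtain v where v: "v \<in> T" "v \<in> A \<union> B" by blast
  obtain p s where ps: "T = {v, p, s}" "p \<in> A \<union> B" "v \<noteq> p" "v \<noteq> s" "p \<noteq> s" "{v, p} \<in> E" "{v, s} \<in> E" "{p, s} \<in> E" "T \<inter> W = {}"
    by (rule T1_D[OF T v(1)])
  show False using light_triangle_odd[OF v(2) ps(2) _ ps(6-8)] ps(1,9) no(1) by auto
qed

text \<open>Two triangles with one common vertex form a starting path of length 2. Disjoint ones are
  linked by a cherry through one centre to a path of length 4, which the other \<open>t - 1\<close>
  centres close.\<close>

lemma T1_even:
  assumes no: "\<not> lcyc E (2 * t + 2)" and T: "T \<in> T1" "T' \<in> T1" "T \<noteq> T'"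
  shows "card (T \<inter> T') = 2"
proof -
  have tr: "T \<in> triangles V E" "T' \<in> triangles V E" using T by (auto simp: T1_def)
  have c: "card T = 3" "finite T" "card T' = 3" "finite T'" using triangle_card[OF tr(1)] triangle_card[OF tr(2)] by auto
  have "T \<inter> T' \<subset> T" using c T(3) card_subset_eq[of T' T] by auto
  then have "card (T \<inter> T') < 3" using psubset_card_mono[OF c(2)] c(1) by metis
  moreover have "card (T \<inter> T') \<noteq> 0"
  proof
    assume "card (T \<inter> T') = 0"
    then have dis: "T \<inter> T' = {}" using c by simp
    have "T \<inter> (A \<union> B) \<noteq> {}" "T' \<inter> (A \<union> B) \<noteq> {}" using T by (auto simp: T1_def)
    then obtain v v' where v: "v \<in> T" "v \<in> A \<union> B" and v': "v' \<in> T'" "v' \<in> A \<union> B" by blast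
    obtain p s where ps: "T = {v, p, s}" "p \<in> A \<union> B" "v \<noteq> p" "v \<noteq> s" "p \<noteq> s" "{v, p} \<in> E" "{v, s} \<in> E" "{p, s} \<in> E" "T \<inter> W = {}"
      by (rule T1_D[OF T(1) v(1)])
    obtain p' s' where ps': "T' = {v', p', s'}" "p' \<in> A \<union> B" "v' \<noteq> p'" "v' \<noteq> s'" "p' \<noteq> s'" "{v', p'} \<in> E" "{v', s'} \<in> E" "{p', s'} \<in> E" "T' \<inter> W = {}"
      by (rule T1_D[OF T(2) v'(1)])
    obtain w where w: "w \<in> W" using W_ne by blast
    define F where "F = T \<union> T' \<union> (W - {w})"
    have "card F \<le> card T + card T' + card (W - {w})"
      unfolding F_def by (intro order.trans[OF card_Un_le] add_right_mono card_Un_le)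
    then have cF: "card F \<le> t + 5" "finite F" using c W_ne(3)[OF w] W t by (auto simp: F_def)
    have "env E (A \<union> B) (set [w]) (100 * t + 200)" using env_subset[OF envW, of "{w}"] w by simp
    then obtain U where U: "lpath E p v' (2 * length [w]) U" "U \<inter> F \<subseteq> {p, v'}"
      using env_conn[OF g, of "A \<union> B" "[w]" "100 * t + 200" p v' F] ps ps' v' dis w cF by (auto simp: F_def)
    have L1: "lpath E v p 1 T" using lpath_tri[OF g ps(6-8)] ps(1) by simp
    have L3: "lpath E v' p' 1 T'" using lpath_tri[OF g ps'(6-8)] ps'(1) by simp
    have pU: "p \<in> U" "v' \<in> U" using U(1) lpath_ends by fast+
    have "T \<inter> U = {p}" using U(2) pU ps dis v' by (auto simp: F_def)
    moreover have "lpath E p v' 2 U" using U(1) by simp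
    ultimately have L2: "lpath E v v' (1 + 2) (T \<union> U)" using lpath_join[OF L1] by blast
    have "(T \<union> U) \<inter> T' = {v'}" using U(2) pU ps' dis ps by (auto simp: F_def)
    then have L4: "lpath E v p' (1 + 2 + 1) (T \<union> U \<union> T')" by (rule lpath_join[OF L2 L3])
    have "lcyc E (2 * t + 2)"
    proof (rule lcyc_W1[OF v(2) ps'(2) _ L4 w])
      show "v \<noteq> p'" using dis v ps'(1) by auto
      show "(T \<union> U \<union> T') \<inter> (W - {w}) = {}"
        using ps(9) ps'(9) U(2) ps(2) v'(2) notin_W by (auto simp: F_def)
    qed auto
    then show False using no by simp
  qed
  moreover have "card (T \<inter> T') \<noteq> 1"
  proof
    assume "card (T \<inter> T') = 1"
    then obtain v where v: "T \<inter> T' = {v}" by (rule card_1_singletonE)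
    then have vT: "v \<in> T" "v \<in> T'" by auto
    obtain p s where ps: "T = {v, p, s}" "p \<in> A \<union> B" "v \<noteq> p" "v \<noteq> s" "p \<noteq> s" "{v, p} \<in> E" "{v, s} \<in> E" "{p, s} \<in> E" "T \<inter> W = {}"
      by (rule T1_D[OF T(1) vT(1)])
    obtain p' s' where ps': "T' = {v, p', s'}" "p' \<in> A \<union> B" "v \<noteq> p'" "v \<noteq> s'" "p' \<noteq> s'" "{v, p'} \<in> E" "{v, s'} \<in> E" "{p', s'} \<in> E" "T' \<inter> W = {}"
      by (rule T1_D[OF T(2) vT(2)])
    have d: "p \<noteq> p'" "p \<noteq> s'" "s \<noteq> p'" "s \<noteq> s'" using v ps(1,3,4) ps'(1,3,4) by auto
    have L: "lpath E p p' 2 {p, v, s, p', s'}"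
      using ps ps' d by (intro lpath2[OF g]) (auto simp: insert_commute)
    have "lcyc E (2 * t + 2)"
      by (rule lcyc_W[OF ps(2) ps'(2) d(1) L]) (use ps ps' in auto)
    then show False using no by simp
  qed
  ultimately show ?thesis by linarith
qed

lemma A_edge_common:
  assumes "a \<in> A" "a' \<in> A"
  shows "n / 7 \<le> real (card (cn E a a' \<inter> B))"
  using A_common[OF assms(2), of "nb E a"] nA[OF assms(1)] by (simp add: cn_def n_def)

lemma inner_common:
  assumes "{x, y} \<in> inner" "finite S" "card S \<le> 20"
  obtains z where "z \<in> A \<union> B" "z \<in> cn E x y" "z \<notin> S" "{x, y, z} \<in> T1"
proof -
  have xy: "{x, y} \<in> E" "({x, y} \<subseteq> A \<or> {x, y} \<subseteq> B)" using assms by (auto simp: inner_def)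
  have "n / 7 \<le> real (card (cn E x y \<inter> (A \<union> B)))"
  proof (cases "{x, y} \<subseteq> A")
    case True
    have "card (cn E x y \<inter> B) \<le> card (cn E x y \<inter> (A \<union> B))" using fin by (intro card_mono) auto
    then show ?thesis using A_edge_common[of x y] True by simp
  next
    case False
    interpret sw: near_extremal V E t W B A by (rule swap)
    have "card (cn E x y \<inter> A) \<le> card (cn E x y \<inter> (A \<union> B))" using fin by (intro card_mono) auto
    moreover have "x \<in> B" "y \<in> B" using False xy by auto
    then have "n / 7 \<le> real (card (cn E x y \<inter> A))" using sw.A_edge_common[of x y] by (simp add: sw.n_def n_def)
    ultimately show ?thesis by linarith
  qed
  then have "card S < card (cn E x y \<inter> (A \<union> B))" using assms(3) n_big(2) by linarith
  then obtain z where z: "z \<in> cn E x y \<inter> (A \<union> B)" "z \<notin> S" using fresh[OF assms(2)] by blast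
  have "{x, y, z} \<in> triangles V E" using z by (intro triangleI[OF g xy(1)]) (auto simp: cn_iff)
  moreover have "x \<in> A \<union> B" "y \<in> A \<union> B" "z \<in> A \<union> B" "x \<noteq> y" using xy z graph_on_neq[OF g xy(1)] by auto
  moreover from this have "{x, y} \<subseteq> {x, y, z} \<inter> (A \<union> B)" by auto
  then have "card {x, y} \<le> card ({x, y, z} \<inter> (A \<union> B))" by (intro card_mono) auto
  ultimately have "{x, y, z} \<in> T1" using notin_W by (auto simp: T1_def)
  then show thesis using that z by blast
qed

text \<open>Each edge inside a part has about \<open>n / 7\<close> common neighbours in the other
  part, so two such edges would extend to triangles in \<open>T1\<close> that meet in at most one
  vertex.\<close>

lemma card_inner_le:
  assumes pair: "\<And>T T'. T \<in> T1 \<Longrightarrow> T' \<in> T1 \<Longrightarrow> T \<noteq> T' \<Longrightarrow> card (T \<inter> T') = 2"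
  shows "card inner \<le> 1"
proof -
  have fE: "finite inner" using graph_on_finite[OF g fV] by (simp add: inner_def)
  have "e = e'" if e: "e \<in> inner" "e' \<in> inner" for e e'
  proof (rule ccontr)
    assume ne: "e \<noteq> e'"
    have "e \<in> E" "e' \<in> E" using e by (auto simp: inner_def)
    then obtain x y x' y' where xy: "e = {x, y}" "x \<noteq> y" "e' = {x', y'}" "x' \<noteq> y'" using graph_on_edge[OF g] by metis
    have "card {x', y'} \<le> 20" using card_length[of "[x', y']"] by simp
    then obtain z where z: "z \<notin> {x', y'}" "{x, y, z} \<in> T1" using inner_common[of x y "{x', y'}"] e(1) xy by auto
    have "card {x, y, z} \<le> 20" using card_length[of "[x, y, z]"] by simp
    then obtain z' where z': "z' \<notin> {x, y, z}" "{x', y', z'} \<in> T1" using inner_common[of x' y' "{x, y, z}"] e(2) xy by auto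
    have "{x, y, z} \<noteq> {x', y', z'}" using z' by auto
    then have "card ({x, y, z} \<inter> {x', y', z'}) = 2" using pair z z' by blast
    moreover have "{x, y, z} \<inter> {x', y', z'} = e \<inter> e'" using z(1) z'(1) unfolding xy(1,3) by blast
    moreover have "\<not> e \<subseteq> e'" using card_subset_eq[of e' e] ne xy by auto
    then have "e \<inter> e' \<subset> e" by blast
    then have "card (e \<inter> e') < card e" using xy by (intro psubset_card_mono) auto
    ultimately show False using xy by simp
  qed
  then show ?thesis using card_le_Suc0_iff_eq[OF fE] by auto
qed

section \<open>Vertices outside the centres and the parts\<close>

definition "dT r = card (nb E r \<inter> (A \<union> B))"
definition "dW r = card (nb E r \<inter> W)"

lemma dT_split: "dT r = card (nb E r \<inter> A) + card (nb E r \<inter> B)"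
proof -
  have "nb E r \<inter> (A \<union> B) = (nb E r \<inter> A) \<union> (nb E r \<inter> B)" by auto
  then show ?thesis unfolding dT_def using fin AB by (simp add: card_Un_disjoint Int_ac disjoint_iff)
qed

text \<open>Otherwise two neighbours \<open>a1\<close>, \<open>a2\<close> of \<open>r\<close> in
  \<open>A\<close> have distinct partners \<open>b1\<close>, \<open>b2\<close> in \<open>B\<close>
  adjacent to \<open>r\<close>, and the resulting two triangles in \<open>T1\<close> share only
  \<open>r\<close>.\<close>

lemma two_sided:
  assumes pair: "\<And>T T'. T \<in> T1 \<Longrightarrow> T' \<in> T1 \<Longrightarrow> T \<noteq> T' \<Longrightarrow> card (T \<inter> T') = 2"
    and r: "r \<in> R" and a: "2 \<le> card (nb E r \<inter> A)"
  shows "real (card (nb E r \<inter> B)) \<le> real (card B) - n / 3 + 2"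
proof (rule ccontr)
  assume no: "\<not> ?thesis"
  have com: "1 < card (nb E r \<inter> B \<inter> (nb E a \<inter> B))" if "a \<in> A" for a
  proof -
    have "card (nb E r \<inter> B) + card (nb E a \<inter> B) = card ((nb E r \<inter> B) \<union> (nb E a \<inter> B)) + card (nb E r \<inter> B \<inter> (nb E a \<inter> B))"
      using fin by (intro card_Un_Int) auto
    moreover have "card ((nb E r \<inter> B) \<union> (nb E a \<inter> B)) \<le> card B" using fin by (intro card_mono) auto
    ultimately have "real (card (nb E r \<inter> B)) + real (card (nb E a \<inter> B)) \<le> real (card B) + real (card (nb E r \<inter> B \<inter> (nb E a \<inter> B)))" by linarith
    then show ?thesis using no nA[OF that] by (simp add: n_def)
  qed
  have "nb E r \<inter> A \<noteq> {}" using a by auto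
  then obtain a1 where a1: "a1 \<in> nb E r \<inter> A" by blast
  have "card {a1} < card (nb E r \<inter> A)" using a by simp
  then obtain a2 where a2: "a2 \<in> nb E r \<inter> A" "a2 \<noteq> a1" using fresh[of "{a1}"] by blast
  have "nb E r \<inter> B \<inter> (nb E a1 \<inter> B) \<noteq> {}" using com[of a1] a1 by auto
  then obtain b1 where b1: "b1 \<in> nb E r" "b1 \<in> B" "b1 \<in> nb E a1" by blast
  have "card {b1} < card (nb E r \<inter> B \<inter> (nb E a2 \<inter> B))" using com[of a2] a2 by simp
  then obtain b2 where b2: "b2 \<in> nb E r" "b2 \<in> B" "b2 \<in> nb E a2" "b2 \<noteq> b1" using fresh[of "{b1}"] by blast
  have rV: "r \<notin> W" "r \<notin> A" "r \<notin> B" using r by (auto simp: R_def)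
  have tri: "{r, a, b} \<in> T1" if "a \<in> A" "b \<in> B" "a \<in> nb E r" "b \<in> nb E r" "b \<in> nb E a" for a b
  proof -
    have "{r, a, b} \<in> triangles V E" using that by (intro triangleI[OF g]) (auto simp: nb_def)
    moreover have "{r, a, b} \<inter> (A \<union> B) = {a, b}" "a \<noteq> b" using that rV AB by auto
    ultimately show ?thesis using that rV notin_W by (auto simp: T1_def)
  qed
  have t12: "{r, a1, b1} \<in> T1" "{r, a2, b2} \<in> T1" using tri a1 a2 b1 b2 by auto
  have "a1 \<noteq> b2" "a2 \<noteq> b1" using a1 a2 b1 b2 AB by auto
  then have i: "{r, a1, b1} \<inter> {r, a2, b2} = {r}" using a2 b2 by auto
  moreover have "{r, a1, b1} \<noteq> {r, a2, b2}" using i a1 rV by auto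
  ultimately have "card {r} = 2" using pair[OF t12] by metis
  then show False by simp
qed

text \<open>A leftover vertex with at most one neighbour in one part sees at most the other part and
  one vertex; with two neighbours in both parts it loses \<open>n / 3\<close> on either side by
  \<open>two_sided\<close>. If it sees all of \<open>W\<close>, maximality caps each side at
  \<open>n / 3\<close>.\<close>

lemma dT_bounds:
  assumes pair: "\<And>T T'. T \<in> T1 \<Longrightarrow> T' \<in> T1 \<Longrightarrow> T \<noteq> T' \<Longrightarrow> card (T \<inter> T') = 2" and r: "r \<in> R"
  shows "real (dT r) \<le> n / 2 + n / (2000 * real t) + 4" "W \<subseteq> nb E r \<Longrightarrow> real (dT r) \<le> n / 3 + 4"
proof -
  interpret sw: near_extremal V E t W B A by (rule swap)
  have T1s: "sw.T1 = T1" by (simp add: sw.T1_def T1_def Un_commute)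
  have Rs: "sw.R = R" by (auto simp: sw.R_def R_def)
  define a where "a = card (nb E r \<inter> A)"
  define b where "b = card (nb E r \<inter> B)"
  have d: "dT r = a + b" using dT_split by (simp add: a_def b_def)
  have ab: "a \<le> card A" "b \<le> card B" unfolding a_def b_def using fin by (auto intro: card_mono)
  have c1: "real b \<le> real (card B) - n / 3 + 2" if "2 \<le> a" using two_sided[OF pair r] that by (simp add: a_def b_def)
  have c2: "real a \<le> real (card A) - n / 3 + 2" if "2 \<le> b" using sw.two_sided[of r, unfolded T1s Rs, OF pair r] that by (simp add: a_def b_def)
  have sab: "real (card A) + real (card B) \<le> n" using card_V by (simp add: n_def)
  have cases: "a \<le> 1 \<or> b \<le> 1 \<or> (2 \<le> a \<and> 2 \<le> b)" by linarith
  from cases show "real (dT r) \<le> n / 2 + n / (2000 * real t) + 4"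
  proof (elim disjE)
    assume "a \<le> 1"
    then show ?thesis using d ab size_upper by simp
  next
    assume "b \<le> 1"
    then show ?thesis using d ab size_upper by simp
  next
    assume "2 \<le> a \<and> 2 \<le> b"
    then show ?thesis using d c1 c2 sab small n_big by simp
  qed
  assume "W \<subseteq> nb E r"
  then have m: "real a < n / 3" "real b < n / 3" using maximal[of r] r by (auto simp: R_def a_def b_def n_def)
  from cases show "real (dT r) \<le> n / 3 + 4"
  proof (elim disjE)
    assume "2 \<le> a \<and> 2 \<le> b"
    then show ?thesis using d c1 c2 sab by simp
  qed (use d m in auto)
qed

definition "ERR = {e \<in> E. e \<subseteq> R}"
definition "cT e = {x \<in> A \<union> B. insert x e \<in> triangles V E}"
text \<open>The threshold \<open>10\<close> leaves room to choose distinct common neighbours along a loose path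
  through a few edges of \<open>\<Gamma>\<close>.\<close>
definition "\<Gamma> = {e \<in> ERR. 10 < card (cT e)}"

lemma graph_ERR: "graph_on R ERR" "finite ERR" "card ERR \<le> card R * card R"
proof -
  show gr: "graph_on R ERR" using g by (auto simp: graph_on_def ERR_def)
  show "finite ERR" using graph_on_finite[OF g fV] by (simp add: ERR_def)
  have "ERR = {e \<in> ERR. e \<inter> R \<noteq> {}}" using graph_on_edge[OF gr] by blast
  then show "card ERR \<le> card R * card R" using edges_touching[OF gr fin(3), of R] by simp
qed

lemma cT_edge: "{r, r'} \<in> E \<Longrightarrow> cT {r, r'} = cn E r r' \<inter> (A \<union> B)" if "r \<in> R" "r' \<in> R"
proof -
  assume e: "{r, r'} \<in> E"
  have nr: "r \<notin> A \<union> B" "r' \<notin> A \<union> B" using that by (auto simp: R_def)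
  show ?thesis
  proof (intro equalityI subsetI)
    fix x assume x: "x \<in> cT {r, r'}"
    then have T: "insert x {r, r'} \<in> triangles V E" "x \<in> A \<union> B" by (auto simp: cT_def)
    then have "x \<noteq> r" "x \<noteq> r'" using nr by auto
    then show "x \<in> cn E r r' \<inter> (A \<union> B)" using triangleD[OF T(1)] T(2) by (auto simp: cn_iff)
  next
    fix x assume x: "x \<in> cn E r r' \<inter> (A \<union> B)"
    then have "{r, r', x} \<in> triangles V E" by (intro triangleI[OF g e]) (auto simp: cn_iff)
    then show "x \<in> cT {r, r'}" using x by (simp add: cT_def insert_commute)
  qed
qed

lemma \<Gamma>_D: "{r, r'} \<in> \<Gamma> \<Longrightarrow> {r, r'} \<in> E \<and> r \<in> R \<and> r' \<in> R \<and> r \<noteq> r' \<and> 10 < card (cn E r r' \<inter> (A \<union> B))"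
  using cT_edge[of r r'] graph_on_neq[OF g] by (auto simp: \<Gamma>_def ERR_def)

lemma \<Gamma>_common:
  assumes "{r, r'} \<in> \<Gamma>" "finite S" "card S \<le> 10"
  obtains x where "x \<in> A \<union> B" "{r, x} \<in> E" "{r', x} \<in> E" "x \<notin> S"
proof -
  have "card S < card (cn E r r' \<inter> (A \<union> B))" using \<Gamma>_D[OF assms(1)] assms(3) by simp
  then obtain x where "x \<in> cn E r r' \<inter> (A \<union> B)" "x \<notin> S" using fresh[OF assms(2)] by blast
  then show thesis using that by (auto simp: cn_iff)
qed

text \<open>The starting path of length 2 has the core \<open>x\<close>, \<open>r2\<close>,
  \<open>z\<close> with apexes \<open>r1\<close> and \<open>r3\<close>. Hence \<Gamma> is a
  matching.\<close>

lemma \<Gamma>_even: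
  assumes no: "\<not> lcyc E (2 * t + 2)" and e: "{r1, r2} \<in> \<Gamma>" "{r2, r3} \<in> \<Gamma>"
  shows "r1 = r3"
proof (rule ccontr)
  assume ne: "r1 \<noteq> r3"
  obtain x where x: "x \<in> A \<union> B" "{r1, x} \<in> E" "{r2, x} \<in> E" "x \<notin> {}" using \<Gamma>_common[OF e(1), of "{}"] by auto
  obtain z where z: "z \<in> A \<union> B" "{r2, z} \<in> E" "{r3, z} \<in> E" "z \<notin> {x}" using \<Gamma>_common[OF e(2), of "{x}"] by auto
  have r: "r1 \<in> R" "r2 \<in> R" "r3 \<in> R" "{r1, r2} \<in> E" "{r2, r3} \<in> E" using \<Gamma>_D e by auto
  then have nr: "r1 \<notin> A \<union> B" "r2 \<notin> A \<union> B" "r3 \<notin> A \<union> B" "r1 \<notin> W" "r2 \<notin> W" "r3 \<notin> W" by (auto simp: R_def)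
  have L: "lpath E x z 2 {x, r2, r1, z, r3}"
    by (rule lpath2[OF g]) (use x z r nr ne in \<open>auto simp: insert_commute\<close>)
  have "lcyc E (2 * t + 2)"
    by (rule lcyc_W[OF x(1) z(1) _ L]) (use z nr x notin_W in auto)
  then show False using no by simp
qed

text \<open>An adjacent centre \<open>w\<close> would give the core \<open>x\<close>,
  \<open>r\<close>, \<open>w\<close>, \<open>z\<close> with apexes \<open>r'\<close>,
  \<open>y\<close>, \<open>b\<close>, a starting path of length 3 that uses
  \<open>w\<close>.\<close>

lemma \<Gamma>_odd_W:
  assumes no: "\<not> lcyc E (2 * t + 1)" and e: "{r, r'} \<in> \<Gamma>"
  shows "dW r = 0"
proof (rule ccontr)
  assume "dW r \<noteq> 0"
  then have "nb E r \<inter> W \<noteq> {}" by (auto simp: dW_def)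
  then obtain w where w: "w \<in> W" "{r, w} \<in> E" by (auto simp: nb_def)
  obtain x where x: "x \<in> A \<union> B" "{r, x} \<in> E" "{r', x} \<in> E" "x \<notin> {}" using \<Gamma>_common[OF e, of "{}"] by auto
  obtain y where y: "y \<in> A \<union> B" "{r, y} \<in> E" "{r', y} \<in> E" "y \<notin> {x}" using \<Gamma>_common[OF e, of "{x}"] by auto
  have r: "r \<in> R" "r' \<in> R" "{r, r'} \<in> E" "r \<noteq> r'" using \<Gamma>_D e by auto
  then have nr: "r \<notin> A \<union> B" "r' \<notin> A \<union> B" "r \<notin> W" "r' \<notin> W" by (auto simp: R_def)
  have cS: "card {x, y} \<le> 2" "card {r, r', x, y} \<le> 4" using card_length[of "[x, y]"] card_length[of "[r, r', x, y]"] by auto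
  have "card {x, y} < card (A \<union> B)" using cS envW by (simp add: env_def)
  then obtain z where z: "z \<in> A \<union> B" "z \<notin> {x, y}" using fresh[of "{x, y}"] by blast
  have "card (W \<union> {r, r', x, y}) < card (cn E w z)"
  proof -
    have "100 * t + 200 \<le> card (cn E w z)" using envW w(1) z(1) by (simp add: env_def)
    then show ?thesis using card_Un_le[of W "{r, r', x, y}"] cS(2) W(2) by linarith
  qed
  then obtain b where b: "b \<in> cn E w z" "b \<notin> W \<union> {r, r', x, y}" using fresh[of "W \<union> {r, r', x, y}"] W by blast
  have Lx: "lpath E x z 3 {x, r, r', w, y, z, b}"
    by (rule lpath3[OF g])
      (use x y z b w r nr WAB[OF w(1) y(1)] WAB[OF w(1) z(1)] notin_W in \<open>auto simp: insert_commute cn_iff\<close>)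
  have "lcyc E (2 * t + 1)"
    by (rule lcyc_W1[OF x(1) z(1) _ Lx w(1)]) (use z nr x y b notin_W in auto)
  then show False using no by simp
qed

text \<open>The outer vertices \<open>r1\<close>, \<open>r4\<close> become apexes over the core
  \<open>x\<close>, \<open>r2\<close>, \<open>r3\<close>, \<open>z\<close>. The length is 3, so one
  centre is left out when closing.\<close>

lemma \<Gamma>_odd_P4:
  assumes no: "\<not> lcyc E (2 * t + 1)" and e: "{r1, r2} \<in> \<Gamma>" "{r2, r3} \<in> \<Gamma>" "{r3, r4} \<in> \<Gamma>" and d: "distinct [r1, r2, r3, r4]"
  shows False
proof -
  obtain x where x: "x \<in> A \<union> B" "{r1, x} \<in> E" "{r2, x} \<in> E" "x \<notin> {}" using \<Gamma>_common[OF e(1), of "{}"] by auto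
  obtain y where y: "y \<in> A \<union> B" "{r2, y} \<in> E" "{r3, y} \<in> E" "y \<notin> {x}" using \<Gamma>_common[OF e(2), of "{x}"] by auto
  have "card {x, y} \<le> 10" using card_length[of "[x, y]"] by simp
  then obtain z where z: "z \<in> A \<union> B" "{r3, z} \<in> E" "{r4, z} \<in> E" "z \<notin> {x, y}" using \<Gamma>_common[OF e(3), of "{x, y}"] by auto
  have r: "{r1, r2} \<in> E" "{r2, r3} \<in> E" "{r3, r4} \<in> E" "r1 \<in> R" "r2 \<in> R" "r3 \<in> R" "r4 \<in> R" using \<Gamma>_D e by auto
  then have nr: "r1 \<notin> A \<union> B" "r2 \<notin> A \<union> B" "r3 \<notin> A \<union> B" "r4 \<notin> A \<union> B" "r1 \<notin> W" "r2 \<notin> W" "r3 \<notin> W" "r4 \<notin> W" by (auto simp: R_def)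
  have L: "lpath E x z 3 {x, r2, r1, r3, y, z, r4}"
    by (rule lpath3[OF g]) (use x y z r nr d in \<open>auto simp: insert_commute\<close>)
  obtain w where w: "w \<in> W" using W_ne by blast
  have "lcyc E (2 * t + 1)"
    by (rule lcyc_W1[OF x(1) z(1) _ L w]) (use z nr x y notin_W in auto)
  then show False using no by simp
qed

end

section \<open>Counting all triangles\<close>

lemma sum_union_le: "finite A \<Longrightarrow> finite B \<Longrightarrow> sum f (A \<union> B) \<le> sum f A + (sum f B :: nat)"
  using sum.union_inter[of A B f] by linarith

lemma card_image_union_le:
  assumes "finite I" "\<And>i. i \<in> I \<Longrightarrow> finite (S i)"
  shows "card (\<Union>i\<in>I. f i ` S i) \<le> (\<Sum>i\<in>I. card (S i))"
  using card_UN_le[OF assms(1), of "\<lambda>i. f i ` S i"] sum_mono[of I "\<lambda>i. card (f i ` S i)" "\<lambda>i. card (S i)"]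
    card_image_le assms(2) by (meson le_trans)

text \<open>Moving \<open>j\<close> vertices away from the balanced split costs at least
  \<open>j * j\<close> in the product and gains only \<open>j\<close> in the larger part.\<close>

lemma balanced_product:
  fixes a b m t :: nat
  assumes "a + b = m" "1 \<le> t"
  shows "a * b \<le> (m div 2) * (m - m div 2)"
    "t * (a * b) + max a b \<le> t * ((m div 2) * (m - m div 2)) + (m - m div 2)"
proof -
  define q where "q = m div 2"
  define p where "p = m - q"
  have pq: "p = q \<or> p = Suc q" "p + q = m" unfolding p_def q_def by presburger+
  have main: "x * y \<le> q * p \<and> t * (x * y) + y \<le> t * (q * p) + p" if "x + y = m" "x \<le> y" for x y
  proof -
    define j where "j = q - x"
    have xq: "x \<le> q" using that pq by linarith
    have q: "q = x + j" using xq by (simp add: j_def)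
    have y: "y = p + j" using that pq q by linarith
    have "q * p = x * p + j * p" by (simp add: q algebra_simps)
    moreover have "x * y = x * p + x * j" by (simp add: y algebra_simps)
    moreover have "x * j + j * j \<le> j * p"
    proof -
      have "x + j \<le> p" using q pq(1) by auto
      then have "j * (x + j) \<le> j * p" by (rule mult_left_mono) simp
      then show ?thesis by (simp add: algebra_simps)
    qed
    ultimately have jj: "x * y + j * j \<le> q * p" by linarith
    have "t * (x * y + j * j) \<le> t * (q * p)" using jj by (rule mult_left_mono) simp
    moreover have "j \<le> t * (j * j)"
    proof (cases j)
      case (Suc i)
      then have "1 * 1 \<le> t * j" using assms(2) by (intro mult_le_mono) auto
      then have "1 * j \<le> (t * j) * j" by (intro mult_right_mono) auto
      then show ?thesis by (simp add: mult.assoc)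
    qed simp
    ultimately have "t * (x * y) + j \<le> t * (q * p)" unfolding distrib_left by linarith
    then show ?thesis using jj y by linarith
  qed
  have "a \<le> b \<or> b \<le> a" by linarith
  then have "a * b \<le> q * p \<and> t * (a * b) + max a b \<le> t * (q * p) + p"
    using main[of a b] main[of b a] assms(1) by (auto simp: max_def mult.commute add.commute)
  then show "a * b \<le> (m div 2) * (m - m div 2)"
    "t * (a * b) + max a b \<le> t * ((m div 2) * (m - m div 2)) + (m - m div 2)"
    by (auto simp: p_def q_def)
qed

lemma floor_product: "((real m)\<^sup>2 - 1) / 4 \<le> real ((m div 2) * (m - m div 2))"
proof -
  define q where "q = m div 2"
  have "m = 2 * q \<or> m = Suc (2 * q)" unfolding q_def by presburger
  then show ?thesis unfolding q_def[symmetric]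
    by (elim disjE) (simp_all add: power2_eq_square algebra_simps)
qed

context near_extremal
begin

definition "cW e = {w \<in> W. insert w e \<in> triangles V E}"

text \<open>A triangle with one centre is counted at its edge outside \<open>W\<close>. Such an edge
  inside the parts or inside \<open>R\<close> has at most \<open>t\<close> centres over it; one from
  \<open>r\<close> to the parts has at most \<open>dW r\<close>.\<close>

lemma triangles_one_centre:
  "card {T \<in> triangles V E. card (T \<inter> W) = 1} \<le>
    t * (card A * card B + card inner) + (\<Sum>r\<in>R. dW r * dT r) + t * (card R * card R)"
proof -
  have fE: "finite E" using graph_on_finite[OF g fV] .
  define E0 where "E0 = {e \<in> E. e \<inter> W = {}}"
  define IN where "IN = {e \<in> E. e \<subseteq> A \<union> B}"
  define MIX where "MIX = (\<lambda>p. {fst p, snd p}) ` (Sigma R (\<lambda>r. nb E r \<inter> (A \<union> B)))"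
  have fS: "finite (Sigma R (\<lambda>r. nb E r \<inter> (A \<union> B)))" using fin by auto
  have fin': "finite E0" "finite IN" "finite MIX" "finite ERR" "finite inner"
    using fE fS by (auto simp: E0_def IN_def MIX_def ERR_def inner_def)
  have cWt: "card (cW e) \<le> t" for e using card_mono[OF W(1), of "cW e"] W(2) by (auto simp: cW_def)
  have "{T \<in> triangles V E. card (T \<inter> W) = 1} \<subseteq> (\<Union>e\<in>E0. (\<lambda>w. insert w e) ` cW e)"
  proof
    fix T assume "T \<in> {T \<in> triangles V E. card (T \<inter> W) = 1}"
    then have T: "T \<in> triangles V E" "card (T \<inter> W) = 1" by auto
    then obtain w where w: "T \<inter> W = {w}" using card_1_singletonE by blast
    then have "w \<in> T" by blast
    then have "card (T - {w}) = 2" using triangle_card[OF T(1)] by simp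
    then obtain x y where xy: "T - {w} = {x, y}" "x \<noteq> y" by (auto simp: card_2_iff)
    have xT: "x \<in> T" "y \<in> T" using xy by auto
    have "{x, y} \<in> E" using triangleD[OF T(1) xT xy(2)] .
    moreover have "{x, y} \<inter> W = {}" using w xy by auto
    moreover have Tw: "insert w {x, y} = T" using w xy by auto
    moreover have "w \<in> cW {x, y}" using w Tw T(1) by (auto simp: cW_def)
    ultimately show "T \<in> (\<Union>e\<in>E0. (\<lambda>w. insert w e) ` cW e)" unfolding E0_def by blast
  qed
  moreover have fc: "finite (cW e)" for e using W by (simp add: cW_def)
  ultimately have "card {T \<in> triangles V E. card (T \<inter> W) = 1} \<le> card (\<Union>e\<in>E0. (\<lambda>w. insert w e) ` cW e)"
    using fin' by (intro card_mono) auto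
  also have "\<dots> \<le> (\<Sum>e\<in>E0. card (cW e))" using fin' fc by (intro card_image_union_le) auto
  also have "\<dots> \<le> (\<Sum>e\<in>IN \<union> MIX \<union> ERR. card (cW e))"
  proof (rule sum_mono2)
    show "E0 \<subseteq> IN \<union> MIX \<union> ERR"
    proof
      fix e assume e: "e \<in> E0"
      then have "e \<in> E" by (simp add: E0_def)
      then obtain x y where xy: "e = {x, y}" "x \<in> V" "y \<in> V" using graph_on_edge[OF g] by blast
      have "x \<in> A \<union> B \<union> R" "y \<in> A \<union> B \<union> R" using e xy by (auto simp: E0_def R_def)
      moreover have MX: "e \<in> MIX" if "r \<in> R" "z \<in> A \<union> B" "e = {r, z}" for r z
        using that e unfolding MIX_def by (intro image_eqI[of _ _ "(r, z)"]) (auto simp: E0_def nb_def)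
      ultimately show "e \<in> IN \<union> MIX \<union> ERR"
        using e xy MX[of x y] MX[of y x] by (auto simp: E0_def IN_def ERR_def insert_commute)
    qed
  qed (use fin' in auto)
  also have "\<dots> \<le> (\<Sum>e\<in>IN. card (cW e)) + (\<Sum>e\<in>MIX. card (cW e)) + (\<Sum>e\<in>ERR. card (cW e))"
    using fin' by (intro order.trans[OF sum_union_le] add_right_mono sum_union_le) auto
  also have "\<dots> \<le> t * (card A * card B + card inner) + (\<Sum>r\<in>R. dW r * dT r) + t * (card R * card R)"
  proof (intro add_mono)
    have "IN \<subseteq> (\<lambda>p. {fst p, snd p}) ` (A \<times> B) \<union> inner"
    proof
      fix e assume e: "e \<in> IN"
      then have "e \<in> E" by (simp add: IN_def)
      then obtain x y where xy: "e = {x, y}" using graph_on_edge[OF g] by blast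
      then have xAB: "x \<in> A \<union> B" "y \<in> A \<union> B" using e by (auto simp: IN_def)
      have im: "e \<in> (\<lambda>p. {fst p, snd p}) ` (A \<times> B)" if "a \<in> A" "b \<in> B" "e = {a, b}" for a b
        using that by (intro image_eqI[of _ _ "(a, b)"]) auto
      consider "x \<in> A \<and> y \<in> A \<or> x \<in> B \<and> y \<in> B" | "x \<in> A \<and> y \<in> B" | "y \<in> A \<and> x \<in> B" using xAB by blast
      then show "e \<in> (\<lambda>p. {fst p, snd p}) ` (A \<times> B) \<union> inner"
      proof cases
        case 1
        then show ?thesis using xy \<open>e \<in> E\<close> by (auto simp: inner_def)
      next
        case 2
        then show ?thesis using im[of x y] xy by blast
      next
        case 3
        then show ?thesis using im[of y x] xy by (simp add: insert_commute)
      qed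
    qed
    then have "card IN \<le> card ((\<lambda>p. {fst p, snd p}) ` (A \<times> B) \<union> inner)" using fin fin' by (intro card_mono) auto
    also have "\<dots> \<le> card ((\<lambda>p. {fst p, snd p}) ` (A \<times> B)) + card inner" by (rule card_Un_le)
    also have "\<dots> \<le> card A * card B + card inner"
      using card_image_le[of "A \<times> B" "\<lambda>p. {fst p, snd p}"] fin by (simp add: card_cartesian_product)
    finally have "card IN * t \<le> (card A * card B + card inner) * t" by (rule mult_right_mono) simp
    moreover have "(\<Sum>e\<in>IN. card (cW e)) \<le> card IN * t" using cWt sum_bounded_above[of IN "\<lambda>e. card (cW e)" t] by simp
    ultimately show "(\<Sum>e\<in>IN. card (cW e)) \<le> t * (card A * card B + card inner)" by (metis le_trans mult.commute)
    have "(\<Sum>e\<in>MIX. card (cW e)) \<le> (\<Sum>p\<in>Sigma R (\<lambda>r. nb E r \<inter> (A \<union> B)). card (cW {fst p, snd p}))"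
      unfolding MIX_def using sum_image_le[OF fS, of "\<lambda>e. card (cW e)" "\<lambda>p. {fst p, snd p}"] by simp
    also have "\<dots> \<le> (\<Sum>p\<in>Sigma R (\<lambda>r. nb E r \<inter> (A \<union> B)). dW (fst p))"
    proof (rule sum_mono)
      fix p assume p: "p \<in> Sigma R (\<lambda>r. nb E r \<inter> (A \<union> B))"
      then obtain r x where rx: "p = (r, x)" "r \<in> R" by auto
      have "cW {r, x} \<subseteq> nb E r \<inter> W"
      proof
        fix w assume w: "w \<in> cW {r, x}"
        then have "insert w {r, x} \<in> triangles V E" "w \<in> W" "w \<noteq> r" using rx by (auto simp: cW_def R_def)
        then show "w \<in> nb E r \<inter> W" using triangleD[of "insert w {r, x}" V E r w] by (auto simp: nb_def)
      qed
      then show "card (cW {fst p, snd p}) \<le> dW (fst p)" unfolding dW_def rx(1) using W by (simp add: card_mono)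
    qed
    also have "\<dots> = (\<Sum>r\<in>R. \<Sum>x\<in>nb E r \<inter> (A \<union> B). dW r)"
      using fin by (subst sum.Sigma) (auto simp: case_prod_unfold)
    also have "\<dots> = (\<Sum>r\<in>R. dW r * dT r)" by (simp add: dT_def mult.commute)
    finally show "(\<Sum>e\<in>MIX. card (cW e)) \<le> (\<Sum>r\<in>R. dW r * dT r)" .
    have "(\<Sum>e\<in>ERR. card (cW e)) \<le> card ERR * t" using cWt sum_bounded_above[of ERR "\<lambda>e. card (cW e)" t] by simp
    also have "\<dots> \<le> (card R * card R) * t" using graph_ERR(3) by (rule mult_right_mono) simp
    finally show "(\<Sum>e\<in>ERR. card (cW e)) \<le> t * (card R * card R)" by (simp add: mult.commute)
  qed
  finally show ?thesis .
qed

text \<open>Triangles are sorted by the number of centres, and those without a centre by the number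
  of vertices in the parts. Edges inside \<open>R\<close> number at most
  \<open>card R * card R\<close>; only those in \<Gamma> can extend to more than ten triangles with
  a third vertex in the parts.\<close>

lemma triangle_count:
  assumes fr: "free t E"
  shows "card (triangles V E) \<le> (t choose 3) + (t choose 2) * (card V - t) +
    (t * (card A * card B + card inner) + (\<Sum>r\<in>R. dW r * dT r) + t * (card R * card R)) + card T1 +
    ((\<Sum>e\<in>\<Gamma>. card (cT e)) + 10 * (card R * card R)) + (4 * t + 9) * (card R * card R)"
proof -
  define F3 where "F3 = {T. T \<subseteq> W \<and> card T = 3}"
  define F2 where "F2 = (\<lambda>p. insert (snd p) (fst p)) ` ({p. p \<subseteq> W \<and> card p = 2} \<times> (V - W))"
  define F1 where "F1 = {T \<in> triangles V E. card (T \<inter> W) = 1}"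
  define Q1 where "Q1 = (\<Union>e\<in>ERR. (\<lambda>x. insert x e) ` cT e)"
  define Q0 where "Q0 = triangles R ERR"
  have ft: "finite (triangles V E)" using finite_triangles[OF fV] .
  have fcT: "finite (cT e)" for e using fin by (simp add: cT_def)
  have ff: "finite F3" "finite F2" "finite F1" "finite T1" "finite Q1" "finite Q0"
    using W fV ft graph_ERR(2) fcT finite_triangles[OF fin(3)] by (auto simp: F3_def F2_def F1_def T1_def Q1_def Q0_def)
  have "triangles V E \<subseteq> F3 \<union> F2 \<union> F1 \<union> T1 \<union> Q1 \<union> Q0"
  proof
    fix T assume T: "T \<in> triangles V E"
    have c: "card T = 3" "finite T" "T \<subseteq> V" using triangle_card[OF T] T by (auto simp: triangles_def)
    have split: "card T = card (T \<inter> S) + card (T - S)" for S using card_Int_Diff[OF c(2)] .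
    consider "card (T \<inter> W) = 0" | "card (T \<inter> W) = 1" | "card (T \<inter> W) = 2" | "card (T \<inter> W) = 3"
      using split[of W] c(1) by linarith
    then show "T \<in> F3 \<union> F2 \<union> F1 \<union> T1 \<union> Q1 \<union> Q0"
    proof cases
      case 1
      then have W0: "T \<inter> W = {}" using c(2) by simp
      have TR: "T - (A \<union> B) \<subseteq> R" using W0 c(3) by (auto simp: R_def)
      consider "2 \<le> card (T \<inter> (A \<union> B))" | "card (T \<inter> (A \<union> B)) = 1" | "card (T \<inter> (A \<union> B)) = 0" by linarith
      then show ?thesis
      proof cases
        case 1
        then show ?thesis using T W0 by (simp add: T1_def)
      next
        case 2
        then obtain x where x: "T \<inter> (A \<union> B) = {x}" using card_1_singletonE by blast
        have "card (T - (A \<union> B)) = 2" using split[of "A \<union> B"] c 2 by simp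
        then obtain r r' where r: "T - (A \<union> B) = {r, r'}" "r \<noteq> r'" by (auto simp: card_2_iff)
        have rT: "r \<in> T" "r' \<in> T" using r by auto
        have "{r, r'} \<in> E" using triangleD[OF T rT r(2)] .
        then have "{r, r'} \<in> ERR" using r TR by (simp add: ERR_def)
        moreover have Tx: "T = insert x {r, r'}" using x r by blast
        moreover have "x \<in> cT {r, r'}" using x T Tx by (auto simp: cT_def)
        ultimately show ?thesis unfolding Q1_def by blast
      next
        case 3
        then have "T \<subseteq> R" using TR c(2) by auto
        then have "T \<in> Q0" using T c by (auto simp: Q0_def triangles_def ERR_def)
        then show ?thesis by simp
      qed
    next
      case 2
      then show ?thesis using T by (simp add: F1_def)
    next
      case 3
      then have "card (T - W) = 1" using split[of W] c by simp
      then obtain v where v: "T - W = {v}" by (rule card_1_singletonE)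
      then have "T = insert v (T \<inter> W)" "v \<in> V - W" using c by auto
      then have "T \<in> F2" unfolding F2_def using 3 by (intro image_eqI[of _ _ "(T \<inter> W, v)"]) auto
      then show ?thesis by simp
    next
      case 4
      then have "T \<inter> W = T" using c by (intro card_subset_eq) auto
      then have "T \<in> F3" using c unfolding F3_def by blast
      then show ?thesis by simp
    qed
  qed
  then have "card (triangles V E) \<le> card (F3 \<union> F2 \<union> F1 \<union> T1 \<union> Q1 \<union> Q0)" using ff by (intro card_mono) auto
  also have "\<dots> \<le> card F3 + card F2 + card F1 + card T1 + card Q1 + card Q0"
    by (intro order.trans[OF card_Un_le] add_right_mono order.refl)
  also have "\<dots> \<le> (t choose 3) + (t choose 2) * (card V - t) +
    (t * (card A * card B + card inner) + (\<Sum>r\<in>R. dW r * dT r) + t * (card R * card R)) + card T1 +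
    ((\<Sum>e\<in>\<Gamma>. card (cT e)) + 10 * (card R * card R)) + (4 * t + 9) * (card R * card R)"
  proof (intro add_mono order.refl)
    show "card F3 \<le> t choose 3" unfolding F3_def using n_subsets[OF W(1), of 3] W(2) by simp
    have "card F2 \<le> card ({p. p \<subseteq> W \<and> card p = 2} \<times> (V - W))"
      unfolding F2_def using W fV by (intro card_image_le) auto
    also have "\<dots> = (t choose 2) * (card V - t)"
      using n_subsets[OF W(1), of 2] W W_sub by (simp add: card_cartesian_product card_Diff_subset)
    finally show "card F2 \<le> (t choose 2) * (card V - t)" .
    show "card F1 \<le> t * (card A * card B + card inner) + (\<Sum>r\<in>R. dW r * dT r) + t * (card R * card R)"
      unfolding F1_def by (rule triangles_one_centre)
    have "card Q1 \<le> (\<Sum>e\<in>ERR. card (cT e))"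
      unfolding Q1_def using graph_ERR(2) fcT by (intro card_image_union_le) auto
    also have "\<dots> \<le> (\<Sum>e\<in>\<Gamma>. card (cT e)) + (\<Sum>e\<in>ERR - \<Gamma>. card (cT e))"
      using sum_union_le[of \<Gamma> "ERR - \<Gamma>"] graph_ERR(2) by (simp add: \<Gamma>_def Un_absorb1)
    also have "(\<Sum>e\<in>ERR - \<Gamma>. card (cT e)) \<le> (\<Sum>e\<in>ERR - \<Gamma>. 10)" by (intro sum_mono) (auto simp: \<Gamma>_def)
    also have "\<dots> \<le> 10 * (card R * card R)"
      using card_mono[OF graph_ERR(2), of "ERR - \<Gamma>"] graph_ERR(3) by auto
    finally show "card Q1 \<le> (\<Sum>e\<in>\<Gamma>. card (cT e)) + 10 * (card R * card R)" by simp
    have "free t ERR" using free_subset[OF fr] by (auto simp: ERR_def)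
    then have "card Q0 \<le> (4 * t + 9) * card ERR" unfolding Q0_def using triangles_linear[OF graph_ERR(1) fin(3)] t by simp
    also have "\<dots> \<le> (4 * t + 9) * (card R * card R)" using graph_ERR(3) by (rule mult_left_mono) simp
    finally show "card Q0 \<le> (4 * t + 9) * (card R * card R)" .
  qed
  finally show ?thesis .
qed

lemma tn: "2 * n \<le> real t * n" "400000 * real t \<le> real t * n" "real t * (n / (2000 * real t)) = n / 2000"
  using t n_big by (auto intro: mult_right_mono simp: mult.commute[of _ "real t"] intro!: mult_left_mono)

text \<open>Moving \<open>r\<close> into the bipartite part would give it about \<open>t * n / 2\<close> triangles. The extra \<open>1 / 2\<close>
  covers half of the triangles on edges of \<open>\<Gamma>\<close>, shared between their two ends.\<close>
lemma vertex_weight: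
  assumes pair: "\<And>T T'. T \<in> T1 \<Longrightarrow> T' \<in> T1 \<Longrightarrow> T \<noteq> T' \<Longrightarrow> card (T \<inter> T') = 2" and r: "r \<in> R"
  shows "(real (dW r) + 1 / 2) * real (dT r) \<le> real t * n / 2 - n / 20"
proof -
  have dWt: "dW r \<le> t" unfolding dW_def using card_mono[OF W(1), of "nb E r \<inter> W"] W(2) by simp
  show ?thesis
  proof (cases "W \<subseteq> nb E r")
    case True
    \<comment> \<open>Maximality lowers the degree into the parts from \<open>n / 2\<close> to
      \<open>n / 3\<close>. This saves \<open>t * n / 6\<close>, at least \<open>n / 3\<close>,
      against the extra \<open>n / 6\<close>.\<close>
    have "(real (dW r) + 1 / 2) * real (dT r) \<le> (real t + 1 / 2) * (n / 3 + 4)"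
      using dWt dT_bounds(2)[OF pair r True] by (intro mult_mono) auto
    also have "\<dots> = real t * n / 3 + 4 * real t + n / 6 + 2" by (simp add: algebra_simps)
    also have "\<dots> \<le> real t * n / 2 - n / 20" using tn n_big by linarith
    finally show ?thesis .
  next
    case False
    then have "nb E r \<inter> W \<subset> W" by blast
    then have "dW r < t" unfolding dW_def using psubset_card_mono[OF W(1)] W(2) by metis
    \<comment> \<open>One missing centre saves more than the surplus \<open>1 / 2\<close> costs; a
      net gain of about \<open>n / 4\<close> remains.\<close>
    then have "(real (dW r) + 1 / 2) * real (dT r) \<le> (real t - 1 / 2) * (n / 2 + n / (2000 * real t) + 4)"
      using dT_bounds(1)[OF pair r] by (intro mult_mono) auto
    also have "\<dots> = real t * n / 2 - n / 4 + real t * (n / (2000 * real t)) - n / (2000 * real t) / 2 + 4 * real t - 2"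
    proof -
      have "(real t - 1 / 2) * (n / 2 + s + 4) = real t * n / 2 - n / 4 + real t * s - s / 2 + 4 * real t - 2" for s
        by (simp add: algebra_simps)
      then show ?thesis .
    qed
    also have "\<dots> \<le> real t * n / 2 - n / 20"
    proof -
      have "X - n / 4 + n / 2000 - s / 2 + 4 * real t - 2 \<le> X - n / 20" if "0 < s" for X s :: real
        using that n_big(2,3) by linarith
      then show ?thesis unfolding tn(3) using small(2) by blast
    qed
    finally show ?thesis .
  qed
qed

text \<open>Since \<Gamma> is a matching and the common neighbours of an edge are bounded by the
  degree of either end, each end pays for half of them.\<close>

lemma weight_even:
  assumes no: "\<not> lcyc E (2 * t + 2)"
  shows "real (\<Sum>r\<in>R. dW r * dT r) + real (\<Sum>e\<in>\<Gamma>. card (cT e)) \<le> real (card R) * (real t * n / 2 - n / 20)"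
proof -
  have gG: "graph_on R \<Gamma>" using graph_on_subset[OF graph_ERR(1)] by (auto simp: \<Gamma>_def)
  have "2 * card (cT e) \<le> sum dT e" if e: "e \<in> \<Gamma>" for e
  proof -
    obtain r r' where r: "e = {r, r'}" "r \<noteq> r'" using graph_on_edge[OF gG e] by blast
    have D: "{r, r'} \<in> E" "r \<in> R" "r' \<in> R" using \<Gamma>_D e r by auto
    have "card (cT e) \<le> dT r" "card (cT e) \<le> dT r'"
      unfolding dT_def r(1) cT_edge[OF D(2,3,1)] using fin by (auto intro!: card_mono simp: cn_def)
    then show ?thesis using r by simp
  qed
  then have "(\<Sum>e\<in>\<Gamma>. 2 * card (cT e)) \<le> (\<Sum>e\<in>\<Gamma>. sum dT e)" by (rule sum_mono)
  also have "\<dots> = sum dT (\<Union>\<Gamma>)"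
  proof -
    have "e \<inter> e' = {}" if e: "e \<in> \<Gamma>" "e' \<in> \<Gamma>" "e \<noteq> e'" for e e'
    proof (rule ccontr)
      assume "e \<inter> e' \<noteq> {}"
      then obtain v where v: "v \<in> e" "v \<in> e'" by blast
      have other: "\<exists>u. e = {u, v}" if "e \<in> \<Gamma>" "v \<in> e" for e using graph_on_edge[OF gG that(1)] that(2) by fastforce
      obtain u u' where u: "e = {u, v}" "e' = {v, u'}" using other[OF e(1) v(1)] other[OF e(2) v(2)] by (metis insert_commute)
      then have "u = u'" using \<Gamma>_even[OF no, of u v u'] e by simp
      then show False using e(3) u by (simp add: insert_commute)
    qed
    moreover have "finite e" if "e \<in> \<Gamma>" for e using graph_on_edge[OF gG that] by auto
    ultimately show ?thesis by (subst sum.Union_disjoint) auto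
  qed
  also have "\<dots> \<le> sum dT R" using gG fin by (intro sum_mono2) (auto simp: graph_on_def)
  finally have "2 * real (\<Sum>e\<in>\<Gamma>. card (cT e)) \<le> real (sum dT R)"
    by (metis of_nat_le_iff of_nat_mult of_nat_numeral sum_distrib_left)
  then have "real (\<Sum>r\<in>R. dW r * dT r) + real (\<Sum>e\<in>\<Gamma>. card (cT e)) \<le> (\<Sum>r\<in>R. (real (dW r) + 1 / 2) * real (dT r))"
    by (simp add: distrib_right sum.distrib sum_divide_distrib[symmetric])
  also have "\<dots> \<le> (\<Sum>r\<in>R. real t * n / 2 - n / 20)"
    by (intro sum_mono vertex_weight) (use T1_even[OF no] in auto)
  finally show ?thesis by simp
qed

text \<open>By \<open>p4_free_edges\<close>, \<Gamma> has at most as many edges as vertices, so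
  every vertex that it covers is charged for one whole edge. It can afford this because it is joined
  to no centre.\<close>

lemma weight_odd:
  assumes no: "\<not> lcyc E (2 * t + 1)"
  shows "real (\<Sum>r\<in>R. dW r * dT r) + real (\<Sum>e\<in>\<Gamma>. card (cT e)) \<le> real (card R) * (real t * n / 2 - n / 20)"
proof -
  have gG: "graph_on R \<Gamma>" using graph_on_subset[OF graph_ERR(1)] by (auto simp: \<Gamma>_def)
  have UR: "\<Union>\<Gamma> \<subseteq> R" using gG by (auto simp: graph_on_def)
  have pair: "card (T \<inter> T') = 2" if "T \<in> T1" "T' \<in> T1" "T \<noteq> T'" for T T' using T1_odd[OF no] that by simp
  define q where "q = n / 2 + n / (2000 * real t) + 4"
  have q: "0 \<le> q" "q \<le> real t * n / 2 - n / 20" using tn(1) small n_big unfolding q_def by linarith+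
  have "graph_on (\<Union>\<Gamma>) \<Gamma>" using gG by (auto simp: graph_on_def)
  then have "card \<Gamma> \<le> card (\<Union>\<Gamma>)"
    using UR fin(3) finite_subset by (intro p4_free_edges) (auto intro: \<Gamma>_odd_P4[OF no])
  then have "real (card \<Gamma>) * q \<le> real (card (\<Union>\<Gamma>)) * q" using q(1) by (intro mult_right_mono) auto
  moreover have "real (card (cT e)) \<le> q" if e: "e \<in> \<Gamma>" for e
  proof -
    obtain r r' where r: "e = {r, r'}" using graph_on_edge[OF gG e] by blast
    have D: "{r, r'} \<in> E" "r \<in> R" "r' \<in> R" using \<Gamma>_D e r by auto
    have "card (cT e) \<le> dT r"
      unfolding dT_def r(1) cT_edge[OF D(2,3,1)] using fin by (auto intro!: card_mono simp: cn_def)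
    then show ?thesis using dT_bounds(1)[OF pair D(2)] by (simp add: q_def)
  qed
  then have "(\<Sum>e\<in>\<Gamma>. real (card (cT e))) \<le> real (card \<Gamma>) * q" using sum_bounded_above by meson
  moreover have "real (card (\<Union>\<Gamma>)) * q = (\<Sum>r\<in>R. if r \<in> \<Union>\<Gamma> then q else 0)"
  proof -
    have "(\<Sum>r\<in>\<Union>\<Gamma>. q) = (\<Sum>r\<in>R. if r \<in> \<Union>\<Gamma> then q else 0)"
      by (rule sum.mono_neutral_cong_left[OF fin(3) UR]) auto
    then show ?thesis by simp
  qed
  ultimately have "real (\<Sum>r\<in>R. dW r * dT r) + real (\<Sum>e\<in>\<Gamma>. card (cT e)) \<le>
      (\<Sum>r\<in>R. real (dW r) * real (dT r) + (if r \<in> \<Union>\<Gamma> then q else 0))"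
    by (simp add: sum.distrib)
  also have "\<dots> \<le> (\<Sum>r\<in>R. real t * n / 2 - n / 20)"
  proof (rule sum_mono)
    fix r assume r: "r \<in> R"
    show "real (dW r) * real (dT r) + (if r \<in> \<Union>\<Gamma> then q else 0) \<le> real t * n / 2 - n / 20"
    proof (cases "r \<in> \<Union>\<Gamma>")
      case True
      then obtain e where e: "e \<in> \<Gamma>" "r \<in> e" by blast
      then obtain r' where "e = {r, r'}" using graph_on_edge[OF gG e(1)] by fastforce
      then have "dW r = 0" using \<Gamma>_odd_W[OF no] e by simp
      then show ?thesis using True q by simp
    next
      case False
      then show ?thesis using vertex_weight[OF pair r] by (simp add: algebra_simps)
    qed
  qed
  finally show ?thesis by simp
qed

section \<open>Leftover vertices are too expensive\<close>

text \<open>Each leftover vertex lowers the main term \<open>t * card A * card B\<close> by about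
  \<open>t * n / 2\<close> and returns at most \<open>t * n / 2 - n / 20\<close>. Terms quadratic in
  \<open>card R\<close> are absorbed because \<open>t * card R\<close> is at most
  \<open>n / 1000\<close>. The \<open>+ 1\<close> pays for an edge inside a part, and the
  \<open>n / 100\<close> for the gap between the rough bound on \<open>card T1\<close> and half of
  \<open>m\<close>.\<close>

lemma final_estimate:
  assumes R0: "R \<noteq> {}"
  shows "real t * (real (card A * card B) + 1) + real (card R) * (real t * n / 2 - n / 20)
    + (5 * real t + 19) * real (card R * card R) + n / 100 \<le> real t * ((n - real t)\<^sup>2 - 1) / 4"
proof -
  define a where "a = real (card A)"
  define b where "b = real (card B)"
  define r where "r = real (card R)"
  define T where "T = real t"
  define s where "s = n / (2000 * real t)"
  have r1: "1 \<le> r" using R0 fin by (simp add: r_def Suc_le_eq card_gt_0_iff)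
  have rs: "r \<le> 2 * s" using size_upper(3) by (simp add: r_def s_def)
  have Ts: "T * s = n / 2000" using tn(3) by (simp add: T_def s_def)
  have s4: "s \<le> n / 4000" using small by (simp add: s_def)
  have n: "100000 * (T * T) \<le> n" "400000 \<le> n" "200000 * T \<le> n" "0 \<le> T" using n_big by (auto simp: T_def)
  have nab: "n = T + a + b + r" unfolding n_def card_V by (simp add: a_def b_def r_def T_def)
  have "0 \<le> (a - b)\<^sup>2" by simp
  then have "4 * (a * b) \<le> (a + b)\<^sup>2" by (simp add: power2_eq_square algebra_simps)
  also have "a + b = n - T - r" using nab by simp
  finally have "T * (4 * (a * b)) \<le> T * (n - T - r)\<^sup>2" using n(4) by (rule mult_left_mono)
  also have "\<dots> = T * (n - T)\<^sup>2 - 2 * (r * (T * n)) + 2 * (r * (T * T)) + (T * r) * r"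
    by (simp add: power2_eq_square algebra_simps)
  finally have 1: "4 * (T * (a * b)) \<le> T * (n - T)\<^sup>2 - 2 * (r * (T * n)) + 2 * (r * (T * T)) + (T * r) * r" by simp
  have "T * r \<le> T * (2 * s)" using rs n(4) by (rule mult_left_mono)
  then have Tr: "T * r \<le> n / 1000" using Ts by simp
  have "(T * r) * r \<le> n / 1000 * r" using Tr r1 by (intro mult_right_mono) auto
  then have 2: "(T * r) * r \<le> (n * r) / 1000" by simp
  have "r \<le> n / 2000" using rs s4 by linarith
  then have "r * r \<le> n / 2000 * r" using r1 by (intro mult_right_mono) auto
  then have 3: "r * r \<le> (n * r) / 2000" by simp
  have "r * (T * T) \<le> r * (n / 100000)" using n(1) r1 by (intro mult_left_mono) auto
  then have 4: "r * (T * T) \<le> (n * r) / 100000" by (simp add: mult.commute)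
  have 5: "n \<le> n * r" using r1 n(2) by simp
  have "T * (a * b) + T + (r * (T * n) / 2 - n * r / 20) + 5 * ((T * r) * r) + 19 * (r * r) + n / 100 \<le> T * (n - T)\<^sup>2 / 4 - T / 4"
    using 1 2 3 4 5 n(2,3) by linarith
  then show ?thesis unfolding a_def[symmetric] b_def[symmetric] r_def[symmetric] T_def[symmetric] of_nat_mult
    by (simp add: algebra_simps)
qed

text \<open>Apart from at most four triangles, all of \<open>T1\<close> share two vertices, one of
  them, \<open>u\<close>, in a part. Inside its own part \<open>u\<close> has at most one neighbour,
  so the third vertex lies essentially in the other part.\<close>

lemma card_T1_even:
  assumes no: "\<not> lcyc E (2 * t + 2)"
  shows "real (card T1) \<le> n / 2 + n / 200"
proof -
  note pair = T1_even[OF no]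
  have fT: "finite T1" using finite_triangles[OF fV] by (simp add: T1_def)
  have c3: "card T = 3" if "T \<in> T1" for T using that triangle_card by (auto simp: T1_def)
  have "card T1 \<le> 4 \<or> (\<exists>u v. u \<noteq> v \<and> (\<forall>T\<in>T1. {u, v} \<subseteq> T))"
    by (rule pairwise_two_common[OF fT]) (use c3 pair in auto)
  then show ?thesis
  proof (elim disjE exE conjE)
    fix u v assume uv: "u \<noteq> v" "\<forall>T\<in>T1. {u, v} \<subseteq> T"
    have bound: "real (card T1) \<le> n / 2 + n / 200"
      if u: "u \<in> A \<union> B" "u \<noteq> v" "\<forall>T\<in>T1. {u, v} \<subseteq> T" for u v
    proof -
      have "T1 \<subseteq> (\<lambda>z. {u, v, z}) ` (nb E u \<inter> (A \<union> B) \<union> R)"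
      proof
        fix T assume T: "T \<in> T1"
        have tr: "T \<in> triangles V E" "T \<inter> W = {}" "T \<subseteq> V" using T by (auto simp: T1_def triangles_def)
        have uvT: "u \<in> T" "v \<in> T" using u T by auto
        then have "card (T - {u, v}) = 1" using c3[OF T] u(2) triangle_card[OF tr(1)] by (simp add: card_Diff_subset)
        then obtain z where z: "T - {u, v} = {z}" by (rule card_1_singletonE)
        then have Tz: "T = {u, v, z}" "z \<in> T" "u \<noteq> z" using uvT by auto
        have "z \<in> nb E u" using triangleD[OF tr(1) uvT(1) Tz(2,3)] by (simp add: nb_def)
        moreover have "z \<in> A \<union> B \<union> R" using tr(2,3) Tz(2) by (auto simp: R_def)
        ultimately show "T \<in> (\<lambda>z. {u, v, z}) ` (nb E u \<inter> (A \<union> B) \<union> R)" using Tz(1) by blast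
      qed
      then have "card T1 \<le> card ((\<lambda>z. {u, v, z}) ` (nb E u \<inter> (A \<union> B) \<union> R))" using fin by (intro card_mono) auto
      also have "\<dots> \<le> card (nb E u \<inter> (A \<union> B) \<union> R)" using fin by (intro card_image_le) auto
      also have "\<dots> \<le> dT u + card R" unfolding dT_def by (rule card_Un_le)
      finally have 1: "card T1 \<le> card (nb E u \<inter> A) + card (nb E u \<inter> B) + card R" using dT_split by simp
      have inj: "card (nb E u \<inter> S) \<le> 1" if S: "u \<in> S" "S = A \<or> S = B" for S
      proof -
        have "card (nb E u \<inter> S) \<le> card inner"
        proof (rule card_inj_on_le[of "\<lambda>z. {u, z}"])
          show "inj_on (\<lambda>z. {u, z}) (nb E u \<inter> S)" by (auto simp: inj_on_def doubleton_eq_iff)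
          show "(\<lambda>z. {u, z}) ` (nb E u \<inter> S) \<subseteq> inner" using S by (auto simp: inner_def nb_def)
          show "finite inner" using graph_on_finite[OF g fV] by (simp add: inner_def)
        qed
        then show ?thesis using card_inner_le[OF pair] by simp
      qed
      have "card (nb E u \<inter> A) \<le> card A" "card (nb E u \<inter> B) \<le> card B" using fin by (auto intro: card_mono)
      then have "card (nb E u \<inter> A) + card (nb E u \<inter> B) \<le> 1 + card A \<or> card (nb E u \<inter> A) + card (nb E u \<inter> B) \<le> 1 + card B"
        using u(1) inj[of A] inj[of B] by auto
      then have "real (card T1) \<le> 1 + real (card A) + real (card R) \<or> real (card T1) \<le> 1 + real (card B) + real (card R)"
        using 1 by linarith
      then show ?thesis using size_upper small n_big by linarith
    qed
    show ?thesis
    proof (cases "T1 = {}")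
      case False
      then obtain T where T: "T \<in> T1" by blast
      have "u \<in> A \<union> B \<or> v \<in> A \<union> B"
      proof (rule ccontr)
        assume n: "\<not> ?thesis"
        have "T \<inter> (A \<union> B) \<subseteq> T - {u, v}" using n by auto
        then have "card (T \<inter> (A \<union> B)) \<le> card (T - {u, v})" using c3[OF T] by (intro card_mono) (auto intro: card_ge_0_finite)
        also have "\<dots> = 1" using uv T c3[OF T] by (simp add: card_Diff_subset)
        finally show False using T by (simp add: T1_def)
      qed
      then show ?thesis using bound[of u v] bound[of v u] uv by auto
    qed (use n_big in simp)
  qed (use n_big in linarith)
qed

lemma inner_in_triangle:
  assumes "T \<in> triangles V E" "T \<subseteq> A \<union> B"
  obtains u v where "u \<in> T" "v \<in> T" "u \<noteq> v" "{u, v} \<in> inner"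
proof -
  have c: "card T = 3" "finite T" using triangle_card[OF assms(1)] by auto
  have "T = (T \<inter> A) \<union> (T \<inter> B)" using assms(2) by auto
  then have "card T \<le> card (T \<inter> A) + card (T \<inter> B)" by (metis card_Un_le)
  then have "\<not> card (T \<inter> A) \<le> Suc 0 \<or> \<not> card (T \<inter> B) \<le> Suc 0" using c by linarith
  then obtain u v where uv: "u \<in> T" "v \<in> T" "u \<noteq> v" "{u, v} \<subseteq> A \<or> {u, v} \<subseteq> B"
    using card_le_Suc0_iff_eq[of "T \<inter> A"] card_le_Suc0_iff_eq[of "T \<inter> B"] c(2) by auto
  then show thesis using that[of u v] triangleD[OF assms(1) uv(1-3)] by (simp add: inner_def)
qed

lemma inner_empty: "T1 = {} \<Longrightarrow> inner = {}"
proof (rule ccontr)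
  assume a: "T1 = {}" "inner \<noteq> {}"
  then obtain e where e: "e \<in> inner" by blast
  then have "e \<in> E" by (simp add: inner_def)
  then obtain x y where "e = {x, y}" using graph_on_edge[OF g] by blast
  then show False using inner_common[of x y "{}"] e a(1) by auto
qed

lemma T1_no_inner: "R = {} \<Longrightarrow> inner = {} \<Longrightarrow> T1 = {}"
proof (rule ccontr)
  assume a: "R = {}" "inner = {}" "T1 \<noteq> {}"
  then obtain T where T: "T \<in> T1" by blast
  then have "T \<in> triangles V E" "T \<subseteq> A \<union> B" using V_split(1) a(1) by (auto simp: T1_def triangles_def)
  then show False using inner_in_triangle a(2) by blast
qed

text \<open>Without leftover vertices a triangle in \<open>T1\<close> has two vertices in the same
  part. That edge is the unique edge inside a part, and the third vertex lies in the opposite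
  part.\<close>

lemma card_T1_exact:
  assumes no: "\<not> lcyc E (2 * t + 2)" and R0: "R = {}"
  shows "card T1 \<le> max (card A) (card B)"
proof (cases "inner = {}")
  case True
  then show ?thesis using T1_no_inner R0 by simp
next
  case False
  then obtain e where e: "e \<in> inner" by blast
  have "finite inner" using graph_on_finite[OF g fV] by (simp add: inner_def)
  then have uniq: "e' = e" if "e' \<in> inner" for e'
    using card_inner_le[OF T1_even[OF no]] card_le_Suc0_iff_eq e that by (metis One_nat_def)
  have main: "T1 \<subseteq> (\<lambda>z. insert z e) ` Q" if eS: "e \<subseteq> S" "(S = A \<and> Q = B) \<or> (S = B \<and> Q = A)" for S Q
  proof
    fix T assume T: "T \<in> T1"
    have tr: "T \<in> triangles V E" "T \<subseteq> A \<union> B" using T V_split(1) R0 by (auto simp: T1_def triangles_def)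
    have c: "card T = 3" "finite T" using triangle_card[OF tr(1)] by auto
    obtain u v where uv: "u \<in> T" "v \<in> T" "u \<noteq> v" "{u, v} \<in> inner" by (rule inner_in_triangle[OF tr])
    have euv: "e = {u, v}" using uniq[OF uv(4)] by simp
    have "card (T - {u, v}) = 1" using c uv by (simp add: card_Diff_subset)
    then obtain z where z: "T - {u, v} = {z}" by (rule card_1_singletonE)
    then have zT: "z \<in> T" "u \<noteq> z" "v \<noteq> z" "T = insert z e" using uv euv by auto
    have "z \<in> Q"
    proof (rule ccontr)
      assume "z \<notin> Q"
      then have "z \<in> S" using zT(1) tr(2) eS(2) by auto
      moreover have "{u, z} \<in> E" using triangleD[OF tr(1) uv(1) zT(1,2)] .
      moreover have "u \<in> S" using eS(1) euv by simp
      ultimately have "{u, z} \<in> inner" using eS(2) by (auto simp: inner_def)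
      then have "{u, z} = {u, v}" using uniq euv by simp
      then show False using zT(2,3) by (auto simp: doubleton_eq_iff)
    qed
    then show "T \<in> (\<lambda>z. insert z e) ` Q" using zT(4) by blast
  qed
  have cQ: "card T1 \<le> card Q" if "T1 \<subseteq> (\<lambda>z. insert z e) ` Q" "finite Q" for Q
    using that by (meson card_image_le card_mono finite_imageI le_trans)
  have "e \<subseteq> A \<or> e \<subseteq> B" using e by (simp add: inner_def)
  then show ?thesis using main[of A B] main[of B A] cQ[of A] cQ[of B] fin by (auto simp: max_def)
qed

definition "m = card V - t"

lemma m_real: "real m = n - real t"
  using card_V by (simp add: m_def n_def)

lemma m_R: "R = {} \<Longrightarrow> card A + card B = m"
  using card_V by (simp add: m_def)

lemma upper_odd:
  assumes no: "\<not> lcyc E (2 * t + 1)"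
  shows "card (triangles V E) \<le> (t choose 3) + (t choose 2) * m + t * ((m div 2) * (m - m div 2))"
proof -
  have fr: "free t E" using no by (simp add: free_def)
  have T0: "T1 = {}" using T1_odd[OF no] .
  have i0: "inner = {}" using inner_empty[OF T0] .
  show ?thesis
  proof (cases "R = {}")
    case True
    have G0: "\<Gamma> = {}" using True graph_on_edge[OF graph_ERR(1)] by (auto simp: \<Gamma>_def)
    have "card (triangles V E) \<le> (t choose 3) + (t choose 2) * m + t * (card A * card B)"
      using triangle_count[OF fr] by (simp add: True T0 i0 G0 m_def)
    moreover have "t * (card A * card B) \<le> t * ((m div 2) * (m - m div 2))"
      using balanced_product(1)[OF m_R[OF True]] t by (intro mult_left_mono) auto
    ultimately show ?thesis by linarith
  next
    case False
    define S1 where "S1 = (\<Sum>r\<in>R. dW r * dT r)"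
    define S2 where "S2 = (\<Sum>e\<in>\<Gamma>. card (cT e))"
    define c where "c = (t choose 3) + (t choose 2) * m"
    define r2 where "r2 = card R * card R"
    have "card (triangles V E) \<le> c + t * (card A * card B) + S1 + S2 + (5 * t + 19) * r2"
      using triangle_count[OF fr] by (simp add: T0 i0 m_def S1_def S2_def c_def r2_def algebra_simps)
    then have "real (card (triangles V E)) \<le> real (c + t * (card A * card B) + S1 + S2 + (5 * t + 19) * r2)"
      by (simp only: of_nat_le_iff)
    then have 1: "real (card (triangles V E)) \<le> real c + real t * real (card A * card B) + (real S1 + real S2) + (5 * real t + 19) * real r2"
      by simp
    have 2: "real S1 + real S2 \<le> real (card R) * (real t * n / 2 - n / 20)"
      using weight_odd[OF no] by (simp add: S1_def S2_def)
    have 3: "real t * (real (card A * card B) + 1) + real (card R) * (real t * n / 2 - n / 20)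
      + (5 * real t + 19) * real r2 + n / 100 \<le> real t * ((n - real t)\<^sup>2 - 1) / 4"
      using final_estimate[OF False] by (simp add: r2_def)
    have "real t * (((real m)\<^sup>2 - 1) / 4) \<le> real t * real ((m div 2) * (m - m div 2))"
      using floor_product by (intro mult_left_mono) auto
    then have 4: "real t * ((n - real t)\<^sup>2 - 1) / 4 \<le> real t * real ((m div 2) * (m - m div 2))" by (simp add: m_real)
    have "real t * (real (card A * card B) + 1) = real t * real (card A * card B) + real t" by (simp add: distrib_left)
    then have "real (card (triangles V E)) \<le> real c + real t * real ((m div 2) * (m - m div 2))"
      using 1 2 3 4 n_big(2) by linarith
    then have "real (card (triangles V E)) \<le> real (c + t * ((m div 2) * (m - m div 2)))" by simp
    then show ?thesis unfolding c_def of_nat_le_iff .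
  qed
qed

lemma upper_even:
  assumes no: "\<not> lcyc E (2 * t + 2)"
  shows "card (triangles V E) \<le> (t choose 3) + (t choose 2) * m + t * ((m div 2) * (m - m div 2)) + t + (m - m div 2)"
proof -
  have fr: "free t E" using no by (simp add: free_def)
  have i1: "card inner \<le> 1" using card_inner_le[OF T1_even[OF no]] .
  have it: "t * (card A * card B + card inner) \<le> t * (card A * card B) + t"
    using mult_left_mono[OF i1, of t] by (simp add: distrib_left)
  show ?thesis
  proof (cases "R = {}")
    case True
    have G0: "\<Gamma> = {}" using True graph_on_edge[OF graph_ERR(1)] by (auto simp: \<Gamma>_def)
    have "card (triangles V E) \<le> (t choose 3) + (t choose 2) * m + (t * (card A * card B) + t) + card T1"
      using triangle_count[OF fr] it by (simp add: True G0 m_def)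
    moreover have "card T1 \<le> max (card A) (card B)" by (rule card_T1_exact[OF no True])
    moreover have "1 \<le> t" using t by simp
    note balanced_product(2)[OF m_R[OF True] this]
    ultimately show ?thesis by linarith
  next
    case False
    define S1 where "S1 = (\<Sum>r\<in>R. dW r * dT r)"
    define S2 where "S2 = (\<Sum>e\<in>\<Gamma>. card (cT e))"
    define c where "c = (t choose 3) + (t choose 2) * m"
    define r2 where "r2 = card R * card R"
    have "card (triangles V E) \<le> c + (t * (card A * card B + card inner) + S1 + t * r2) + card T1 + (S2 + 10 * r2) + (4 * t + 9) * r2"
      using triangle_count[OF fr] unfolding m_def S1_def S2_def c_def r2_def .
    moreover have "(5 * t + 19) * r2 = t * r2 + 10 * r2 + (4 * t + 9) * r2" by (simp add: algebra_simps)
    ultimately have "card (triangles V E) \<le> c + (t * (card A * card B) + t) + S1 + S2 + (5 * t + 19) * r2 + card T1"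
      using it by linarith
    then have "real (card (triangles V E)) \<le> real (c + (t * (card A * card B) + t) + S1 + S2 + (5 * t + 19) * r2 + card T1)"
      by (simp only: of_nat_le_iff)
    then have 1: "real (card (triangles V E)) \<le> real c + real t * real (card A * card B) + real t + (real S1 + real S2) + (5 * real t + 19) * real r2 + real (card T1)"
      by simp
    have 2: "real S1 + real S2 \<le> real (card R) * (real t * n / 2 - n / 20)"
      using weight_even[OF no] by (simp add: S1_def S2_def)
    have 3: "real t * (real (card A * card B) + 1) + real (card R) * (real t * n / 2 - n / 20)
      + (5 * real t + 19) * real r2 + n / 100 \<le> real t * ((n - real t)\<^sup>2 - 1) / 4"
      using final_estimate[OF False] by (simp add: r2_def)
    have "real t * (((real m)\<^sup>2 - 1) / 4) \<le> real t * real ((m div 2) * (m - m div 2))"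
      using floor_product by (intro mult_left_mono) auto
    then have 4: "real t * ((n - real t)\<^sup>2 - 1) / 4 \<le> real t * real ((m div 2) * (m - m div 2))" by (simp add: m_real)
    have 5: "real t * (real (card A * card B) + 1) = real t * real (card A * card B) + real t" by (simp add: distrib_left)
    \<comment> \<open>The larger half of \<open>m\<close> is at least \<open>n / 2 - t / 2\<close>,
      which has to pay for \<open>T1\<close>.\<close>
    have "real (m div 2) \<le> real m / 2" by linarith
    then have 6: "n / 2 - real t / 2 \<le> real (m - m div 2)" using m_real by (simp add: of_nat_diff)
    have "real (card (triangles V E)) \<le> real c + real t * real ((m div 2) * (m - m div 2)) + real t + real (m - m div 2)"
      using 1 2 3 4 5 6 card_T1_even[OF no] n_big(2,3) by linarith
    then have "real (card (triangles V E)) \<le> real (c + t * ((m div 2) * (m - m div 2)) + t + (m - m div 2))" by simp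
    then show ?thesis unfolding c_def of_nat_le_iff .
  qed
qed

end

section \<open>The upper bound for all large graphs\<close>

text \<open>Triangles of the join of \<open>t\<close> centres with a balanced complete bipartite
  graph, sorted by the number of centres: three, two, one.\<close>

definition extremal_count :: "nat \<Rightarrow> nat \<Rightarrow> nat" where
  "extremal_count t n = (t choose 3) + (t choose 2) * (n - t) + t * (((n - t) div 2) * ((n - t) - (n - t) div 2))"

lemma extremal_count_lower:
  assumes "1 \<le> t" "t \<le> n"
  shows "real t * (real n)\<^sup>2 / 4 - real t * real t * real n \<le> real (extremal_count t n)"
proof -
  have 1: "1 \<le> real t" "real t \<le> real n" using assms by auto
  have "real t * (((real (n - t))\<^sup>2 - 1) / 4) \<le> real t * real (((n - t) div 2) * ((n - t) - (n - t) div 2))"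
    by (intro mult_left_mono floor_product) simp
  also have "\<dots> \<le> real (extremal_count t n)" by (simp add: extremal_count_def)
  finally have "real t * (((real n - real t)\<^sup>2 - 1) / 4) \<le> real (extremal_count t n)" using assms by (simp add: of_nat_diff)
  moreover have "real t * (((real n - real t)\<^sup>2 - 1) / 4) = real t * (real n)\<^sup>2 / 4 - real t * real t * real n / 2 + real t * (real t * real t - 1) / 4"
    by (simp add: power2_eq_square field_simps)
  moreover have "0 \<le> real t * (real t * real t - 1)" using mult_mono[of 1 "real t" 1 "real t"] 1 by simp
  moreover have "0 \<le> real t * real t * real n" by simp
  ultimately show ?thesis by linarith
qed

text \<open>A free graph with clearly fewer triangles than \<open>extremal_count\<close> satisfies
  the bounds trivially, and any other free graph has the near-extremal structure. Enlarging the
  parts to a maximal pair turns it into an instance of \<open>near_extremal\<close>.\<close>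

lemma triangles_upper_bound:
  assumes t: "2 \<le> t"
  shows "\<exists>N. \<forall>(V :: 'a set) E. graph_on V E \<longrightarrow> finite V \<longrightarrow> N \<le> card V \<longrightarrow>
    (\<not> lcyc E (2 * t + 1) \<longrightarrow> card (triangles V E) \<le> extremal_count t (card V)) \<and>
    (\<not> lcyc E (2 * t + 2) \<longrightarrow> card (triangles V E) \<le> extremal_count t (card V) + t + ((card V - t) - (card V - t) div 2))"
proof -
  define \<beta> where "\<beta> = 1 / (2000 * real t)"
  have \<beta>: "0 < \<beta>" "\<beta> \<le> 1 / 6" using t by (auto simp: \<beta>_def field_simps)
  obtain N0 where N0: "\<forall>(V :: 'a set) E. graph_on V E \<longrightarrow> finite V \<longrightarrow> N0 \<le> card V \<longrightarrow> free t E \<longrightarrow>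
    real t * (real (card V))\<^sup>2 / 4 - real t * real t * real (card V) \<le> real (card (triangles V E)) \<longrightarrow>
    (\<exists>W A B. finite W \<and> card W = t \<and> A \<subseteq> V \<and> B \<subseteq> V \<and> A \<inter> B = {} \<and>
      real (card V) / 2 - \<beta> * real (card V) \<le> real (card A) \<and> real (card V) / 2 - \<beta> * real (card V) \<le> real (card B) \<and>
      (\<forall>w\<in>W. \<forall>x\<in>A \<union> B. {w, x} \<in> E) \<and>
      (\<forall>a\<in>A. real (card V) / 2 - \<beta> * real (card V) \<le> real (card (nb E a \<inter> B))) \<and>
      (\<forall>b\<in>B. real (card V) / 2 - \<beta> * real (card V) \<le> real (card (nb E b \<inter> A))))"
    using near_extremal_structure[OF t \<beta>(1), of "real t * real t"] by (elim exE) (rule that)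
  show ?thesis
  proof (intro exI[of _ "N0 + 100000 * t * t"] allI impI)
    fix V :: "'a set" and E
    assume g: "graph_on V E" and fV: "finite V" and nN: "N0 + 100000 * t * t \<le> card V"
    have big: "100000 * real t * real t \<le> real (card V)"
      using nN by (metis add_leD2 of_nat_le_iff of_nat_mult of_nat_numeral)
    have "t * 1 \<le> t * t" using t by (intro mult_le_mono) auto
    then have "t \<le> 100000 * t * t" by simp
    then have tn: "t \<le> card V" using nN by linarith
    show "(\<not> lcyc E (2 * t + 1) \<longrightarrow> card (triangles V E) \<le> extremal_count t (card V)) \<and>
      (\<not> lcyc E (2 * t + 2) \<longrightarrow> card (triangles V E) \<le> extremal_count t (card V) + t + ((card V - t) - (card V - t) div 2))"
    proof (cases "free t E \<and> real t * (real (card V))\<^sup>2 / 4 - real t * real t * real (card V) \<le> real (card (triangles V E))")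
      case False
      have "card (triangles V E) \<le> extremal_count t (card V)" if "free t E"
        using False that extremal_count_lower[OF _ tn] t by fastforce
      then show ?thesis by (auto simp: free_def)
    next
      case True
      obtain W A0 B0 where WAB: "finite W" "card W = t" "A0 \<subseteq> V" "B0 \<subseteq> V" "A0 \<inter> B0 = {}"
        "real (card V) / 2 - \<beta> * real (card V) \<le> real (card A0)" "real (card V) / 2 - \<beta> * real (card V) \<le> real (card B0)"
        "\<forall>w\<in>W. \<forall>x\<in>A0 \<union> B0. {w, x} \<in> E"
        "\<forall>a\<in>A0. real (card V) / 2 - \<beta> * real (card V) \<le> real (card (nb E a \<inter> B0))"
        "\<forall>b\<in>B0. real (card V) / 2 - \<beta> * real (card V) \<le> real (card (nb E b \<inter> A0))"
        using N0[rule_format, OF g fV add_leD1[OF nN] conjunct1[OF True] conjunct2[OF True]] by (elim exE conjE) (rule that)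
      \<comment> \<open>The degrees are relaxed to \<open>n / 3\<close> here, so that
        \<open>P\<close> survives the addition of any vertex that is joined to \<open>W\<close> and
        has \<open>n / 3\<close> neighbours in one part. A pair with the largest total size then
        satisfies \<open>maximal\<close>.\<close>
      define P where "P p \<longleftrightarrow> fst p \<subseteq> V \<and> snd p \<subseteq> V \<and> fst p \<inter> snd p = {} \<and>
        real (card V) / 2 - \<beta> * real (card V) \<le> real (card (fst p)) \<and> real (card V) / 2 - \<beta> * real (card V) \<le> real (card (snd p)) \<and>
        (\<forall>w\<in>W. \<forall>x\<in>fst p \<union> snd p. {w, x} \<in> E) \<and>
        (\<forall>a\<in>fst p. real (card V) / 3 \<le> real (card (nb E a \<inter> snd p))) \<and>
        (\<forall>b\<in>snd p. real (card V) / 3 \<le> real (card (nb E b \<inter> fst p)))" for p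
      have "\<beta> * real (card V) \<le> 1 / 6 * real (card V)" using \<beta>(2) by (rule mult_right_mono) simp
      then have third: "real (card V) / 3 \<le> real (card V) / 2 - \<beta> * real (card V)" by simp
      have P0: "P (A0, B0)" unfolding P_def fst_conv snd_conv
        using WAB(3-8) order_trans[OF third bspec[OF WAB(9)]] order_trans[OF third bspec[OF WAB(10)]] by (intro conjI ballI) blast+
      define f where "f p = card (fst p) + card (snd p)" for p :: "'a set \<times> 'a set"
      have "\<forall>p. P p \<longrightarrow> f p < card V + card V + 1"
        using card_mono[OF fV] unfolding P_def f_def by (meson add_mono less_add_one order_le_less_trans)
      then obtain p where p: "P p" "\<forall>q. P q \<longrightarrow> f q \<le> f p" using ex_has_greatest_nat[of P "(A0, B0)" f, OF P0] by blast
      define A where "A = fst p"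
      define B where "B = snd p"
      have fAB: "finite A" "finite B" using p(1) finite_subset[OF _ fV] by (auto simp: P_def A_def B_def)
      have PAB: "A \<subseteq> V" "B \<subseteq> V" "A \<inter> B = {}"
        "real (card V) / 2 - \<beta> * real (card V) \<le> real (card A)" "real (card V) / 2 - \<beta> * real (card V) \<le> real (card B)"
        "\<And>w x. w \<in> W \<Longrightarrow> x \<in> A \<union> B \<Longrightarrow> {w, x} \<in> E"
        "\<And>a. a \<in> A \<Longrightarrow> real (card V) / 3 \<le> real (card (nb E a \<inter> B))"
        "\<And>b. b \<in> B \<Longrightarrow> real (card V) / 3 \<le> real (card (nb E b \<inter> A))"
        using p(1) unfolding P_def A_def B_def by blast+
      have grow: "real (card (nb E x \<inter> S)) \<le> real (card (nb E x \<inter> insert r S))" if "finite S" for x r S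
        using that by (intro of_nat_mono card_mono) auto
      have max: "real (card (nb E r \<inter> A)) < real (card V) / 3 \<and> real (card (nb E r \<inter> B)) < real (card V) / 3"
        if r: "r \<in> V - (W \<union> A \<union> B)" "W \<subseteq> nb E r" for r
      proof (rule ccontr)
        assume no: "\<not> ?thesis"
        have rW: "{w, r} \<in> E" if "w \<in> W" for w using r(2) that by (auto simp: nb_def insert_commute)
        have rr: "r \<in> V" "r \<notin> A" "r \<notin> B" using r by auto
        have cc: "real (card S) \<le> real (card (insert r S))" if "finite S" for S using that by (simp add: card_insert_if)
        show False
        proof (cases "real (card V) / 3 \<le> real (card (nb E r \<inter> B))")
          case True
          have "P (insert r A, B)" unfolding P_def fst_conv snd_conv
          proof (intro conjI ballI)
            show "real (card V) / 2 - \<beta> * real (card V) \<le> real (card (insert r A))" using PAB(4) cc[OF fAB(1)] by linarith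
            show "{w, x} \<in> E" if "w \<in> W" "x \<in> insert r A \<union> B" for w x using that PAB(6) rW by auto
            show "real (card V) / 3 \<le> real (card (nb E a \<inter> B))" if "a \<in> insert r A" for a using that PAB(7) True by auto
            show "real (card V) / 3 \<le> real (card (nb E b \<inter> insert r A))" if "b \<in> B" for b
              using PAB(8)[OF that] grow[OF fAB(1), of b r] by linarith
          qed (use PAB rr in auto)
          then have "f (insert r A, B) \<le> f p" using p(2) by blast
          then show False using rr fAB by (simp add: f_def A_def[symmetric] B_def[symmetric])
        next
          case False
          then have True': "real (card V) / 3 \<le> real (card (nb E r \<inter> A))" using no by linarith
          have "P (A, insert r B)" unfolding P_def fst_conv snd_conv
          proof (intro conjI ballI)
            show "real (card V) / 2 - \<beta> * real (card V) \<le> real (card (insert r B))" using PAB(5) cc[OF fAB(2)] by linarith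
            show "{w, x} \<in> E" if "w \<in> W" "x \<in> A \<union> insert r B" for w x using that PAB(6) rW by auto
            show "real (card V) / 3 \<le> real (card (nb E b \<inter> A))" if "b \<in> insert r B" for b using that PAB(8) True' by auto
            show "real (card V) / 3 \<le> real (card (nb E a \<inter> insert r B))" if "a \<in> A" for a
              using PAB(7)[OF that] grow[OF fAB(2), of a r] by linarith
          qed (use PAB rr in auto)
          then have "f (A, insert r B) \<le> f p" using p(2) by blast
          then show False using rr fAB by (simp add: f_def A_def[symmetric] B_def[symmetric])
        qed
      qed
      interpret ne: near_extremal V E t W A B
        by unfold_locales (use g fV t WAB(1,2) PAB max big in \<open>auto simp: \<beta>_def\<close>)
      show ?thesis using ne.upper_odd ne.upper_even by (simp add: extremal_count_def ne.m_def)
    qed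
  qed
qed

subsection \<open>The lower bound\<close>

text \<open>A blow-up of a cycle of length \<open>k\<close> contains \<open>k\<close> edge-disjoint triangles with every vertex in at
  most two of them, so \<open>t\<close> centres meet at most \<open>2 * t\<close> of these triangles.\<close>
lemma copy_triangles:
  assumes k: "3 \<le> k" and g: "graph_on V E"
    and cc: "contains_copy (blowup_V (cycle_V k) (cycle_E k)) (blowup_E (cycle_V k) (cycle_E k)) V E"
  obtains T :: "nat \<Rightarrow> 'a set" where "\<And>i. i < k \<Longrightarrow> T i \<in> triangles V E"
    "\<And>v. card {i. i < k \<and> v \<in> T i} \<le> 2"
    "\<And>i j u v. i < k \<Longrightarrow> j < k \<Longrightarrow> u \<noteq> v \<Longrightarrow> {u, v} \<subseteq> T i \<Longrightarrow> {u, v} \<subseteq> T j \<Longrightarrow> i = j"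
proof -
  define X where "X = blowup_V (cycle_V k) (cycle_E k)"
  obtain f where f: "inj_on f X" "f ` X \<subseteq> V" "\<And>e. e \<in> blowup_E (cycle_V k) (cycle_E k) \<Longrightarrow> f ` e \<in> E"
    using cc unfolding contains_copy_def X_def by blast
  define s where "s i = (i + 1) mod k" for i
  have sk: "s i < k" for i using k by (simp add: s_def)
  define S where "S i = {Inl i, Inl (s i), Inr {i, s i}}" for i :: nat
  have SX: "S i \<subseteq> X" if "i < k" for i
    using that sk unfolding S_def X_def blowup_V_def cycle_V_def cycle_E_def s_def by auto
  have ce: "{i, s i} \<in> cycle_E k" if "i < k" for i using that by (auto simp: cycle_E_def s_def)
  have be: "f ` {Inl i, Inl (s i)} \<in> E" "f ` {Inl i, Inr {i, s i}} \<in> E" "f ` {Inl (s i), Inr {i, s i}} \<in> E" if "i < k" for i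
  proof -
    have "{Inl i, Inl (s i)} = Inl ` {i, s i}" by simp
    then show "f ` {Inl i, Inl (s i)} \<in> E" using ce[OF that] by (intro f(3)) (unfold blowup_E_def, blast)
    show "f ` {Inl i, Inr {i, s i}} \<in> E" using ce[OF that] by (intro f(3)) (unfold blowup_E_def, blast)
    show "f ` {Inl (s i), Inr {i, s i}} \<in> E" using ce[OF that] by (intro f(3)) (unfold blowup_E_def, blast)
  qed
  have tri: "f ` S i \<in> triangles V E" if "i < k" for i
    using triangleI[OF g, of "f (Inl i)" "f (Inl (s i))" "f (Inr {i, s i})"] be[OF that] by (simp add: S_def)
  have cyc: "i = j" if "i < k" "j < k" "{i, s i} = {j, s j}" for i j
    using cycle_edge_inj[OF k that(1,2)] that(3) by (simp add: s_def)
  have inj_s: "i = j" if "i < k" "j < k" "s i = s j" for i j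
    using that by (auto simp: s_def mod_if split: if_splits)
  have cnt: "card {i. i < k \<and> x \<in> S i} \<le> 2" for x
  proof (cases x)
    case (Inl j)
    define Q where "Q = {i. i < k \<and> s i = j}"
    have Q: "finite Q" "card Q \<le> Suc 0"
      using inj_s by (auto simp: Q_def card_le_Suc0_iff_eq)
    have "{i. i < k \<and> x \<in> S i} \<subseteq> insert j Q" using Inl by (auto simp: S_def Q_def)
    then have "card {i. i < k \<and> x \<in> S i} \<le> card (insert j Q)" using Q(1) by (intro card_mono) auto
    then show ?thesis using card_insert_bound[OF Q(1), of j] Q(2) by linarith
  next
    case (Inr e)
    have "card {i. i < k \<and> x \<in> S i} \<le> Suc 0"
      using cyc Inr by (subst card_le_Suc0_iff_eq) (auto simp: S_def)
    then show ?thesis by simp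
  qed
  show thesis
  proof (rule that[of "\<lambda>i. f ` S i"])
    show "f ` S i \<in> triangles V E" if "i < k" for i using tri[OF that] .
    show "card {i. i < k \<and> v \<in> f ` S i} \<le> 2" for v
    proof (cases "\<exists>x\<in>X. f x = v")
      case True
      then obtain x where x: "x \<in> X" "f x = v" by blast
      have "{i. i < k \<and> v \<in> f ` S i} = {i. i < k \<and> x \<in> S i}"
        using x SX f(1) by (auto simp: inj_on_def)
      then show ?thesis using cnt by simp
    next
      case False
      then have e: "{i. i < k \<and> v \<in> f ` S i} = {}" using SX by auto
      show ?thesis unfolding e by simp
    qed
    show "i = j" if ij: "i < k" "j < k" and uv: "u \<noteq> v" "{u, v} \<subseteq> f ` S i" "{u, v} \<subseteq> f ` S j" for i j u v
    proof -
      note int = inj_on_image_Int[OF f(1) SX[OF ij(1)] SX[OF ij(2)]]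
      have "u \<in> f ` (S i \<inter> S j)" "v \<in> f ` (S i \<inter> S j)" unfolding int using uv(2,3) by auto
      then obtain a b where ab: "a \<in> S i \<inter> S j" "b \<in> S i \<inter> S j" "u = f a" "v = f b" by (elim imageE)
      then have ab: "a \<in> S i \<inter> S j" "b \<in> S i \<inter> S j" "a \<noteq> b" using uv(1) by auto
      show ?thesis
      proof (rule ccontr)
        assume ne: "i \<noteq> j"
        then have e: "{i, s i} \<noteq> {j, s j}" using cyc ij by blast
        \<comment> \<open>The new vertices of different triangles differ, so a common vertex lies on
          the cycle itself. Two common vertices would make the two cycle edges equal.\<close>
        have "a \<in> {Inl i, Inl (s i)} \<inter> {Inl j, Inl (s j)}" "b \<in> {Inl i, Inl (s i)} \<inter> {Inl j, Inl (s j)}"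
          using ab e by (auto simp: S_def)
        then have "{a, b} \<subseteq> {Inl i, Inl (s i)}" "{a, b} \<subseteq> {Inl j, Inl (s j)}" by auto
        then have "{a, b} = Inl ` {i, s i}" "{a, b} = Inl ` {j, s j}" using ab(3) by auto
        then have "Inl ` {i, s i} = (Inl ` {j, s j} :: (nat + nat set) set)" by (rule trans[OF sym])
        then show False using e inj_image_eq_iff[OF inj_Inl] by blast
      qed
    qed
  qed
qed

lemma S_edges_iff:
  "{u, v} \<in> S_edges n t \<longleftrightarrow> u < n \<and> v < n \<and> u \<noteq> v \<and> (u < t \<or> v < t \<or>
    (t \<le> u \<and> u < t + (n - t) div 2 \<and> t + (n - t) div 2 \<le> v) \<or> (t \<le> v \<and> v < t + (n - t) div 2 \<and> t + (n - t) div 2 \<le> u))"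
  unfolding S_edges_def by (auto simp: doubleton_eq_iff) 

lemma S_edges_graph: "graph_on {0..<n} (S_edges n t)"
  unfolding graph_on_def S_edges_def by auto

lemma Splus_edges_graph: "t + 1 < n \<Longrightarrow> graph_on {0..<n} (Splus_edges n t)"
  using S_edges_graph[of n t] by (auto simp: graph_on_def Splus_edges_def)

lemma triangle_elements:
  assumes "T \<in> triangles V E"
  obtains x y z where "T = {x, y, z}" "x \<noteq> y" "x \<noteq> z" "y \<noteq> z" "{x, y} \<in> E" "{x, z} \<in> E" "{y, z} \<in> E"
proof -
  have "card T = 3" using triangle_card[OF assms] by simp
  then obtain x y z where T: "T = {x, y, z}" "x \<noteq> y" "x \<noteq> z" "y \<noteq> z" by (auto simp: card_3_iff)
  then show thesis using that triangleD[OF assms] by blast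
qed

lemma S_triangle_centre: "T \<in> triangles {0..<n} (S_edges n t) \<Longrightarrow> T \<inter> {..<t} \<noteq> {}"
proof
  assume T: "T \<in> triangles {0..<n} (S_edges n t)" and e: "T \<inter> {..<t} = {}"
  obtain x y z where xyz: "T = {x, y, z}" "{x, y} \<in> S_edges n t" "{x, z} \<in> S_edges n t" "{y, z} \<in> S_edges n t"
    by (rule triangle_elements[OF T])
  have "\<not> x < t" "\<not> y < t" "\<not> z < t" using e xyz(1) by auto
  then show False using xyz(2-4) unfolding S_edges_iff by linarith
qed

lemma Splus_triangle_centre:
  assumes T: "T \<in> triangles {0..<n} (Splus_edges n t)" and e: "T \<inter> {..<t} = {}"
  shows "{t, t + 1} \<subseteq> T"
proof (rule ccontr)
  assume n: "\<not> {t, t + 1} \<subseteq> T"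
  have "T \<in> triangles {0..<n} (S_edges n t)"
    unfolding triangles_def
  proof (intro CollectI conjI ballI impI)
    show "T \<subseteq> {0..<n}" "card T = 3" using T by (auto simp: triangles_def)
    fix x y assume xy: "x \<in> T" "y \<in> T" "x \<noteq> y"
    then have "{x, y} \<in> Splus_edges n t" using triangleD[OF T] by blast
    moreover have "{x, y} \<noteq> {t, t + 1}" using n xy by (auto simp: doubleton_eq_iff)
    ultimately show "{x, y} \<in> S_edges n t" by (simp add: Splus_edges_def)
  qed
  then show False using S_triangle_centre e by blast
qed

lemma centre_count:
  fixes t :: nat
  assumes "\<And>v. card {i. i < k \<and> v \<in> T i} \<le> 2"
  shows "card {i. i < k \<and> T i \<inter> {..<t} \<noteq> {}} \<le> 2 * t"
proof -
  have "{i. i < k \<and> T i \<inter> {..<t} \<noteq> {}} = (\<Union>v\<in>{..<t}. {i. i < k \<and> v \<in> T i})" by auto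
  also have "card \<dots> \<le> (\<Sum>v\<in>{..<t}. card {i. i < k \<and> v \<in> T i})" by (rule card_UN_le) simp
  also have "\<dots> \<le> (\<Sum>v\<in>{..<t}. 2)" using assms by (rule sum_mono)
  finally show ?thesis by simp
qed

text \<open>All \<open>2 * t + 1\<close> triangles of a copy contain a centre, but the centres meet
  at most \<open>2 * t\<close> of them.\<close>

lemma S_no_copy:
  assumes "2 \<le> t"
  shows "\<not> contains_copy (blowup_V (cycle_V (2 * t + 1)) (cycle_E (2 * t + 1))) (blowup_E (cycle_V (2 * t + 1)) (cycle_E (2 * t + 1))) {0..<n} (S_edges n t)"
proof
  assume c: "contains_copy (blowup_V (cycle_V (2 * t + 1)) (cycle_E (2 * t + 1))) (blowup_E (cycle_V (2 * t + 1)) (cycle_E (2 * t + 1))) {0..<n} (S_edges n t)"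
  have k: "3 \<le> 2 * t + 1" using assms by simp
  obtain T where T: "\<And>i. i < 2 * t + 1 \<Longrightarrow> T i \<in> triangles {0..<n} (S_edges n t)"
    "\<And>v. card {i. i < 2 * t + 1 \<and> v \<in> T i} \<le> 2"
    by (rule copy_triangles[OF k S_edges_graph c]) blast
  have "{i. i < 2 * t + 1 \<and> T i \<inter> {..<t} \<noteq> {}} = {..<2 * t + 1}" using T(1) S_triangle_centre by auto
  then have "card {..<2 * t + 1} \<le> 2 * t" using centre_count[of "2 * t + 1" T t, OF T(2)] by simp
  then show False by simp
qed

text \<open>Of the \<open>2 * t + 2\<close> triangles of a copy, at most \<open>2 * t\<close> meet
  the centres. The others contain the added edge, and as the triangles are edge-disjoint there is at
  most one of these.\<close>

lemma Splus_no_copy: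
  assumes "2 \<le> t" "t + 1 < n"
  shows "\<not> contains_copy (blowup_V (cycle_V (2 * t + 2)) (cycle_E (2 * t + 2))) (blowup_E (cycle_V (2 * t + 2)) (cycle_E (2 * t + 2))) {0..<n} (Splus_edges n t)"
proof
  assume c: "contains_copy (blowup_V (cycle_V (2 * t + 2)) (cycle_E (2 * t + 2))) (blowup_E (cycle_V (2 * t + 2)) (cycle_E (2 * t + 2))) {0..<n} (Splus_edges n t)"
  have k: "3 \<le> 2 * t + 2" using assms by simp
  obtain T where T: "\<And>i. i < 2 * t + 2 \<Longrightarrow> T i \<in> triangles {0..<n} (Splus_edges n t)"
    "\<And>v. card {i. i < 2 * t + 2 \<and> v \<in> T i} \<le> 2"
    "\<And>i j u v. i < 2 * t + 2 \<Longrightarrow> j < 2 * t + 2 \<Longrightarrow> u \<noteq> v \<Longrightarrow> {u, v} \<subseteq> T i \<Longrightarrow> {u, v} \<subseteq> T j \<Longrightarrow> i = j"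
    by (rule copy_triangles[OF k Splus_edges_graph[OF assms(2)] c]) blast
  define P where "P = {i. i < 2 * t + 2 \<and> T i \<inter> {..<t} \<noteq> {}}"
  define Q where "Q = {i. i < 2 * t + 2 \<and> T i \<inter> {..<t} = {}}"
  have fin: "finite P" "finite Q" by (auto simp: P_def Q_def)
  have "card P \<le> 2 * t" unfolding P_def by (rule centre_count[OF T(2)])
  moreover have "i = j" if "i \<in> Q" "j \<in> Q" for i j
    using T(3)[of i j t "t + 1"] Splus_triangle_centre[OF T(1)] that by (auto simp: Q_def)
  then have "card Q \<le> Suc 0" using fin(2) by (subst card_le_Suc0_iff_eq) auto
  moreover have "{..<2 * t + 2} = P \<union> Q" by (auto simp: P_def Q_def)
  then have "2 * t + 2 = card (P \<union> Q)" by (metis card_lessThan)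
  then have "2 * t + 2 \<le> card P + card Q" using card_Un_le[of P Q] by simp
  ultimately show False by linarith
qed

text \<open>This direction carries the bound by \<open>extremal_count\<close> over to
  \<open>card (S_bi n t)\<close>, which is attained because \<open>S_edges\<close> contains no
  copy.\<close>

lemma card_S_bi:
  assumes "t \<le> n"
  shows "extremal_count t n \<le> card (S_bi n t)"
proof -
  define q where "q = t + (n - t) div 2"
  have q: "t \<le> q" "q \<le> n" "q - t = (n - t) div 2" "n - q = (n - t) - (n - t) div 2" using assms by (auto simp: q_def)
  define F3 where "F3 = {T. T \<subseteq> {..<t} \<and> card T = 3}"
  define D2 where "D2 = {p. p \<subseteq> {..<t} \<and> card p = 2} \<times> {t..<n}"
  define F2 where "F2 = (\<lambda>p. insert (snd p) (fst p)) ` D2"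
  define D1 where "D1 = {..<t} \<times> {t..<q} \<times> {q..<n}"
  define F1 where "F1 = (\<lambda>p. {fst p, fst (snd p), snd (snd p)}) ` D1"
  have i2: "insert v p \<inter> {..<t} = p" "insert v p - {..<t} = {v}" if "(p, v) \<in> D2" for p v using that by (auto simp: D2_def)
  have i1: "{w, a, b} \<inter> {..<t} = {w}" "{w, a, b} \<inter> {t..<q} = {a}" "{w, a, b} \<inter> {q..<n} = {b}" if "(w, a, b) \<in> D1" for w a b
    using that q by (auto simp: D1_def)
  have inj2: "inj_on (\<lambda>p. insert (snd p) (fst p)) D2"
  proof (rule inj_onI)
    fix x y assume xy: "x \<in> D2" "y \<in> D2" "insert (snd x) (fst x) = insert (snd y) (fst y)"
    have "fst x = fst y" using i2(1)[of "fst x" "snd x"] i2(1)[of "fst y" "snd y"] xy by simp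
    moreover have "{snd x} = {snd y}" using i2(2)[of "fst x" "snd x"] i2(2)[of "fst y" "snd y"] xy by simp
    ultimately show "x = y" by (simp add: prod_eq_iff)
  qed
  have inj1: "inj_on (\<lambda>p. {fst p, fst (snd p), snd (snd p)}) D1"
  proof (rule inj_onI)
    fix x y assume xy: "x \<in> D1" "y \<in> D1" "{fst x, fst (snd x), snd (snd x)} = {fst y, fst (snd y), snd (snd y)}"
    have m: "(fst x, fst (snd x), snd (snd x)) \<in> D1" "(fst y, fst (snd y), snd (snd y)) \<in> D1" using xy by auto
    have "{fst x} = {fst y}" "{fst (snd x)} = {fst (snd y)}" "{snd (snd x)} = {snd (snd y)}"
      using i1[OF m(1)] i1[OF m(2)] xy(3) by metis+
    then show "x = y" by (simp add: prod_eq_iff)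
  qed
  have c3: "card F3 = t choose 3" unfolding F3_def using n_subsets[of "{..<t}" 3] by simp
  have "card D2 = (t choose 2) * (n - t)" unfolding D2_def using n_subsets[of "{..<t}" 2] by (simp add: card_cartesian_product)
  then have c2: "card F2 = (t choose 2) * (n - t)" unfolding F2_def using card_image[OF inj2] by simp
  have "card D1 = t * (((n - t) div 2) * ((n - t) - (n - t) div 2))"
    unfolding D1_def using q by (simp add: card_cartesian_product)
  then have c1: "card F1 = t * (((n - t) div 2) * ((n - t) - (n - t) div 2))" unfolding F1_def using card_image[OF inj1] by simp
  have k3: "card (T \<inter> {..<t}) = 3" if "T \<in> F3" for T
  proof -
    have "T \<inter> {..<t} = T" using that by (auto simp: F3_def)
    then show ?thesis using that by (simp add: F3_def)
  qed
  have k2: "card (T \<inter> {..<t}) = 2" if "T \<in> F2" for T using that i2(1) by (auto simp: F2_def D2_def)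
  have k1: "card (T \<inter> {..<t}) = 1" if "T \<in> F1" for T using that i1(1) unfolding F1_def by fastforce
  have fin: "finite F3" "finite F2" "finite F1" by (auto simp: F3_def F2_def F1_def D2_def D1_def)
  have dis: "F3 \<inter> F2 = {}" "(F3 \<union> F2) \<inter> F1 = {}" using k3 k2 k1 by fastforce+
  have "F3 \<union> F2 \<union> F1 \<subseteq> S_bi n t"
  proof (intro Un_least subsetI)
    fix T assume T: "T \<in> F3"
    then show "T \<in> S_bi n t" using assms by (auto simp: F3_def S_bi_def triangles_def S_edges_iff)
  next
    fix T assume "T \<in> F2"
    then obtain p v where pv: "(p, v) \<in> D2" "T = insert v p" by (auto simp: F2_def)
    then have "p \<subseteq> {..<t}" "card p = 2" "finite p" "t \<le> v" "v < n" by (auto simp: D2_def intro: card_ge_0_finite)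
    then show "T \<in> S_bi n t" using assms pv(2) by (auto simp: S_bi_def triangles_def S_edges_iff card_insert_if)
  next
    fix T assume "T \<in> F1"
    then obtain w a b where wab: "(w, a, b) \<in> D1" "T = {w, a, b}" by (auto simp: F1_def)
    then have "w < t" "t \<le> a" "a < q" "q \<le> b" "b < n" by (auto simp: D1_def)
    then show "T \<in> S_bi n t" unfolding S_bi_def wab(2)
      by (intro triangleI[OF S_edges_graph]) (auto simp: S_edges_iff q_def)
  qed
  then have "card (F3 \<union> F2 \<union> F1) \<le> card (S_bi n t)"
    by (intro card_mono) (auto simp: S_bi_def intro: finite_triangles)
  moreover have "card (F3 \<union> F2 \<union> F1) = card F3 + card F2 + card F1"
    using fin dis by (simp add: card_Un_disjoint)
  ultimately show ?thesis using c1 c2 c3 by (simp add: extremal_count_def)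
qed

text \<open>The added edge forms a triangle with each of the \<open>t\<close> centres and with each
  vertex of the larger part. The 4 guarantees that the smaller part has at least two vertices, so
  that the edge fits inside it.\<close>

lemma card_S_bi_plus:
  assumes "t + 4 \<le> n"
  shows "extremal_count t n + t + ((n - t) - (n - t) div 2) \<le> card (S_bi_plus n t)"
proof -
  define q where "q = t + (n - t) div 2"
  have q: "t + 1 < q" "q \<le> n" "n - q = (n - t) - (n - t) div 2" using assms by (auto simp: q_def)
  define G where "G = (\<lambda>x. {t, t + 1, x}) ` ({..<t} \<union> {q..<n})"
  have gp: "graph_on {0..<n} (Splus_edges n t)" using assms by (intro Splus_edges_graph) simp
  have "inj_on (\<lambda>x. {t, t + 1, x}) ({..<t} \<union> {q..<n})"
  proof (rule inj_onI)
    fix x y assume xy: "x \<in> {..<t} \<union> {q..<n}" "y \<in> {..<t} \<union> {q..<n}" "{t, t + 1, x} = {t, t + 1, y}"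
    have "x \<noteq> t" "x \<noteq> t + 1" using xy(1) q(1) by auto
    then show "x = y" using xy(3) by blast
  qed
  then have "card G = card ({..<t} \<union> {q..<n})" unfolding G_def by (rule card_image)
  also have "\<dots> = t + (n - q)" using q(1) by (subst card_Un_disjoint) auto
  finally have cG: "card G = t + ((n - t) - (n - t) div 2)" using q(3) by simp
  have sub: "S_bi n t \<subseteq> S_bi_plus n t" by (auto simp: S_bi_def S_bi_plus_def triangles_def Splus_edges_def)
  have "G \<subseteq> S_bi_plus n t"
  proof
    fix T assume "T \<in> G"
    then obtain x where x: "x \<in> {..<t} \<union> {q..<n}" "T = {t, t + 1, x}" unfolding G_def by blast
    have "{t, x} \<in> S_edges n t" "{t + 1, x} \<in> S_edges n t"
      using x(1) q(1,2) unfolding S_edges_iff q_def[symmetric] by auto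
    then show "T \<in> S_bi_plus n t" unfolding S_bi_plus_def x(2)
      by (intro triangleI[OF gp]) (auto simp: Splus_edges_def)
  qed
  moreover have "S_bi n t \<inter> G = {}"
  proof (rule ccontr)
    assume "S_bi n t \<inter> G \<noteq> {}"
    then obtain T where T: "T \<in> S_bi n t" "t \<in> T" "t + 1 \<in> T" by (auto simp: G_def)
    then have "{t, t + 1} \<in> S_edges n t" using triangleD[of T "{0..<n}" "S_edges n t" t "t + 1"] by (simp add: S_bi_def)
    then show False using q(1) unfolding S_edges_iff q_def[symmetric] by auto
  qed
  moreover have "finite (S_bi n t)" "finite G" "finite (S_bi_plus n t)"
    by (auto simp: S_bi_def S_bi_plus_def G_def intro: finite_triangles)
  ultimately have "card (S_bi n t) + card G \<le> card (S_bi_plus n t)"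
    using sub card_mono[of "S_bi_plus n t" "S_bi n t \<union> G"] by (simp add: card_Un_disjoint)
  then show ?thesis using cG card_S_bi[of t n] assms by simp
qed

section \<open>Both extremal numbers\<close>

lemma ex_triangles_eqI:
  assumes "graph_on {0..<n} E0" "\<not> contains_copy X F {0..<n} E0" "card (triangles {0..<n} E0) = c"
    and "\<And>E. graph_on {0..<n} E \<Longrightarrow> \<not> contains_copy X F {0..<n} E \<Longrightarrow> card (triangles {0..<n} E) \<le> c"
  shows "ex_triangles n X F = c"
  unfolding ex_triangles_def
proof (rule Max_eqI)
  show "finite {card (triangles {0..<n} E) |E. graph_on {0..<n} E \<and> \<not> contains_copy X F {0..<n} E}"
    by (rule finite_subset[of _ "{..c}"]) (use assms(4) in auto)
qed (use assms in auto)

theorem theorem1p9: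
  fixes t :: nat
  assumes "t \<ge> 2"
  shows "\<exists>N. \<forall>n\<ge>N.
    ex_triangles n (blowup_V (cycle_V (2*t+1)) (cycle_E (2*t+1)))
                   (blowup_E (cycle_V (2*t+1)) (cycle_E (2*t+1))) = card (S_bi n t) \<and>
    ex_triangles n (blowup_V (cycle_V (2*t+2)) (cycle_E (2*t+2)))
                   (blowup_E (cycle_V (2*t+2)) (cycle_E (2*t+2))) = card (S_bi_plus n t)"
proof -
  obtain N where N: "\<forall>(V :: nat set) E. graph_on V E \<longrightarrow> finite V \<longrightarrow> N \<le> card V \<longrightarrow>
    (\<not> lcyc E (2 * t + 1) \<longrightarrow> card (triangles V E) \<le> extremal_count t (card V)) \<and>
    (\<not> lcyc E (2 * t + 2) \<longrightarrow> card (triangles V E) \<le> extremal_count t (card V) + t + ((card V - t) - (card V - t) div 2))"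
    using triangles_upper_bound[OF assms] by (elim exE) (rule that)
  show ?thesis
  proof (intro exI[of _ "N + t + 4"] allI impI conjI)
    fix n assume n: "N + t + 4 \<le> n"
    have up: "\<not> lcyc E (2 * t + 1) \<Longrightarrow> card (triangles {0..<n} E) \<le> extremal_count t n"
      "\<not> lcyc E (2 * t + 2) \<Longrightarrow> card (triangles {0..<n} E) \<le> extremal_count t n + t + ((n - t) - (n - t) div 2)"
      if "graph_on {0..<n} E" for E :: "nat set set"
      using N[rule_format, OF that] n by auto
    show "ex_triangles n (blowup_V (cycle_V (2*t+1)) (cycle_E (2*t+1)))
      (blowup_E (cycle_V (2*t+1)) (cycle_E (2*t+1))) = card (S_bi n t)"
    proof (rule ex_triangles_eqI[OF S_edges_graph S_no_copy[OF assms]])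
      fix E assume E: "graph_on {0..<n} E"
        "\<not> contains_copy (blowup_V (cycle_V (2*t+1)) (cycle_E (2*t+1))) (blowup_E (cycle_V (2*t+1)) (cycle_E (2*t+1))) {0..<n} E"
      have "\<not> lcyc E (2 * t + 1)" using lcyc_contains_copy[OF E(1)] E(2) assms by fastforce
      then show "card (triangles {0..<n} E) \<le> card (S_bi n t)" using up(1)[OF E(1)] card_S_bi[of t n] n by simp
    qed (simp add: S_bi_def)
    show "ex_triangles n (blowup_V (cycle_V (2*t+2)) (cycle_E (2*t+2)))
      (blowup_E (cycle_V (2*t+2)) (cycle_E (2*t+2))) = card (S_bi_plus n t)"
    proof (rule ex_triangles_eqI[OF Splus_edges_graph Splus_no_copy[OF assms]])
      fix E assume E: "graph_on {0..<n} E"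
        "\<not> contains_copy (blowup_V (cycle_V (2*t+2)) (cycle_E (2*t+2))) (blowup_E (cycle_V (2*t+2)) (cycle_E (2*t+2))) {0..<n} E"
      have "\<not> lcyc E (2 * t + 2)" using lcyc_contains_copy[OF E(1)] E(2) assms by fastforce
      then show "card (triangles {0..<n} E) \<le> card (S_bi_plus n t)" using up(2)[OF E(1)] card_S_bi_plus[of t n] n by simp
    qed (use n in \<open>simp_all add: S_bi_plus_def\<close>)
  qed
qed

end
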